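(* Let $\mathcal F$ be an infinite set of $p$-tuples $f=(f_1,\ldots,f_p)$ of nowhere vanishing holomorphic functions on $\mathbb D$ satisfying the identity $$f_1+f_2+\cdots+f_p=0.$$ Then there exist disjoint non-empty subsets $I_1,\ldots,I_n\subset\{1,\ldots,p\}$ and an infinite subset $\mathcal G\subset\mathcal F$ with the following properties: (1) $n\ge 1$. (2) Let $k\in\{1,\ldots,n\}$. Then: (a) For all $i,j\in I_k$, the indexed family $(f_i/f_j)_{f\in\mathcal G}$ converges uniformly on compact subsets of $\mathbb D$ to a nowhere vanishing holomorphic function. (b) For all $j\in I_k$, the indexed family $\left(\sum_{i\in I_k}f_i/f_j\right)_{f\in\mathcal G}$ converges uniformly on compact subsets of $\mathbb D$ to $0$. In particular, $I_k$ contains at least two elements. (3) Set $I=I_1\sqcup\cdots\sqcup I_n$. Let $i\in\{1,\ldots,p\}-I$. Let $\varepsilon>0$, $s\in(0,1)$ and $\gamma>0$. Then there exists a finite subset $\mathcal E\subset\mathcal G$ such that for all $f\in\mathcal G-\mathcal E$ we have $$\frac{|f_i(z)|}{\sqrt{\sum_{j\in I}|f_j(z)|^2}}<\varepsilon$$ for $\gamma$-almost all $z\in\mathbb D(s)$.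
   Context: $\mathbb D$ is the unit disc in $\mathbb C$ and $\mathbb D(s)=\{z\in\mathbb D:|z|<s\}$. For an infinite index set $J$ and a metric space $(M,d)$, an indexed family $(h_i)_{i\in J}$ of functions $\mathbb D\to M$ converges uniformly on compact subsets of $\mathbb D$ to $h:\mathbb D\to M$ if for every compact $K\subset\mathbb D$ and every $\varepsilon>0$ there is a finite subset $F\subset J$ such that $d(h_i(z),h(z))<\varepsilon$ for all $z\in K$ and all $i\in J-F$. An infinite set is regarded as an indexed family indexed by itself. For $\gamma>0$ and an open set $W\subset\mathbb C$, an assertion about points $w\in W$ holds for $\gamma$-almost all $w\in W$ if it holds for all $w\in W$ except possibly those contained in a union of at most countably many closed discs the sum of whose radii is less than $\gamma$. *)

theory Defs
  imports "HOL-Complex_Analysis.Complex_Analysis"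
begin

abbreviation unit_disc :: "complex set" where
  "unit_disc \<equiv> ball 0 1"

text \<open>Members are extensional, i.e. take the value \<open>undefined\<close> off the disc, so that equality of HOL
  functions is equality of functions on the disc. Otherwise a set of tuples could be infinite
  merely because its members differ outside the disc.\<close>

definition nonvanishing_holomorphic :: "(complex \<Rightarrow> complex) set" where
  "nonvanishing_holomorphic =
     {g \<in> extensional unit_disc. g holomorphic_on unit_disc \<and> (\<forall>z\<in>unit_disc. g z \<noteq> 0)}"

definition nonvanishing_tuples :: "nat \<Rightarrow> (nat \<Rightarrow> complex \<Rightarrow> complex) set" where
  "nonvanishing_tuples p = {1..p} \<rightarrow>\<^sub>E nonvanishing_holomorphic"

text \<open>Convergence of an indexed family is along the complements of finite subsets of the index
  set \<open>J\<close>. It is only meaningful for infinite \<open>J\<close>.\<close>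

definition converges_on_compacts ::
    "'i set \<Rightarrow> ('i \<Rightarrow> complex \<Rightarrow> 'm::metric_space) \<Rightarrow> (complex \<Rightarrow> 'm) \<Rightarrow> bool" where
  "converges_on_compacts J h g \<longleftrightarrow>
     (\<forall>K. compact K \<and> K \<subseteq> unit_disc \<longrightarrow>
       (\<forall>\<epsilon>>0. \<exists>E. finite E \<and> E \<subseteq> J \<and> (\<forall>z\<in>K. \<forall>i\<in>J - E. dist (h i z) (g z) < \<epsilon>)))"

text \<open>The exceptional discs form a set \<open>C\<close> of pairs (centre, radius). Summability is required
  explicitly because \<open>infsum\<close> is 0 on families that are not summable.\<close>

definition holds_almost_all :: "real \<Rightarrow> complex set \<Rightarrow> (complex \<Rightarrow> bool) \<Rightarrow> bool" where
  "holds_almost_all \<gamma> W P \<longleftrightarrow>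
     (\<exists>C :: (complex \<times> real) set.
        countable C \<and> (\<forall>(c, r)\<in>C. r > 0) \<and>
        (\<lambda>(c, r). r) summable_on C \<and> (\<Sum>\<^sub>\<infinity>(c, r)\<in>C. r) < \<gamma> \<and>
        (\<forall>w\<in>W. w \<notin> (\<Union>(c, r)\<in>C. cball c r) \<longrightarrow> P w))"

end

theory Submission
  imports Defs "HOL-Real_Asymp.Real_Asymp"
begin

text \<open>
  A free ultrafilter on \<open>F\<close> replaces the passage to subsequences. Call \<open>i\<close> and \<open>j\<close> equivalent if
  \<open>\<bar>ln \<bar>f\<^sub>i / f\<^sub>j\<bar>\<bar>\<close> stays bounded on compact sets along the ultrafilter. Then \<open>f\<^sub>i / f\<^sub>j\<close> has a nowhere
  vanishing limit. Call a class null if the limits of \<open>f\<^sub>i / f\<^sub>j\<close>, summed over \<open>i\<close> in the class, add up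
  to \<open>0\<close>. The sets \<open>I\<^sub>k\<close> are the null classes.

  The heart of the matter is a comparison theorem: if \<open>a + \<Sum>\<^sub>j h\<^sub>j\<close> is extremely small, \<open>a\<close> is bounded and
  not small, and the units \<open>h\<^sub>j\<close> are bounded at some point, then some \<open>h\<^sub>j\<close> is comparable to \<open>1\<close>. It
  shows that the class of an index that is dominant at some point is null. Hence (3) even holds without
  exceptional discs.

  The comparison theorem is proved by induction on the number of terms. Let \<open>T\<close> be the maximum of the \<open>\<bar>ln \<bar>h\<^sub>j\<bar>\<bar>\<close> on
  a disc. If the maximum on a smaller disc is at least a fixed multiple of \<open>T\<close>, the functions \<open>ln \<bar>h\<^sub>j\<bar> / T\<close> have harmonic limits,
  not all constantly \<open>0\<close>, and the terms with limit \<open>0\<close> already satisfy a relation with error \<open>exp (- c * T)\<close>.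
  Otherwise, terms are eliminated one after the other by Wronskians. If all coefficients that arise are
  larger than \<open>exp (- c * T)\<close> for every \<open>c > 0\<close>, the last two terms give a second main theorem, which bounds the maximum on a
  disc by the logarithm of the maximum on a larger disc and thereby contradicts boundedness. If one
  coefficient is smaller, integrating the elimination back yields another approximate linear relation, with
  constant coefficients, and a shorter relation to which the induction hypothesis applies.
\<close>

section \<open>Harnack inequality and minimum modulus\<close>

text \<open>Quotients of terms from different classes can tend to 0 in one region and to infinity in
  another, so limits alone do not decide which terms cancel; the comparison theorem has to be
  quantitative. Its hypothesis is shaped by the induction: when a relation has been shortened, the
  remaining terms may have a much smaller logarithmic size \<open>M\<close> than the size
  \<open>T\<close> of the old ones. An error \<open>exp (- c * T)\<close> is then
  \<open>exp (- \<kappa> * M)\<close> with \<open>\<kappa>\<close> tending to infinity, which is the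
  form that reproduces itself. The class under study is collected in one function \<open>a\<close>;
  it may have zeros, so it can only be a coefficient, and elimination is set up for terms that are a
  coefficient times a unit. Zeros of coefficients are the obstacle throughout. A function of
  subexponential size that is not exponentially small at some point is not exponentially small on
  suitable whole circles; there division is allowed, and the maximum principle brings the result
  inside. The loss in this estimate is polynomial in the gaps between the radii, which is what the
  growth argument can afford.\<close>

lemma positive_real_part_bounds_strict:
  assumes hol: "g holomorphic_on ball c R" and R: "R > 0"
    and pos: "\<And>z. z \<in> ball c R \<Longrightarrow> Re (g z) > 0" and z: "z \<in> ball c R"
  defines "r \<equiv> dist z c"
  shows "cmod (g z - g c) \<le> 2 * Re (g c) * r / (R - r)"
    and "Re (g z) \<ge> Re (g c) * (R - r) / (R + r)"
proof -
  define p where "p = Re (g c)"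
  have p: "p > 0" using pos[of c] R by (simp add: p_def)
  have r: "0 \<le> r" "r < R" using z by (auto simp: r_def dist_commute)
  define t where "t = r / R"
  have t: "0 \<le> t" "t < 1" using r R by (auto simp: t_def)
  \<comment> \<open>The Cayley transform centred at \<open>g c\<close> maps the right half-plane to
    the disc, so the Schwarz lemma gives \<open>cmod (\<phi> w) \<le> cmod w\<close>. Both claims
    come from solving the resulting inequality \<open>D\<close>: the first for the modulus of
    \<open>g z - g c\<close> (Borel-Caratheodory), the second for its real part (Harnack).\<close>
  define \<phi> where "\<phi> w = (g (c + of_real R * w) - g c) / (g (c + of_real R * w) + cnj (g c))" for w
  have inb: "c + of_real R * w \<in> ball c R" if "cmod w < 1" for w
    using that R by (simp add: dist_norm norm_mult)
  have nz: "g (c + of_real R * w) + cnj (g c) \<noteq> 0" if "cmod w < 1" for w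
  proof
    assume "g (c + of_real R * w) + cnj (g c) = 0"
    then have "Re (g (c + of_real R * w) + cnj (g c)) = 0" by simp
    then show False using pos[OF inb[OF that]] p by (simp add: p_def)
  qed
  have hol\<phi>: "\<phi> holomorphic_on ball 0 1"
  proof -
    have "(\<lambda>w. g (c + of_real R * w)) holomorphic_on ball 0 1"
      using holomorphic_on_compose_gen[of "\<lambda>w. c + of_real R * w" "ball 0 1" g "ball c R"] hol inb
      by (force simp: o_def intro!: holomorphic_intros)
    then show ?thesis unfolding \<phi>_def using nz by (intro holomorphic_intros) auto
  qed
  have lt: "cmod (\<phi> w) < 1" if "cmod w < 1" for w
  proof -
    define a where "a = g (c + of_real R * w)"
    have ra: "Re a > 0" using pos[OF inb[OF that]] by (simp add: a_def)
    have "(cmod (a + cnj (g c)))\<^sup>2 - (cmod (a - g c))\<^sup>2 = 4 * Re a * p"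
      unfolding cmod_power2 p_def by (simp add: power2_eq_square algebra_simps)
    moreover have "4 * Re a * p > 0" using ra p by simp
    ultimately have "(cmod (a - g c))\<^sup>2 < (cmod (a + cnj (g c)))\<^sup>2" by linarith
    then have "cmod (a - g c) < cmod (a + cnj (g c))" using norm_ge_zero power2_less_imp_less by blast
    then show ?thesis unfolding \<phi>_def a_def[symmetric] norm_divide
      by (smt (verit) divide_less_eq_1 norm_ge_zero)
  qed
  define w where "w = (z - c) / of_real R"
  have w: "cmod w = t" using R by (simp add: w_def t_def r_def norm_divide dist_norm)
  have zw: "c + of_real R * w = z" using R by (simp add: w_def)
  have "cmod (\<phi> w) \<le> t"
    using Schwarz_Lemma(1)[OF hol\<phi> _ lt, of w] w t by (simp add: \<phi>_def)
  moreover have "\<phi> w * (g z + cnj (g c)) = g z - g c"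
    using nz[of w] w t zw by (simp add: \<phi>_def)
  ultimately have D: "cmod (g z - g c) \<le> t * cmod (g z + cnj (g c))"
    by (metis mult_right_mono norm_ge_zero norm_mult)
  have e: "g z + cnj (g c) = (g z - g c) + of_real (2 * p)"
    by (simp add: complex_eq_iff p_def)
  have "cmod (g z + cnj (g c)) \<le> cmod (g z - g c) + 2 * p"
    unfolding e using p by (metis norm_triangle_ineq abs_of_pos mult_pos_pos norm_of_real zero_less_numeral)
  then have "cmod (g z - g c) \<le> t * (cmod (g z - g c) + 2 * p)"
    using D t by (meson mult_left_mono order_trans)
  then have "cmod (g z - g c) * (1 - t) \<le> 2 * p * t" by (simp add: algebra_simps)
  then have "cmod (g z - g c) \<le> 2 * p * t / (1 - t)" using t by (simp add: pos_le_divide_eq)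
  also have "2 * p * t / (1 - t) = 2 * p * r / (R - r)"
    using R r by (simp add: t_def field_simps)
  finally show "cmod (g z - g c) \<le> 2 * Re (g c) * r / (R - r)" by (simp add: p_def)
  define x where "x = Re (g z - g c)"
  have xp: "x + p > 0" using pos[OF z] by (simp add: x_def p_def)
  have "(cmod (g z - g c))\<^sup>2 \<le> (t * cmod (g z + cnj (g c)))\<^sup>2"
    using D by (intro power_mono) auto
  then have "x\<^sup>2 + (Im (g z - g c))\<^sup>2 \<le> t\<^sup>2 * ((x + 2 * p)\<^sup>2 + (Im (g z - g c))\<^sup>2)"
    unfolding e power_mult_distrib cmod_power2 by (simp add: x_def)
  moreover have "t\<^sup>2 * (Im (g z - g c))\<^sup>2 \<le> 1 * (Im (g z - g c))\<^sup>2"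
    using t by (intro mult_right_mono) (auto simp: power_le_one)
  ultimately have "x\<^sup>2 \<le> t\<^sup>2 * (x + 2 * p)\<^sup>2" unfolding ring_distribs(1)[of "t\<^sup>2"] by linarith
  then have "x\<^sup>2 \<le> (t * (x + 2 * p))\<^sup>2"
    by (simp only: power_mult_distrib)
  then have "- x \<le> t * (x + 2 * p)"
    using abs_le_square_iff[of x "t * (x + 2 * p)"] t xp p by (simp add: abs_mult)
  then have "(x + p) * (1 + t) \<ge> p * (1 - t)" by (simp add: algebra_simps)
  then have "x + p \<ge> p * (1 - t) / (1 + t)" using t by (simp add: pos_divide_le_eq)
  also have "p * (1 - t) / (1 + t) = p * (R - r) / (R + r)"
  proof -
    have "1 - t = (R - r) / R" "1 + t = (R + r) / R" using R by (simp_all add: t_def field_simps)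
    then show ?thesis using R by simp
  qed
  finally show "Re (g z) \<ge> Re (g c) * (R - r) / (R + r)" by (simp add: p_def x_def)
qed

text \<open>The strict version for \<open>g + e\<close> with \<open>e > 0\<close>, followed by the
  limit \<open>e\<close> to \<open>0\<close>. The weak inequality is what normalised logarithms
  provide.\<close>

lemma positive_real_part_bounds:
  assumes hol: "g holomorphic_on ball c R" and R: "R > 0"
    and pos: "\<And>z. z \<in> ball c R \<Longrightarrow> Re (g z) \<ge> 0" and z: "z \<in> ball c R"
  defines "r \<equiv> dist z c"
  shows "cmod (g z - g c) \<le> 2 * Re (g c) * r / (R - r)"
    and "Re (g z) \<ge> Re (g c) * (R - r) / (R + r)"
proof -
  have r: "0 \<le> r" "r < R" using z by (auto simp: r_def dist_commute)
  have *: "cmod (g z - g c) \<le> 2 * (Re (g c) + e) * r / (R - r) \<and>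
      Re (g z) + e \<ge> (Re (g c) + e) * (R - r) / (R + r)" if "e > 0" for e
  proof -
    have "(\<lambda>z. g z + of_real e) holomorphic_on ball c R" by (intro holomorphic_intros hol)
    from positive_real_part_bounds_strict[OF this R _ z] that pos
    show ?thesis by (auto simp: r_def add_nonneg_pos)
  qed
  have ev: "eventually (\<lambda>e::real. e > 0) (at_right 0)" by (simp add: eventually_at_right_less)
  have "((\<lambda>e. 2 * (Re (g c) + e) * r / (R - r)) \<longlongrightarrow> 2 * (Re (g c) + 0) * r / (R - r)) (at_right 0)"
    using r by (intro tendsto_intros) auto
  moreover have "eventually (\<lambda>e. cmod (g z - g c) \<le> 2 * (Re (g c) + e) * r / (R - r)) (at_right 0)"
    using ev by eventually_elim (use * in blast)
  ultimately show "cmod (g z - g c) \<le> 2 * Re (g c) * r / (R - r)"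
    using tendsto_lowerbound by fastforce
  have "((\<lambda>e. Re (g z) + e - (Re (g c) + e) * (R - r) / (R + r)) \<longlongrightarrow>
     Re (g z) + 0 - (Re (g c) + 0) * (R - r) / (R + r)) (at_right 0)"
    using r R by (intro tendsto_intros) auto
  moreover have "eventually (\<lambda>e. 0 \<le> Re (g z) + e - (Re (g c) + e) * (R - r) / (R + r)) (at_right 0)"
    using ev by eventually_elim (use * in force)
  ultimately show "Re (g z) \<ge> Re (g c) * (R - r) / (R + r)"
    using tendsto_lowerbound by fastforce
qed

lemma ball_holomorphic_log:
  assumes "h holomorphic_on ball c R" "\<And>z. z \<in> ball c R \<Longrightarrow> h z \<noteq> 0"
  obtains g where "g holomorphic_on ball c R" "\<And>z. z \<in> ball c R \<Longrightarrow> h z = exp (g z)"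
    "\<And>z. z \<in> ball c R \<Longrightarrow> ln (cmod (h z)) = Re (g z)"
proof -
  have "contractible (ball c R)" by (intro convex_imp_contractible convex_ball)
  from contractible_imp_holomorphic_log[OF assms(1) this assms(2)] obtain g
    where g: "g holomorphic_on ball c R" "\<And>z. z \<in> ball c R \<Longrightarrow> h z = exp (g z)" by blast
  then show ?thesis using that by simp
qed

text \<open>Minus the logarithm of \<open>h\<close> has nonnegative real part. Passing from
  \<open>z\<close> to the centre and from the centre to \<open>z0\<close> costs a factor
  \<open>(R + r) / (R - r)\<close> each, hence the square.\<close>

lemma harnack_unit:
  assumes hol: "h holomorphic_on ball 0 R" and nz: "\<And>z. z \<in> ball 0 R \<Longrightarrow> h z \<noteq> 0"
    and le: "\<And>z. z \<in> ball 0 R \<Longrightarrow> cmod (h z) \<le> 1"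
    and r: "0 \<le> r" "r < R" and z: "z \<in> cball 0 r" and z0: "z0 \<in> cball 0 r"
  shows "- ln (cmod (h z)) \<le> ((R + r) / (R - r))\<^sup>2 * (- ln (cmod (h z0)))"
proof -
  obtain g where g: "g holomorphic_on ball 0 R" "\<And>z. z \<in> ball 0 R \<Longrightarrow> ln (cmod (h z)) = Re (g z)"
    using ball_holomorphic_log[OF hol nz] by metis
  let ?g = "\<lambda>z. - g z"
  have hg: "?g holomorphic_on ball 0 R" using g by (intro holomorphic_intros)
  have R: "R > 0" using r by simp
  have pos: "Re (?g z) \<ge> 0" if "z \<in> ball 0 R" for z
  proof -
    have "ln (cmod (h z)) \<le> 0" using le[OF that] nz[OF that] by simp
    then show ?thesis using g(2)[OF that] by simp
  qed
  have zb: "z \<in> ball 0 R" "z0 \<in> ball 0 R" using z z0 r by auto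
  note A = positive_real_part_bounds[OF hg R pos]
  define s where "s = cmod z" define s0 where "s0 = cmod z0"
  have s: "0 \<le> s" "s \<le> r" "0 \<le> s0" "s0 \<le> r" using z z0 by (auto simp: s_def s0_def)
  define p where "p = Re (?g 0)"
  have p: "p \<ge> 0" unfolding p_def using pos[of 0] R by simp
  have "Re (?g z) \<le> p + cmod (?g z - ?g 0)"
    using complex_Re_le_cmod[of "?g z - ?g 0"] by (simp add: p_def)
  also have "\<dots> \<le> p + 2 * p * s / (R - s)"
    using A(1)[OF _ zb(1)] by (auto simp: p_def s_def)
  also have "\<dots> \<le> p + 2 * p * r / (R - r)"
  proof -
    have "2 * p * s / (R - s) \<le> 2 * p * r / (R - r)"
      using s r p by (intro frac_le mult_left_mono) auto
    then show ?thesis by simp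
  qed
  also have "\<dots> = (R + r) / (R - r) * p" using r by (simp add: field_simps)
  finally have 1: "Re (?g z) \<le> (R + r) / (R - r) * p" .
  have "p * (R - r) / (R + r) \<le> p * (R - s0) / (R + s0)"
    using s r p R by (intro frac_le mult_left_mono mult_nonneg_nonneg) auto
  also have "\<dots> \<le> Re (?g z0)" using A(2)[OF _ zb(2)] by (auto simp: p_def s0_def)
  finally have "p * (R - r) \<le> Re (?g z0) * (R + r)" using r R by (simp add: pos_divide_le_eq)
  then have "p \<le> (R + r) / (R - r) * Re (?g z0)" using r R by (simp add: field_simps)
  then have "(R + r) / (R - r) * p \<le> (R + r) / (R - r) * ((R + r) / (R - r) * Re (?g z0))"
    using r by (intro mult_left_mono) auto
  with 1 have "Re (?g z) \<le> ((R + r) / (R - r))\<^sup>2 * Re (?g z0)"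
    by (simp only: power2_eq_square mult.assoc)
  then show ?thesis using g(2)[OF zb(1)] g(2)[OF zb(2)] by simp
qed

text \<open>The quotient is the derivative of a branch \<open>g\<close> of the logarithm. A bound
  for the real part of \<open>g\<close> alone bounds its oscillation on the circle of radius
  \<open>\<delta> / 2\<close> by \<open>4 * M\<close>, and Cauchy's inequality there contributes the
  factor \<open>2 / \<delta>\<close>.\<close>

lemma log_deriv_bound:
  assumes hol: "h holomorphic_on ball z \<delta>" and nz: "\<And>w. w \<in> ball z \<delta> \<Longrightarrow> h w \<noteq> 0"
    and \<delta>: "\<delta> > 0" and M: "\<And>w. w \<in> ball z \<delta> \<Longrightarrow> \<bar>ln (cmod (h w))\<bar> \<le> M"
  shows "cmod (deriv h z / h z) \<le> 8 * M / \<delta>"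
proof -
  obtain g where g: "g holomorphic_on ball z \<delta>" "\<And>w. w \<in> ball z \<delta> \<Longrightarrow> h w = exp (g w)"
     "\<And>w. w \<in> ball z \<delta> \<Longrightarrow> ln (cmod (h w)) = Re (g w)"
    using ball_holomorphic_log[OF hol nz] by metis
  have z: "z \<in> ball z \<delta>" using \<delta> by simp
  have dg: "(g has_field_derivative deriv g z) (at z)"
    using g(1) z by (meson holomorphic_derivI open_ball)
  have "((\<lambda>w. exp (g w)) has_field_derivative exp (g z) * deriv g z) (at z)"
    by (rule derivative_eq_intros dg refl)+
  then have "(h has_field_derivative exp (g z) * deriv g z) (at z)"
    by (rule has_field_derivative_transform_within_open[OF _ open_ball z]) (simp add: g(2))
  then have "deriv h z = exp (g z) * deriv g z" by (rule DERIV_imp_deriv)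
  then have eq: "deriv h z / h z = deriv g z" using g(2)[OF z] by simp
  define G where "G w = g w + of_real M" for w
  have hG: "G holomorphic_on ball z \<delta>" unfolding G_def by (intro holomorphic_intros g)
  have posG: "Re (G w) \<ge> 0" if "w \<in> ball z \<delta>" for w
    using M[OF that] g(3)[OF that] by (simp add: G_def)
  have "Re (G z) \<le> 2 * M" using M[OF z] g(3)[OF z] by (simp add: G_def)
  have b: "cmod (g w - g z) \<le> 4 * M" if "dist z w = \<delta> / 2" for w
  proof -
    have w: "w \<in> ball z \<delta>" using that \<delta> by simp
    have "cmod (G w - G z) \<le> 2 * Re (G z) * (\<delta>/2) / (\<delta> - \<delta>/2)"
      using positive_real_part_bounds(1)[OF hG \<delta> posG w] that unfolding dist_commute[of w z] by (simp only:)
    also have "\<dots> = 2 * Re (G z)" using \<delta> by (simp add: field_simps)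
    finally show ?thesis using \<open>Re (G z) \<le> 2 * M\<close> by (simp add: G_def)
  qed
  have sub: "cball z (\<delta>/2) \<subseteq> ball z \<delta>" using \<delta> by auto
  have "cmod ((deriv ^^ 1) (\<lambda>w. g w - g z) z) \<le> fact 1 * (4 * M) / (\<delta>/2) ^ 1"
  proof (rule Cauchy_inequality)
    have *: "(\<lambda>w. g w - g z) holomorphic_on ball z \<delta>" by (intro holomorphic_intros g)
    show "(\<lambda>w. g w - g z) holomorphic_on ball z (\<delta>/2)"
      by (rule holomorphic_on_subset[OF *]) (use \<delta> in auto)
    show "continuous_on (cball z (\<delta>/2)) (\<lambda>w. g w - g z)"
      by (rule continuous_on_subset[OF holomorphic_on_imp_continuous_on[OF *] sub])
  qed (use \<delta> b in \<open>auto simp: dist_norm\<close>)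
  moreover have "deriv (\<lambda>w. g w - g z) z = deriv g z"
    using dg by (intro DERIV_imp_deriv) (auto intro!: derivative_eq_intros)
  ultimately show ?thesis using eq by simp
qed

lemma deriv_bound:
  assumes hol: "f holomorphic_on ball z \<delta>" and \<delta>: "\<delta> > 0"
    and B: "\<And>w. w \<in> ball z \<delta> \<Longrightarrow> cmod (f w) \<le> B"
  shows "cmod (deriv f z) \<le> 2 * B / \<delta>"
proof -
  have sub: "cball z (\<delta>/2) \<subseteq> ball z \<delta>" using \<delta> by auto
  have "cmod ((deriv ^^ 1) f z) \<le> fact 1 * B / (\<delta>/2) ^ 1"
  proof (rule Cauchy_inequality)
    show "f holomorphic_on ball z (\<delta>/2)"
      by (rule holomorphic_on_subset[OF hol]) (use \<delta> in auto)
    show "continuous_on (cball z (\<delta>/2)) f"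
      by (rule continuous_on_subset[OF holomorphic_on_imp_continuous_on[OF hol] sub])
    show "cmod (f x) \<le> B" if "cmod (z - x) = \<delta>/2" for x
      using B[of x] that \<delta> by (simp add: dist_norm)
  qed (use \<delta> in auto)
  then show ?thesis by (simp add: mult.commute)
qed

section \<open>Zeros of bounded functions: Blaschke factors and the minimum modulus on
  circles\<close>

lemma blaschke_divide:
  assumes hol: "Y holomorphic_on ball 0 1" and le: "\<And>z. z \<in> ball 0 1 \<Longrightarrow> cmod (Y z) \<le> 1"
    and a: "cmod a < 1" and Ya: "Y a = 0"
  obtains Y' where "Y' holomorphic_on ball 0 1" "\<And>z. z \<in> ball 0 1 \<Longrightarrow> cmod (Y' z) \<le> 1"
    "\<And>z. z \<in> ball 0 1 \<Longrightarrow> Y z = Moebius_function 0 a z * Y' z"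
proof -
  have nz: "1 - cnj a * z \<noteq> 0" if "cmod z < 1" for z
  proof
    assume "1 - cnj a * z = 0"
    then have "cmod (cnj a * z) = 1" by simp
    moreover have "cmod (cnj a * z) < 1"
      using a that norm_mult_less[of "cnj a" 1 z 1] by simp
    ultimately show False by simp
  qed
  define q where "q z = (if z = a then deriv Y a else (Y z - Y a) / (z - a))" for z
  define Y' where "Y' z = q z * (1 - cnj a * z)" for z
  have hq: "q holomorphic_on ball 0 1"
    unfolding q_def by (rule pole_lemma_open[OF hol open_ball])
  then have hY': "Y' holomorphic_on ball 0 1" unfolding Y'_def by (intro holomorphic_intros)
  have eq: "Y z = Moebius_function 0 a z * Y' z" if "z \<in> ball 0 1" for z
    using nz[of z] that by (auto simp: Y'_def q_def Moebius_function_simple Ya)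
  have le1: "cmod (Y z) \<le> cmod (Moebius_function 0 a z)" if z: "z \<in> ball 0 1" for z
  proof -
    define w where "w = Moebius_function 0 a z"
    have w: "cmod w < 1" using a z Moebius_function_norm_lt_1 by (simp add: w_def)
    have mw: "Moebius_function 0 (-a) w = z"
      unfolding w_def using a z by (intro Moebius_function_compose) auto
    \<comment> \<open>The Schwarz lemma for \<open>Y\<close> in the coordinate that moves
      \<open>a\<close> to \<open>0\<close>. Only the weak bound \<open>cmod (Y z) \<le> 1\<close> is
      given, so \<open>Y\<close> is first multiplied by some \<open>t < 1\<close>; letting
      \<open>t\<close> tend to \<open>1\<close> removes the factor.\<close>
    have *: "t * cmod (Y z) \<le> cmod w" if t: "0 < t" "t < 1" for t
    proof -
      define f where "f \<zeta> = of_real t * Y (Moebius_function 0 (-a) \<zeta>)" for \<zeta>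
      have m: "Moebius_function 0 (-a) \<zeta> \<in> ball 0 1" if "cmod \<zeta> < 1" for \<zeta>
        using a that Moebius_function_norm_lt_1[of "-a" \<zeta>] by simp
      have "f holomorphic_on ball 0 1"
        unfolding f_def
        using holomorphic_on_compose_gen[OF Moebius_function_holomorphic[of "-a" 0] hol] a m
        by (intro holomorphic_intros) (force simp: o_def)
      moreover have "f 0 = 0" by (simp add: f_def Moebius_function_simple Ya)
      moreover have "cmod (f \<zeta>) < 1" if "cmod \<zeta> < 1" for \<zeta>
      proof -
        have "cmod (f \<zeta>) \<le> t * 1"
          unfolding f_def norm_mult using t le[OF m[OF that]] by (intro mult_mono) auto
        then show ?thesis using t by simp
      qed
      ultimately have "cmod (f w) \<le> cmod w" using Schwarz_Lemma(1) w by blast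
      then show ?thesis using t by (simp add: f_def mw norm_mult)
    qed
    have "((\<lambda>t. t * cmod (Y z)) \<longlongrightarrow> 1 * cmod (Y z)) (at_left (1::real))"
      by (intro tendsto_intros)
    moreover have "eventually (\<lambda>t. t * cmod (Y z) \<le> cmod w) (at_left (1::real))"
      by (rule eventually_mono[OF eventually_at_left_real[of 0 1]]) (use * in auto)
    ultimately show ?thesis
      using tendsto_upperbound[of _ "1 * cmod (Y z)" "at_left (1::real)" "cmod w"]
      by (fastforce simp: w_def trivial_limit_at_left_real)
  qed
  have le2: "cmod (Y' z) \<le> 1" if z: "z \<in> ball 0 1" "z \<noteq> a" for z
  proof -
    have "Moebius_function 0 a z \<noteq> 0" using z nz[of z] by (auto simp: Moebius_function_simple)
    moreover have "cmod (Moebius_function 0 a z) * cmod (Y' z) \<le> cmod (Moebius_function 0 a z) * 1"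
      using le1[OF z(1)] eq[OF z(1)] by (simp add: norm_mult)
    ultimately show ?thesis using mult_le_cancel_left_pos[of "cmod (Moebius_function 0 a z)"] by auto
  qed
  have "cmod (Y' a) \<le> 1"
  proof -
    have "isCont Y' a"
      using hY' a by (simp add: continuous_on_interior[OF holomorphic_on_imp_continuous_on] interior_open)
    then have "((\<lambda>z. cmod (Y' z)) \<longlongrightarrow> cmod (Y' a)) (at a)"
      by (intro tendsto_norm) (simp add: isCont_def)
    moreover have "eventually (\<lambda>z. cmod (Y' z) \<le> 1) (at a)"
      using eventually_at_in_open[of "ball 0 1" a] a le2 by (auto elim!: eventually_mono)
    ultimately show ?thesis using tendsto_upperbound[of "\<lambda>z. cmod (Y' z)" "cmod (Y' a)" "at a" 1] by simp
  qed
  with le2 hY' eq that show ?thesis by metis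
qed

text \<open>Pseudo-hyperbolic geometry: with \<open>x\<close>, \<open>y\<close> the moduli of
  \<open>a\<close>, \<open>z\<close> and \<open>d\<close> that of the denominator, \<open>1 -
  m\<^sup>2 = (1 - x\<^sup>2) * (1 - y\<^sup>2) / d\<^sup>2\<close>, and the right-hand side is at
  least \<open>\<delta>\<^sup>2 / 4\<close>. The exponential form is suited to multiplying many
  factors.\<close>

lemma Moebius_function_upper:
  assumes r: "0 < \<delta>" "\<delta> < 1" and a: "cmod a \<le> 1 - \<delta>/2" and z: "cmod z \<le> 1 - \<delta>"
  shows "cmod (Moebius_function 0 a z) \<le> exp (- (\<delta>\<^sup>2 / 8))"
proof -
  define x where "x = cmod a" define y where "y = cmod z"
  have xy: "0 \<le> x" "x \<le> 1 - \<delta>/2" "0 \<le> y" "y \<le> 1 - \<delta>" using a z by (auto simp: x_def y_def)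
  define d where "d = cmod (1 - cnj a * z)"
  have "cmod (cnj a * z) < 1"
    using norm_mult_less[of "cnj a" 1 z 1] xy r by (simp add: x_def y_def)
  then have dp: "d > 0" by (auto simp: d_def)
  have d: "d \<le> 1 + x * y"
    unfolding d_def x_def y_def using norm_triangle_ineq4[of 1 "cnj a * z"] by (simp add: norm_mult)
  have e: "(cmod (z - a))\<^sup>2 = d\<^sup>2 - (1 - x\<^sup>2) * (1 - y\<^sup>2)"
    unfolding d_def x_def y_def cmod_power2 by (simp add: power2_eq_square algebra_simps)
  define m where "m = cmod (Moebius_function 0 a z)"
  have "m\<^sup>2 = (cmod (z - a))\<^sup>2 / d\<^sup>2"
    by (simp add: m_def Moebius_function_simple norm_divide d_def power_divide)
  also have "\<dots> = 1 - (1 - x\<^sup>2) * (1 - y\<^sup>2) / d\<^sup>2" using dp e by (simp add: field_simps)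
  finally have m2: "m\<^sup>2 = 1 - (1 - x\<^sup>2) * (1 - y\<^sup>2) / d\<^sup>2" .
  have "d\<^sup>2 \<le> (1 + x * y)\<^sup>2" using d dp by (intro power_mono) auto
  also have "\<dots> \<le> 2 * (1 + x * y)"
  proof -
    have "x * y \<le> 1" using xy r by (intro mult_le_one) auto
    then have "(1 + x * y) * (1 + x * y) \<le> 2 * (1 + x * y)" using xy by (intro mult_right_mono) auto
    then show ?thesis by (simp add: power2_eq_square)
  qed
  also have "\<dots> \<le> 2 * ((1 + x) * (1 + y))" using xy by (simp add: algebra_simps)
  finally have d2: "d\<^sup>2 \<le> 2 * ((1 + x) * (1 + y))" .
  have "(\<delta>/2) * \<delta> \<le> (1 - x) * (1 - y)" using xy r by (intro mult_mono) auto
  then have "\<delta>\<^sup>2 / 4 * (2 * ((1 + x) * (1 + y))) \<le> (1 - x) * (1 - y) * ((1 + x) * (1 + y))"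
    using xy mult_right_mono[of "(\<delta>/2) * \<delta>" "(1 - x) * (1 - y)" "(1 + x) * (1 + y)"]
    by (simp add: power2_eq_square)
  also have "\<dots> = (1 - x\<^sup>2) * (1 - y\<^sup>2)" by (simp add: power2_eq_square algebra_simps)
  finally have "\<delta>\<^sup>2 / 4 * d\<^sup>2 \<le> (1 - x\<^sup>2) * (1 - y\<^sup>2)"
    using mult_left_mono[OF d2, of "\<delta>\<^sup>2 / 4"] by simp
  then have "\<delta>\<^sup>2 / 4 \<le> (1 - x\<^sup>2) * (1 - y\<^sup>2) / d\<^sup>2" using dp by (simp add: pos_le_divide_eq)
  then have "m\<^sup>2 \<le> 1 + (- (\<delta>\<^sup>2 / 4))" using m2 by simp
  also have "\<dots> \<le> exp (- (\<delta>\<^sup>2 / 4))" by (rule exp_ge_add_one_self)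
  also have "\<dots> = (exp (- (\<delta>\<^sup>2 / 8)))\<^sup>2" by (simp add: power2_eq_square flip: exp_add)
  finally have "m\<^sup>2 \<le> (exp (- (\<delta>\<^sup>2 / 8)))\<^sup>2" .
  then show ?thesis unfolding m_def by (rule power2_le_imp_le) simp
qed

lemma Moebius_function_lower:
  assumes "cmod a < 1" "cmod z < 1"
  shows "cmod (Moebius_function 0 a z) \<ge> cmod (z - a) / 2"
proof -
  have c: "cmod (cnj a * z) < 1" using norm_mult_less[of "cnj a" 1 z 1] assms by simp
  then have "cmod (1 - cnj a * z) \<le> 2"
    using norm_triangle_ineq4[of 1 "cnj a * z"] by simp
  moreover have "cmod (1 - cnj a * z) > 0" using c by auto
  ultimately have "cmod (z - a) / 2 \<le> cmod (z - a) / cmod (1 - cnj a * z)"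
    by (intro divide_left_mono mult_pos_pos) auto
  then show ?thesis by (simp add: Moebius_function_simple norm_divide)
qed

text \<open>Each factor is at most \<open>exp (- \<delta>\<^sup>2 / 8)\<close> at \<open>z0\<close>, which bounds the number of factors; with a
  maximal number of them, the remaining function has no zeros left.\<close>

lemma blaschke_factorization:
  assumes hol: "y holomorphic_on ball 0 1" and le: "\<And>z. z \<in> ball 0 1 \<Longrightarrow> cmod (y z) \<le> 1"
    and \<delta>: "0 < \<delta>" "\<delta> < 1" and z0: "cmod z0 \<le> 1 - \<delta>" and yz0: "cmod (y z0) \<ge> exp (- L)"
  obtains as Y where "Y holomorphic_on ball 0 1" "\<And>z. z \<in> ball 0 1 \<Longrightarrow> cmod (Y z) \<le> 1"
    "\<And>z. z \<in> cball 0 (1 - \<delta>/2) \<Longrightarrow> Y z \<noteq> 0"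
    "\<And>a. a \<in> set as \<Longrightarrow> cmod a \<le> 1 - \<delta>/2"
    "\<And>z. z \<in> ball 0 1 \<Longrightarrow> y z = (\<Prod>a\<leftarrow>as. Moebius_function 0 a z) * Y z"
    "real (length as) \<le> 8 * L / \<delta>\<^sup>2"
    "cmod (Y z0) \<ge> exp (- L)"
proof -
  define P where "P N \<longleftrightarrow> (\<exists>as Y. length as = N \<and> Y holomorphic_on ball 0 1 \<and>
     (\<forall>z\<in>ball 0 1. cmod (Y z) \<le> 1) \<and> (\<forall>a\<in>set as. cmod a \<le> 1 - \<delta>/2) \<and>
     (\<forall>z\<in>ball 0 1. y z = (\<Prod>a\<leftarrow>as. Moebius_function 0 a z) * Y z))" for N
  have prod: "cmod (\<Prod>a\<leftarrow>as. Moebius_function 0 a z0) \<le> exp (- (\<delta>\<^sup>2 / 8)) ^ length as"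
    if "\<forall>a\<in>set as. cmod a \<le> 1 - \<delta>/2" for as
    using that
  proof (induction as)
    case (Cons a as)
    have "cmod (Moebius_function 0 a z0 * (\<Prod>a\<leftarrow>as. Moebius_function 0 a z0))
        \<le> exp (- (\<delta>\<^sup>2 / 8)) * exp (- (\<delta>\<^sup>2 / 8)) ^ length as"
      unfolding norm_mult
      using Moebius_function_upper[OF \<delta> _ z0, of a] Cons by (intro mult_mono) auto
    then show ?case by simp
  qed simp
  have z0b: "z0 \<in> ball 0 1" using z0 \<delta> by simp
  have bd: "real N \<le> 8 * L / \<delta>\<^sup>2" if PN: "P N" for N
  proof -
    obtain as Y where A: "length as = N" "Y holomorphic_on ball 0 1" "\<forall>z\<in>ball 0 1. cmod (Y z) \<le> 1"
      "\<forall>a\<in>set as. cmod a \<le> 1 - \<delta>/2"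
      "\<forall>z\<in>ball 0 1. y z = (\<Prod>a\<leftarrow>as. Moebius_function 0 a z) * Y z"
      using PN unfolding P_def by blast
    have "exp (- L) \<le> cmod (\<Prod>a\<leftarrow>as. Moebius_function 0 a z0) * cmod (Y z0)"
      using yz0 A(5) z0b by (simp add: norm_mult)
    also have "\<dots> \<le> exp (- (\<delta>\<^sup>2 / 8)) ^ length as * 1"
      using prod[OF A(4)] A(3) z0b by (intro mult_mono) auto
    also have "\<dots> = exp (- (real N * \<delta>\<^sup>2 / 8))" by (simp add: A(1) flip: exp_of_nat_mult)
    finally have "real N * \<delta>\<^sup>2 / 8 \<le> L" by simp
    then show ?thesis using \<delta> by (simp add: field_simps)
  qed
  have P0: "P 0" unfolding P_def using hol le by (intro exI[of _ "[]"] exI[of _ y]) auto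
  have "N \<le> nat \<lceil>8 * L / \<delta>\<^sup>2\<rceil>" if "P N" for N
    using bd[OF that] by linarith
  then obtain N where N: "P N" "\<And>m. P m \<Longrightarrow> m \<le> N"
    using Nat.ex_has_greatest_nat[of P 0 "nat \<lceil>8 * L / \<delta>\<^sup>2\<rceil>"] P0 by auto
  obtain as Y where A: "length as = N" "Y holomorphic_on ball 0 1" "\<forall>z\<in>ball 0 1. cmod (Y z) \<le> 1"
      "\<forall>a\<in>set as. cmod a \<le> 1 - \<delta>/2"
      "\<forall>z\<in>ball 0 1. y z = (\<Prod>a\<leftarrow>as. Moebius_function 0 a z) * Y z"
    using N(1) unfolding P_def by blast
  have nz: "Y b \<noteq> 0" if b: "b \<in> cball 0 (1 - \<delta>/2)" for b
  proof
    assume Yb: "Y b = 0"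
    have "cmod b < 1" using b \<delta> by simp
    from blaschke_divide[OF A(2) _ this Yb] A(3) obtain Y' where Y': "Y' holomorphic_on ball 0 1"
      "\<And>z. z \<in> ball 0 1 \<Longrightarrow> cmod (Y' z) \<le> 1"
      "\<And>z. z \<in> ball 0 1 \<Longrightarrow> Y z = Moebius_function 0 b z * Y' z" by blast
    have "P (Suc N)" unfolding P_def
      using Y' A b by (intro exI[of _ "b # as"] exI[of _ Y']) auto
    then show False using N(2) by fastforce
  qed
  have "cmod (Y z0) \<ge> exp (- L)"
  proof -
    have "exp (- L) \<le> cmod (\<Prod>a\<leftarrow>as. Moebius_function 0 a z0) * cmod (Y z0)"
      using yz0 A(5) z0b by (simp add: norm_mult)
    also have "\<dots> \<le> 1 * cmod (Y z0)"
      using prod[OF A(4)] power_le_one[of "exp (- (\<delta>\<^sup>2 / 8))" "length as"]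
      by (intro mult_right_mono) auto
    finally show ?thesis by simp
  qed
  then show ?thesis using that[of Y as] A nz bd[OF N(1)] by auto
qed

text \<open>A good point is found by averaging. An antiderivative of \<open>ln \<bar>x\<bar>\<close>
  is \<open>\<psi> x = x * ln \<bar>x\<bar> - x\<close>, bounded by \<open>1\<close> for
  \<open>\<bar>x\<bar> \<le> 2\<close>, so the integral of the sum is at least
  \<open>- 2 * length ts\<close>. The lemma yields radii that avoid the distances to given zeros
  quantitatively.\<close>

lemma exists_log_distance_sum_ge:
  fixes ts :: "real list"
  assumes \<rho>: "\<rho>1 < \<rho>2" and ts: "\<And>t. t \<in> set ts \<Longrightarrow> \<bar>\<rho>1 - t\<bar> \<le> 2 \<and> \<bar>\<rho>2 - t\<bar> \<le> 2"
  obtains \<rho> where "\<rho>1 \<le> \<rho>" "\<rho> \<le> \<rho>2" "\<rho> \<notin> set ts"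
    "(\<Sum>t\<leftarrow>ts. ln \<bar>\<rho> - t\<bar>) \<ge> - 3 * length ts / (\<rho>2 - \<rho>1)"
proof (cases "ts = []")
  case True
  then show ?thesis using that[of \<rho>1] \<rho> by auto
next
  case False
  define el where "el = \<rho>2 - \<rho>1"
  have el: "el > 0" using \<rho> by (simp add: el_def)
  define \<psi> :: "real \<Rightarrow> real" where "\<psi> x = x * ln \<bar>x\<bar> - x" for x
  define G where "G x = (\<Sum>t\<leftarrow>ts. \<psi> (x - t))" for x
  define f where "f x = (\<Sum>t\<leftarrow>ts. ln \<bar>x - t\<bar>)" for x
  have \<psi>1: "\<bar>\<psi> x\<bar> \<le> 1" if "\<bar>x\<bar> \<le> 2" for x
  proof -
    have *: "\<bar>y * ln y - y\<bar> \<le> 1" if y: "0 < y" "y \<le> 2" for y :: real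
    proof -
      have "ln (1 / y) \<le> 1 / y - 1" using y by (intro ln_le_minus_one) auto
      then have "y * ln (1/y) \<le> y * (1 / y - 1)" using y by (intro mult_left_mono) auto
      then have "y * ln y \<ge> y - 1" using y by (simp add: ln_div algebra_simps)
      moreover have "ln y \<le> 1"
        using ln_le_cancel_iff[of y 2] y ln_2_less_1 by linarith
      then have "y * ln y \<le> y * 1" using y by (intro mult_left_mono) auto
      ultimately show ?thesis using y by linarith
    qed
    consider "x = 0" | "x > 0" | "x < 0" by linarith
    then show ?thesis
    proof cases
      case 3
      then have "\<psi> x = - ((-x) * ln (-x) - (-x))" by (simp add: \<psi>_def)
      then show ?thesis using *[of "-x"] that 3 by (simp only: abs_minus_cancel)
    qed (use * that in \<open>auto simp: \<psi>_def\<close>)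
  qed
  have cont0: "continuous_on UNIV \<psi>"
  proof -
    have "isCont \<psi> x" for x
    proof (cases "x = 0")
      case True
      have "((\<lambda>x::real. x * ln \<bar>x\<bar> - x) \<longlongrightarrow> 0) (at_right 0)" "((\<lambda>x::real. x * ln \<bar>x\<bar> - x) \<longlongrightarrow> 0) (at_left 0)"
        by real_asymp+
      then have "((\<lambda>x::real. x * ln \<bar>x\<bar> - x) \<longlongrightarrow> 0) (at 0)"
        using filterlim_split_at by blast
      then show ?thesis using True by (simp add: isCont_def \<psi>_def[abs_def])
    qed (auto simp: \<psi>_def[abs_def] intro!: continuous_intros)
    then show ?thesis by (simp add: continuous_at_imp_continuous_on)
  qed
  have contG: "continuous_on {\<rho>1..\<rho>2} G"
  proof -
    have "continuous_on {\<rho>1..\<rho>2} (\<lambda>x. \<Sum>t\<leftarrow>us. \<psi> (x - t))" for us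
    proof (induction us)
      case (Cons u us)
      have "continuous_on {\<rho>1..\<rho>2} (\<lambda>x. \<psi> (x - u))"
        by (rule continuous_on_compose2[OF cont0]) (auto intro!: continuous_intros)
      then show ?case using Cons by (auto intro!: continuous_intros)
    qed simp
    then show ?thesis by (simp add: G_def[abs_def])
  qed
  have derG: "(G has_vector_derivative f x) (at x)" if "x \<in> {\<rho>1<..<\<rho>2} - set ts" for x
  proof -
    have "((\<lambda>x. \<Sum>t\<leftarrow>us. \<psi> (x - t)) has_real_derivative (\<Sum>t\<leftarrow>us. ln \<bar>x - t\<bar>)) (at x)"
      if "x \<notin> set us" for us
      using that
    proof (induction us)
      case (Cons u us)
      have xu: "x - u \<noteq> 0" using Cons by simp
      have "((\<lambda>x. \<psi> (x - u)) has_real_derivative ln \<bar>x - u\<bar>) (at x)"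
      proof (cases "x - u > 0")
        case True
        have "((\<lambda>x. (x - u) * ln (x - u) - (x - u)) has_real_derivative ln \<bar>x - u\<bar>) (at x)"
          using True by (auto intro!: derivative_eq_intros)
        moreover have "eventually (\<lambda>x. x > u) (at x)"
          using True eventually_at_in_open'[of "{u<..}" x] by simp
        then have "eventually (\<lambda>x. (x - u) * ln (x - u) - (x - u) = \<psi> (x - u)) (nhds x)"
          using eventually_nhds_in_open[of "{u<..}" x] True by (auto elim!: eventually_mono simp: \<psi>_def)
        ultimately show ?thesis by (rule DERIV_cong_ev[THEN iffD1, OF refl _ refl, rotated])
      next
        case False
        then have lt: "x < u" using xu by simp
        have "((\<lambda>x. (x - u) * ln (u - x) - (x - u)) has_real_derivative ln \<bar>x - u\<bar>) (at x)"
          using lt by (auto intro!: derivative_eq_intros simp: abs_if divide_simps)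
        moreover have "eventually (\<lambda>x. (x - u) * ln (u - x) - (x - u) = \<psi> (x - u)) (nhds x)"
          using eventually_nhds_in_open[of "{..<u}" x] lt by (auto elim!: eventually_mono simp: \<psi>_def abs_if)
        ultimately show ?thesis by (rule DERIV_cong_ev[THEN iffD1, OF refl _ refl, rotated])
      qed
      then show ?case using Cons by (auto intro!: derivative_intros)
    qed simp
    then show ?thesis using that
      by (simp add: G_def[abs_def] f_def has_real_derivative_iff_has_vector_derivative)
  qed
  have int: "(f has_integral (G \<rho>2 - G \<rho>1)) {\<rho>1..\<rho>2}"
    by (rule fundamental_theorem_of_calculus_interior_strong[of "set ts"]) (use \<rho> derG contG in auto)
  have Gl: "G \<rho>2 - G \<rho>1 \<ge> - 2 * length ts"
  proof -
    have "(\<Sum>t\<leftarrow>us. \<psi> (\<rho>2 - t)) - (\<Sum>t\<leftarrow>us. \<psi> (\<rho>1 - t)) \<ge> - 2 * length us"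
      if "set us \<subseteq> set ts" for us
      using that
    proof (induction us)
      case (Cons u us)
      have "\<bar>\<psi> (\<rho>2 - u)\<bar> \<le> 1" "\<bar>\<psi> (\<rho>1 - u)\<bar> \<le> 1" using Cons.prems ts \<psi>1 by auto
      then show ?case using Cons by simp
    qed simp
    then show ?thesis by (simp add: G_def)
  qed
  have "\<exists>\<rho>. \<rho>1 \<le> \<rho> \<and> \<rho> \<le> \<rho>2 \<and> \<rho> \<notin> set ts \<and> f \<rho> \<ge> - 3 * length ts / el"
  proof (rule ccontr)
    assume "\<not> ?thesis"
    then have lt: "f x \<le> - 3 * length ts / el" if "x \<in> {\<rho>1..\<rho>2} - set ts" for x
      using that by force
    \<comment> \<open>At the points of \<open>ts\<close> the convention \<open>ln 0 = 0\<close> may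
      spoil the upper bound, so the function is altered there; finitely many points do not affect
      the integral. The constant 3 against 2 gives the contradiction.\<close>
    define f' where "f' x = (if x \<in> set ts then - 3 * length ts / el else f x)" for x
    have "(f' has_integral (G \<rho>2 - G \<rho>1)) {\<rho>1..\<rho>2}"
      by (rule has_integral_spike_finite[OF _ _ int, of "set ts"]) (auto simp: f'_def)
    moreover have "((\<lambda>x. - 3 * length ts / el) has_integral (\<rho>2 - \<rho>1) *\<^sub>R (- 3 * length ts / el)) {\<rho>1..\<rho>2}"
      using has_integral_const_real[of "- 3 * length ts / el" \<rho>1 \<rho>2] \<rho> by simp
    ultimately have "G \<rho>2 - G \<rho>1 \<le> (\<rho>2 - \<rho>1) *\<^sub>R (- 3 * length ts / el)"
      by (rule has_integral_le) (use lt in \<open>auto simp: f'_def\<close>)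
    also have "\<dots> = - 3 * length ts" using el by (simp add: el_def[symmetric])
    finally show False using Gl \<open>ts \<noteq> []\<close> length_greater_0_conv[of ts] by (simp del: length_greater_0_conv)
  qed
  then show ?thesis using that by (auto simp: f_def el_def)
qed


text \<open>The zeros in the disc of radius \<open>1 - \<delta>/2\<close> are split off as Blaschke
  factors, at most \<open>8 * L / \<delta>\<^sup>2\<close> of them. A suitable circle keeps their
  product away from zero at the cost
  \<open>32 * L / (\<delta>\<^sup>2 * (\<rho>2 - \<rho>1))\<close>; Harnack bounds the zero-free
  factor at the cost \<open>16 * L / \<delta>\<^sup>2\<close>. As
  \<open>\<rho>2 - \<rho>1 \<le> 1\<close>, together this gives 48.\<close>

lemma minimum_modulus_circle_unit:
  assumes hol: "y holomorphic_on ball 0 1" and le: "\<And>z. z \<in> ball 0 1 \<Longrightarrow> cmod (y z) \<le> 1"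
    and \<delta>: "0 < \<delta>" "\<delta> < 1" and z0: "cmod z0 \<le> 1 - \<delta>" and yz0: "cmod (y z0) \<ge> exp (- L)"
    and \<rho>: "0 \<le> \<rho>1" "\<rho>1 < \<rho>2" and sub: "cball \<zeta> \<rho>2 \<subseteq> cball 0 (1 - \<delta>)"
  obtains \<rho> where "\<rho>1 \<le> \<rho>" "\<rho> \<le> \<rho>2"
    "\<And>z. z \<in> sphere \<zeta> \<rho> \<Longrightarrow> cmod (y z) \<ge> exp (- (48 / (\<delta>\<^sup>2 * (\<rho>2 - \<rho>1))) * L)"
proof -
  obtain as Y where Y: "Y holomorphic_on ball 0 1" "\<And>z. z \<in> ball 0 1 \<Longrightarrow> cmod (Y z) \<le> 1"
    and Ynz: "\<And>z. z \<in> cball 0 (1 - \<delta>/2) \<Longrightarrow> Y z \<noteq> 0"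
    and as: "\<And>a. a \<in> set as \<Longrightarrow> cmod a \<le> 1 - \<delta>/2"
    and yeq: "\<And>z. z \<in> ball 0 1 \<Longrightarrow> y z = (\<Prod>a\<leftarrow>as. Moebius_function 0 a z) * Y z"
    and N: "real (length as) \<le> 8 * L / \<delta>\<^sup>2" and Yz0: "cmod (Y z0) \<ge> exp (- L)"
    using blaschke_factorization[OF hol le \<delta> z0 yz0] by metis
  define el where "el = \<rho>2 - \<rho>1"
  have "\<zeta> \<in> cball 0 (1 - \<delta>)" using subsetD[OF sub, of \<zeta>] \<rho> by simp
  then have z1: "cmod \<zeta> \<le> 1" using \<delta> by simp
  have el: "0 < el" "el \<le> 1" "\<rho>2 \<le> 1"
  proof -
    have "\<rho>2 \<le> 1 - \<delta>"
      using sub \<rho> \<delta> by (subst (asm) cball_subset_cball_iff) (auto simp: dist_norm, use norm_ge_zero[of \<zeta>] in linarith)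
    then show "0 < el" "el \<le> 1" "\<rho>2 \<le> 1" using \<rho> \<delta> by (auto simp: el_def)
  qed
  define ts where "ts = map (\<lambda>a. dist \<zeta> a) as"
  have tsb: "\<bar>\<rho>1 - t\<bar> \<le> 2 \<and> \<bar>\<rho>2 - t\<bar> \<le> 2" if t: "t \<in> set ts" for t
  proof -
    obtain a where a: "a \<in> set as" "t = dist \<zeta> a" using t by (auto simp: ts_def)
    have "dist \<zeta> a \<le> cmod \<zeta> + cmod a" by (metis dist_norm norm_triangle_ineq4)
    also have "\<dots> \<le> 2" using as[OF a(1)] z1 \<delta> by linarith
    finally have "t \<le> 2" "t \<ge> 0" using a by auto
    then show ?thesis using el \<rho> by linarith
  qed
  obtain \<rho> where \<rho>': "\<rho>1 \<le> \<rho>" "\<rho> \<le> \<rho>2" "\<rho> \<notin> set ts"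
    and sum: "(\<Sum>t\<leftarrow>ts. ln \<bar>\<rho> - t\<bar>) \<ge> - 3 * length ts / el"
    unfolding el_def using exists_log_distance_sum_ge[OF \<rho>(2) tsb] by blast
  show ?thesis
  proof (rule that[OF \<rho>'(1,2)])
    fix z assume z: "z \<in> sphere \<zeta> \<rho>"
    then have zc: "z \<in> cball 0 (1 - \<delta>)" using sub \<rho>' by auto
    then have zb: "z \<in> ball 0 1" using \<delta> by auto
    have prod: "ln (cmod (\<Prod>a\<leftarrow>bs. Moebius_function 0 a z)) \<ge> (\<Sum>t\<leftarrow>map (\<lambda>a. dist \<zeta> a) bs. ln \<bar>\<rho> - t\<bar>) - length bs
        \<and> (\<Prod>a\<leftarrow>bs. Moebius_function 0 a z) \<noteq> 0" if "set bs \<subseteq> set as" for bs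
      using that
    proof (induction bs)
      case (Cons a bs)
      have a: "a \<in> set as" using Cons by simp
      define m where "m = cmod (Moebius_function 0 a z)"
      have r: "\<bar>\<rho> - dist \<zeta> a\<bar> > 0" using \<rho>' a by (auto simp: ts_def)
      \<comment> \<open>On a circle about \<open>\<zeta>\<close> the distance to a zero is at least
        the difference of the radii, which turns the choice of the circle into a problem on the
        line.\<close>
      have "\<bar>dist \<zeta> z - dist \<zeta> a\<bar> \<le> dist z a"
        by (metis abs_dist_diff_le dist_commute)
      then have "\<bar>\<rho> - dist \<zeta> a\<bar> \<le> cmod (z - a)" using z by (simp add: dist_norm)
      also have "\<dots> / 2 \<le> m"
        unfolding m_def using as[OF a] \<delta> zb by (intro Moebius_function_lower) auto
      finally have m: "\<bar>\<rho> - dist \<zeta> a\<bar> / 2 \<le> m" by simp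
      then have mpos: "m > 0" using r half_gt_zero less_le_trans by blast
      have "ln (\<bar>\<rho> - dist \<zeta> a\<bar> / 2) \<le> ln m" using m r mpos by (subst ln_le_cancel_iff) auto
      moreover have "ln (\<bar>\<rho> - dist \<zeta> a\<bar> / 2) = ln \<bar>\<rho> - dist \<zeta> a\<bar> - ln 2"
        using r by (simp add: ln_div)
      moreover have "ln 2 < (1::real)" by (rule ln_2_less_1)
      ultimately have "ln m \<ge> ln \<bar>\<rho> - dist \<zeta> a\<bar> - 1" by linarith
      moreover have nz: "Moebius_function 0 a z \<noteq> 0" using mpos by (auto simp: m_def)
      ultimately show ?case using Cons
        by (auto simp: norm_mult ln_mult m_def)
    qed simp
    define p where "p = (\<Prod>a\<leftarrow>as. Moebius_function 0 a z)"
    have p: "ln (cmod p) \<ge> - 3 * length as / el - length as" "p \<noteq> 0"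
      using prod[of as] sum unfolding ts_def[symmetric] by (auto simp: p_def ts_def)
    have Ynz': "Y z \<noteq> 0" using Ynz[of z] zc \<delta> by simp
    have rr: "0 \<le> 1 - \<delta>" "1 - \<delta> < 1 - \<delta>/2" using \<delta> by auto
    have "- ln (cmod (Y z)) \<le> (((1 - \<delta>/2) + (1 - \<delta>)) / ((1 - \<delta>/2) - (1 - \<delta>)))\<^sup>2 * (- ln (cmod (Y z0)))"
    proof (rule harnack_unit[OF _ _ _ rr zc])
      show "Y holomorphic_on ball 0 (1 - \<delta> / 2)"
        by (rule holomorphic_on_subset[OF Y(1)]) (use \<delta> in auto)
      show "\<And>z. z \<in> ball 0 (1 - \<delta> / 2) \<Longrightarrow> Y z \<noteq> 0" using Ynz by auto
      show "\<And>z. z \<in> ball 0 (1 - \<delta> / 2) \<Longrightarrow> cmod (Y z) \<le> 1" using Y(2) \<delta> by auto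
      show "z0 \<in> cball 0 (1 - \<delta>)" using z0 by simp
    qed
    also have "\<dots> \<le> (2 / (\<delta>/2))\<^sup>2 * L"
    proof (intro mult_mono power_mono)
      show "((1 - \<delta>/2) + (1 - \<delta>)) / ((1 - \<delta>/2) - (1 - \<delta>)) \<le> 2 / (\<delta>/2)"
        using \<delta> by (intro frac_le) auto
      have "ln (cmod (Y z0)) \<ge> ln (exp (- L))"
        by (intro ln_mono) (use Yz0 in \<open>auto intro: less_le_trans[OF exp_gt_zero]\<close>)
      then show "- ln (cmod (Y z0)) \<le> L" by simp
      have "Y z0 \<noteq> 0" using Ynz[of z0] z0 \<delta> by auto
      then show "0 \<le> - ln (cmod (Y z0))" using Y(2)[of z0] z0 \<delta> by simp
    qed (use \<delta> in auto)
    finally have lY: "ln (cmod (Y z)) \<ge> - (16 * L / \<delta>\<^sup>2)"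
      using \<delta> by (simp add: power_divide field_simps)
    have L0: "L \<ge> 0"
    proof -
      have "0 \<le> 8 * L / \<delta>\<^sup>2" using N order_trans of_nat_0_le_iff by blast
      then show ?thesis using \<delta> by (simp add: zero_le_divide_iff)
    qed
    have "3 * length as / el + length as \<le> 4 * length as / el"
    proof -
      have "real (length as) * el \<le> real (length as) * 1" using el by (intro mult_left_mono) auto
      then show ?thesis using el by (simp add: field_simps)
    qed
    also have "\<dots> \<le> 4 * (8 * L / \<delta>\<^sup>2) / el"
      using N el by (intro divide_right_mono mult_left_mono) auto
    finally have lp: "ln (cmod p) \<ge> - (32 * L / \<delta>\<^sup>2 / el)" using p(1) by simp
    have "16 * L / \<delta>\<^sup>2 \<le> 16 * L / \<delta>\<^sup>2 / el"
    proof -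
      have "16 * L / \<delta>\<^sup>2 / 1 \<le> 16 * L / \<delta>\<^sup>2 / el" using el L0 by (intro divide_left_mono) auto
      then show ?thesis by simp
    qed
    then have "ln (cmod (Y z)) + ln (cmod p) \<ge> - (48 * L / \<delta>\<^sup>2 / el)"
      using lY lp by (simp add: add_divide_distrib[symmetric])
    then have "ln (cmod (y z)) \<ge> - (48 * L / \<delta>\<^sup>2 / el)"
      using yeq[OF zb] p(2) Ynz' by (simp add: norm_mult ln_mult p_def[symmetric])
    moreover have "y z \<noteq> 0" using yeq[OF zb] p(2) Ynz' by (simp add: p_def[symmetric])
    ultimately have "cmod (y z) \<ge> exp (- (48 * L / \<delta>\<^sup>2 / el))"
      by (subst (asm) ln_ge_iff) auto
    then show "cmod (y z) \<ge> exp (- (48 / (\<delta>\<^sup>2 * (\<rho>2 - \<rho>1))) * L)"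
      by (simp add: el_def field_simps)
  qed
qed

text \<open>The dependence of the constant on \<open>R - r\<close> and \<open>\<rho>2 - \<rho>1\<close> is polynomial; the growth argument needs this.\<close>

lemma minimum_modulus_circle:
  assumes hol: "y holomorphic_on ball 0 R" and le: "\<And>z. z \<in> ball 0 R \<Longrightarrow> cmod (y z) \<le> exp A"
    and r: "0 < r" "r < R" "R \<le> 1" and z0: "z0 \<in> cball 0 r" and yz0: "cmod (y z0) \<ge> exp (- B)"
    and \<rho>: "0 \<le> \<rho>1" "\<rho>1 < \<rho>2" and sub: "cball \<zeta> \<rho>2 \<subseteq> cball 0 r" and A: "A \<ge> 0"
  obtains \<rho> where "\<rho>1 \<le> \<rho>" "\<rho> \<le> \<rho>2"
    "\<And>z. z \<in> sphere \<zeta> \<rho> \<Longrightarrow> cmod (y z) \<ge> exp (- (48 / ((R - r)\<^sup>2 * (\<rho>2 - \<rho>1))) * (A + B))"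
proof -
  \<comment> \<open>Normalised to the unit disc and to the bound \<open>1\<close>; the lower bound
    at \<open>z0\<close> becomes \<open>exp (- (A + B))\<close>.\<close>
  define y1 where "y1 w = of_real (exp (- A)) * y (of_real R * w)" for w
  have R: "R > 0" using r by simp
  have inb: "of_real R * w \<in> ball 0 R" if "w \<in> ball 0 1" for w :: complex
  proof -
    have "R * cmod w < R * 1" using that R by (intro mult_strict_left_mono) auto
    then show ?thesis using R by (simp add: norm_mult)
  qed
  have hol1: "y1 holomorphic_on ball 0 1"
  proof -
    have "(\<lambda>w. y (of_real R * w)) holomorphic_on ball 0 1"
      using holomorphic_on_compose_gen[of "\<lambda>w. of_real R * w" "ball 0 1" y "ball 0 R"] hol inb
      by (force simp: o_def intro!: holomorphic_intros)
    then show ?thesis unfolding y1_def by (intro holomorphic_intros)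
  qed
  have le1: "cmod (y1 w) \<le> 1" if "w \<in> ball 0 1" for w
  proof -
    have "cmod (y1 w) = exp (- A) * cmod (y (of_real R * w))" by (simp add: y1_def norm_mult)
    also have "\<dots> \<le> exp (- A) * exp A" using le[OF inb[OF that]] by (intro mult_left_mono) auto
    finally show ?thesis by (simp flip: exp_add)
  qed
  define \<delta> where "\<delta> = (R - r) / R"
  have \<delta>: "0 < \<delta>" "\<delta> < 1" using r by (auto simp: \<delta>_def field_simps)
  have d1: "1 - \<delta> = r / R" using R by (simp add: \<delta>_def field_simps)
  have z0': "cmod (z0 / of_real R) \<le> 1 - \<delta>"
    using z0 R by (simp add: d1 norm_divide divide_right_mono)
  have y0: "cmod (y1 (z0 / of_real R)) \<ge> exp (- (A + B))"
  proof -
    have "cmod (y1 (z0 / of_real R)) = exp (- A) * cmod (y z0)" using R by (simp add: y1_def norm_mult)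
    moreover have "exp (- (A + B)) = exp (- A) * exp (- B)" by (simp flip: exp_add)
    ultimately show ?thesis using yz0 by (simp add: mult_left_mono)
  qed
  have sub': "cball (\<zeta> / of_real R) (\<rho>2 / R) \<subseteq> cball 0 (1 - \<delta>)"
  proof
    fix w assume "w \<in> cball (\<zeta> / of_real R) (\<rho>2 / R)"
    then have "cmod (\<zeta> / of_real R - w) * R \<le> \<rho>2" using R by (simp add: dist_norm field_simps)
    also have "cmod (\<zeta> / of_real R - w) * R = cmod ((\<zeta> / of_real R - w) * of_real R)"
      using R by (simp add: norm_mult)
    also have "(\<zeta> / of_real R - w) * of_real R = \<zeta> - of_real R * w" using R by (simp add: field_simps)
    finally have "of_real R * w \<in> cball 0 r" using sub by (auto simp: dist_norm)
    then show "w \<in> cball 0 (1 - \<delta>)" using R by (simp add: d1 norm_mult field_simps)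
  qed
  have "\<rho>1 / R < \<rho>2 / R" "0 \<le> \<rho>1 / R" using \<rho> R by (auto simp: divide_strict_right_mono)
  then obtain \<rho> where \<rho>': "\<rho>1 / R \<le> \<rho>" "\<rho> \<le> \<rho>2 / R"
    and lb: "\<And>w. w \<in> sphere (\<zeta> / of_real R) \<rho> \<Longrightarrow>
      cmod (y1 w) \<ge> exp (- (48 / (\<delta>\<^sup>2 * (\<rho>2/R - \<rho>1/R))) * (A + B))"
    using minimum_modulus_circle_unit[OF hol1 le1 \<delta> z0' y0 _ _ sub'] by metis
  have AB: "A + B \<ge> 0"
  proof -
    have "z0 / of_real R \<in> ball 0 1" using z0' \<delta> by simp
    from order_trans[OF y0 le1[OF this]] show ?thesis by simp
  qed
  show ?thesis
  proof (rule that[of "R * \<rho>"])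
    show "\<rho>1 \<le> R * \<rho>" "R * \<rho> \<le> \<rho>2" using \<rho>' R by (auto simp: field_simps)
    fix z assume z: "z \<in> sphere \<zeta> (R * \<rho>)"
    have "cmod (\<zeta> / of_real R - z / of_real R) = \<rho>"
      using z R by (simp add: dist_norm norm_divide flip: diff_divide_distrib)
    then have "z / of_real R \<in> sphere (\<zeta> / of_real R) \<rho>" by (simp add: dist_norm)
    note lb[OF this]
    also have "cmod (y1 (z / of_real R)) = exp (- A) * cmod (y z)"
      using R by (simp add: y1_def norm_mult)
    also have "\<dots> \<le> 1 * cmod (y z)" using A by (intro mult_right_mono) auto
    finally have 1: "cmod (y z) \<ge> exp (- (48 / (\<delta>\<^sup>2 * (\<rho>2/R - \<rho>1/R))) * (A + B))" by simp
    \<comment> \<open>The rescaling by \<open>R\<close> multiplies the constant by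
      \<open>R ^ 3\<close>, which is at most \<open>1\<close>.\<close>
    have "48 / (\<delta>\<^sup>2 * (\<rho>2/R - \<rho>1/R)) \<le> 48 / ((R - r)\<^sup>2 * (\<rho>2 - \<rho>1))"
    proof (rule divide_left_mono)
      have "R ^ 3 \<le> 1" using r R by (intro power_le_one) auto
      moreover have "\<delta>\<^sup>2 * (\<rho>2/R - \<rho>1/R) * R ^ 3 = (R - r)\<^sup>2 * (\<rho>2 - \<rho>1)"
        using R by (simp add: \<delta>_def power2_eq_square power3_eq_cube field_simps)
      moreover have "\<delta>\<^sup>2 * (\<rho>2/R - \<rho>1/R) * R ^ 3 \<le> \<delta>\<^sup>2 * (\<rho>2/R - \<rho>1/R) * 1"
        using \<open>R ^ 3 \<le> 1\<close> \<rho> R by (intro mult_left_mono) (auto simp: divide_right_mono)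
      ultimately show "(R - r)\<^sup>2 * (\<rho>2 - \<rho>1) \<le> \<delta>\<^sup>2 * (\<rho>2/R - \<rho>1/R)" by simp
      show "0 < \<delta>\<^sup>2 * (\<rho>2 / R - \<rho>1 / R) * ((R - r)\<^sup>2 * (\<rho>2 - \<rho>1))"
        using \<delta> \<rho> R r by (auto intro!: mult_pos_pos simp: divide_strict_right_mono)
    qed simp
    then have "48 / (\<delta>\<^sup>2 * (\<rho>2/R - \<rho>1/R)) * (A + B) \<le> 48 / ((R - r)\<^sup>2 * (\<rho>2 - \<rho>1)) * (A + B)"
      using AB by (rule mult_right_mono)
    then have "exp (- (48 / ((R - r)\<^sup>2 * (\<rho>2 - \<rho>1))) * (A + B)) \<le> exp (- (48 / (\<delta>\<^sup>2 * (\<rho>2/R - \<rho>1/R))) * (A + B))"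
      by simp
    with 1 show "cmod (y z) \<ge> exp (- (48 / ((R - r)\<^sup>2 * (\<rho>2 - \<rho>1))) * (A + B))" by linarith
  qed
qed

section \<open>Elimination by iterated Wronskians\<close>

text \<open>The Wronskian of \<open>\<alpha> j * h j\<close> and \<open>\<alpha> k * h k\<close>,
  divided by \<open>h j * h k\<close>. This leaves only logarithmic derivatives of the units, which
  are bounded linearly in their logarithmic size, whereas the units themselves may be exponentially
  large.\<close>

definition elim_step :: "(nat \<Rightarrow> complex \<Rightarrow> complex) \<Rightarrow> nat \<Rightarrow> (nat \<Rightarrow> complex \<Rightarrow> complex) \<Rightarrow> nat \<Rightarrow> complex \<Rightarrow> complex"
  where "elim_step h k \<alpha> j z =
    (deriv (\<alpha> j) z + \<alpha> j z * (deriv (h j) z / h j z)) * \<alpha> k z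
      - \<alpha> j z * (deriv (\<alpha> k) z + \<alpha> k z * (deriv (h k) z / h k z))"

text \<open>The head of the list is the last pivot. Up to a unit factor, \<open>elim_op\<close> is the iterated
  Wronskian with the pivot terms, and it maps \<open>\<alpha> j * h j\<close> to \<open>elim_coeff h \<alpha> ks j * h j\<close>.\<close>

fun elim_coeff :: "(nat \<Rightarrow> complex \<Rightarrow> complex) \<Rightarrow> (nat \<Rightarrow> complex \<Rightarrow> complex) \<Rightarrow> nat list \<Rightarrow> nat \<Rightarrow> complex \<Rightarrow> complex" where
  "elim_coeff h \<alpha> [] = \<alpha>"
| "elim_coeff h \<alpha> (k # ks) = elim_step h k (elim_coeff h \<alpha> ks)"

fun elim_op :: "(nat \<Rightarrow> complex \<Rightarrow> complex) \<Rightarrow> (nat \<Rightarrow> complex \<Rightarrow> complex) \<Rightarrow> nat list \<Rightarrow> (complex \<Rightarrow> complex) \<Rightarrow> complex \<Rightarrow> complex" where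
  "elim_op h \<alpha> [] x = x"
| "elim_op h \<alpha> (k # ks) x = (\<lambda>z. deriv (elim_op h \<alpha> ks x) z * elim_coeff h \<alpha> ks k z
      - elim_op h \<alpha> ks x z * (deriv (elim_coeff h \<alpha> ks k) z + elim_coeff h \<alpha> ks k z * (deriv (h k) z / h k z)))"

lemma deriv_eq_on_open:
  assumes "open S" "z \<in> S" "\<And>w. w \<in> S \<Longrightarrow> f w = g w"
  shows "deriv f z = deriv g z"
  using assms by (intro deriv_cong_ev refl eventually_nhds_in_open[THEN eventually_mono]) auto

lemma norm_diff_mult_le:
  fixes a b c d :: "'a::real_normed_algebra"
  assumes "norm a \<le> A" "norm b \<le> B" "norm c \<le> C" "norm d \<le> D"
  shows "norm (a * b - c * d) \<le> A * B + C * D"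
proof -
  have "0 \<le> A" "0 \<le> C" using assms norm_ge_zero order_trans by blast+
  then have "norm a * norm b \<le> A * B" "norm c * norm d \<le> C * D"
    using assms by (auto intro!: mult_mono)
  then show ?thesis
    by (meson add_mono norm_mult_ineq norm_triangle_ineq4 order_trans)
qed

locale unit_family =
  fixes h \<alpha> :: "nat \<Rightarrow> complex \<Rightarrow> complex" and J :: "nat set"
  assumes hol_h: "\<And>j. j \<in> J \<Longrightarrow> h j holomorphic_on unit_disc"
    and h_nz: "\<And>j z. j \<in> J \<Longrightarrow> z \<in> unit_disc \<Longrightarrow> h j z \<noteq> 0"
    and hol_\<alpha>: "\<And>j. j \<in> J \<Longrightarrow> \<alpha> j holomorphic_on unit_disc"
begin

abbreviation "C ks \<equiv> elim_coeff h \<alpha> ks"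
abbreviation "V ks \<equiv> elim_op h \<alpha> ks"
abbreviation "L j z \<equiv> deriv (h j) z / h j z"

lemma hol_C: "set ks \<subseteq> J \<Longrightarrow> j \<in> J \<Longrightarrow> C ks j holomorphic_on unit_disc"
proof (induction ks arbitrary: j)
  case (Cons k ks)
  show ?case unfolding elim_coeff.simps elim_step_def[abs_def]
    using Cons hol_h h_nz by (intro holomorphic_intros) auto
qed (simp add: hol_\<alpha>)

lemma hol_V: "set ks \<subseteq> J \<Longrightarrow> x holomorphic_on unit_disc \<Longrightarrow> V ks x holomorphic_on unit_disc"
proof (induction ks)
  case (Cons k ks)
  show ?case unfolding elim_op.simps
    using Cons hol_h h_nz hol_C by (intro holomorphic_intros) auto
qed simp

text \<open>The Wronskian of a term with itself vanishes, and later steps map a zero coefficient to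
  zero. Thus only terms outside \<open>ks\<close> survive.\<close>

lemma C_pivot: "set ks \<subseteq> J \<Longrightarrow> k \<in> set ks \<Longrightarrow> z \<in> unit_disc \<Longrightarrow> C ks k z = 0"
proof (induction ks arbitrary: z)
  case (Cons l ks)
  show ?case
  proof (cases "k = l")
    case False
    then have k: "\<And>w. w \<in> unit_disc \<Longrightarrow> C ks k w = 0" using Cons by simp
    have "deriv (C ks k) z = deriv (\<lambda>_. 0) z"
      by (rule deriv_eq_on_open[OF open_ball Cons.prems(3) k])
    then show ?thesis using k[OF Cons.prems(3)] by (simp add: elim_step_def)
  qed (simp add: elim_step_def algebra_simps)
qed simp

lemma V_term:
  "set ks \<subseteq> J \<Longrightarrow> j \<in> J \<Longrightarrow> z \<in> unit_disc \<Longrightarrow> V ks (\<lambda>w. \<alpha> j w * h j w) z = C ks j z * h j z"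
proof (induction ks arbitrary: z)
  case (Cons k ks)
  let ?x = "\<lambda>w. \<alpha> j w * h j w"
  have eq: "\<And>w. w \<in> unit_disc \<Longrightarrow> V ks ?x w = C ks j w * h j w" using Cons by simp
  have "deriv (V ks ?x) z = deriv (\<lambda>w. C ks j w * h j w) z"
    by (rule deriv_eq_on_open[OF open_ball Cons.prems(3) eq])
  also have "\<dots> = C ks j z * deriv (h j) z + deriv (C ks j) z * h j z"
  proof (rule DERIV_imp_deriv, rule DERIV_mult')
    show "(C ks j has_field_derivative deriv (C ks j) z) (at z)"
      using hol_C[of ks j] Cons.prems by (intro holomorphic_derivI) auto
    show "(h j has_field_derivative deriv (h j) z) (at z)"
      using hol_h[of j] Cons.prems by (intro holomorphic_derivI) auto
  qed
  finally show ?case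
    using eq[OF Cons.prems(3)] h_nz[OF Cons.prems(2,3)] by (simp add: elim_step_def field_simps)
qed simp

lemma V_lincomb:
  assumes "set ks \<subseteq> J" "x holomorphic_on unit_disc" "y holomorphic_on unit_disc" "z \<in> unit_disc"
  shows "V ks (\<lambda>w. x w + c * y w) z = V ks x z + c * V ks y z"
  using assms
proof (induction ks arbitrary: z)
  case (Cons k ks)
  have eq: "\<And>w. w \<in> unit_disc \<Longrightarrow> V ks (\<lambda>w. x w + c * y w) w = V ks x w + c * V ks y w" using Cons by simp
  have "deriv (V ks (\<lambda>w. x w + c * y w)) z = deriv (\<lambda>w. V ks x w + c * V ks y w) z"
    by (rule deriv_eq_on_open[OF open_ball Cons.prems(4) eq])
  also have "\<dots> = deriv (V ks x) z + c * deriv (V ks y) z"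
  proof (rule DERIV_imp_deriv, rule DERIV_add)
    show "(V ks x has_field_derivative deriv (V ks x) z) (at z)"
      using hol_V[of ks x] Cons.prems by (intro holomorphic_derivI) auto
    have "(V ks y has_field_derivative deriv (V ks y) z) (at z)"
      using hol_V[of ks y] Cons.prems by (intro holomorphic_derivI) auto
    then show "((\<lambda>w. c * V ks y w) has_field_derivative c * deriv (V ks y) z) (at z)"
      by (rule DERIV_cmult)
  qed
  finally have D: "deriv (V ks (\<lambda>w. x w + c * y w)) z = deriv (V ks x) z + c * deriv (V ks y) z" .
  have "(a + c * b) * m - (x + c * y) * l = a * m - x * l + c * (b * m - y * l)" for a b m l x y :: complex
    by (simp add: algebra_simps)
  then show ?case unfolding elim_op.simps D eq[OF Cons.prems(4)] .
qed simp

lemma V_sum: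
  assumes "set ks \<subseteq> J" "finite S" "\<And>s. s \<in> S \<Longrightarrow> x s holomorphic_on unit_disc" "z \<in> unit_disc"
  shows "V ks (\<lambda>w. \<Sum>s\<in>S. x s w) z = (\<Sum>s\<in>S. V ks (x s) z)"
  using assms(2,3)
proof (induction S)
  case empty
  have "V ks (\<lambda>w. 0 + (- 1) * 0) z = V ks (\<lambda>w. 0) z + (- 1) * V ks (\<lambda>w. 0) z"
    by (rule V_lincomb) (use assms in auto)
  then show ?case by simp
next
  case (insert s S)
  have "V ks (\<lambda>w. x s w + 1 * (\<Sum>s\<in>S. x s w)) z = V ks (x s) z + 1 * V ks (\<lambda>w. \<Sum>s\<in>S. x s w) z"
    by (rule V_lincomb) (use assms insert in \<open>auto intro!: holomorphic_intros\<close>)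
  then show ?case using insert by simp
qed

text \<open>With \<open>m\<close> a bound for a coefficient, \<open>2 * m / d\<close> is Cauchy's
  estimate of its derivative and \<open>m * E\<close> accounts for the logarithmic derivative. The
  base \<open>6 * E / d\<close> is at least \<open>1\<close>, so its powers can be compared by their
  exponents.\<close>

lemma coeff_bound_step:
  fixes d E m :: real
  assumes d: "0 < d" "d \<le> 1" and E: "E \<ge> 1" and m: "m \<ge> 0"
  shows "2 * m / d + m * E \<le> (6 * E / d) / 2 * m" "E \<le> 6 * E / d" "1 \<le> 6 * E / d"
proof -
  have 1: "1 \<le> E / d" using E d by (simp add: pos_le_divide_eq)
  have "E * d \<le> E * 1" using E d by (intro mult_left_mono) auto
  then have 2: "E \<le> E / d" using d by (simp add: pos_le_divide_eq)
  have "1 / d \<le> E / d" using E d by (simp add: divide_right_mono)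
  then have "2 * (1 / d) + E \<le> 3 * (E / d)" using 2 by linarith
  then have "m * (2 * (1 / d) + E) \<le> m * (3 * (E / d))" using m by (intro mult_left_mono) auto
  then show "2 * m / d + m * E \<le> (6 * E / d) / 2 * m" by (simp add: algebra_simps)
  show "E \<le> 6 * E / d" using 2 E by simp
  then show "1 \<le> 6 * E / d" using E by linarith
qed

text \<open>Each elimination differentiates once more, and Cauchy's estimate uses up a further strip
  of width \<open>d\<close>.\<close>

lemma shrink_ball:
  fixes r d :: real and z :: complex
  assumes d: "0 < d" and r: "r \<le> 1" and z: "z \<in> ball 0 (r - real (Suc n) * d)"
  shows "ball z d \<subseteq> ball 0 (r - real n * d)" "z \<in> ball 0 r" "z \<in> ball 0 (r - real n * d)"
    "ball 0 (r - real n * d) \<subseteq> unit_disc"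
proof -
  show *: "ball z d \<subseteq> ball 0 (r - real n * d)"
  proof
    fix w :: complex assume "w \<in> ball z d"
    then have "cmod w < d + cmod z" using norm_triangle_ineq2[of w z] by (simp add: dist_norm norm_minus_commute)
    then show "w \<in> ball 0 (r - real n * d)" using z by (simp add: algebra_simps)
  qed
  then show "z \<in> ball 0 (r - real n * d)" using subsetD[OF *, of z] d by simp
  have "0 \<le> real (Suc n) * d" "0 \<le> real n * d" using d by auto
  then show "z \<in> ball 0 r" "ball 0 (r - real n * d) \<subseteq> unit_disc" using z r by auto
qed

text \<open>If \<open>X ^ e\<close> with \<open>X = 6 * E / d\<close> bounds the coefficients before
  a step, then \<open>X ^ (1 + 2 * e)\<close> bounds them after it, and \<open>4 * e\<close> is
  enough as an exponent because \<open>e \<ge> 1\<close>. What matters later is that the bound is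
  polynomial in \<open>E / d\<close>.\<close>

lemma elim_coeff_bound:
  fixes d E r :: real
  assumes ks: "set ks \<subseteq> J" and d: "0 < d" "d \<le> 1" and E: "E \<ge> 1" and r: "r \<le> 1"
    and \<alpha>: "\<And>j z. j \<in> J \<Longrightarrow> z \<in> ball 0 r \<Longrightarrow> cmod (\<alpha> j z) \<le> E"
    and L: "\<And>j z. j \<in> J \<Longrightarrow> z \<in> ball 0 r \<Longrightarrow> cmod (L j z) \<le> E"
    and j: "j \<in> J" and z: "z \<in> ball 0 (r - length ks * d)"
  shows "cmod (C ks j z) \<le> (6 * E / d) ^ (4 ^ length ks)"
  using ks j z
proof (induction ks arbitrary: j z)
  case Nil
  then show ?case using \<alpha> coeff_bound_step(2)[OF d E order_refl] by (force intro: order_trans)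
next
  case (Cons k ks)
  define X where "X = 6 * E / d"
  define m where "m = X ^ (4 ^ length ks)"
  have X1: "1 \<le> X" unfolding X_def by (rule coeff_bound_step(3)[OF d E order_refl])
  then have m: "m \<ge> 1" unfolding m_def by (intro one_le_power) auto
  have "z \<in> ball 0 (r - real (Suc (length ks)) * d)" using Cons.prems by simp
  note sb = shrink_ball[OF d(1) r this]
  have b: "cmod (C ks j w) \<le> m" if "j \<in> J" "w \<in> ball 0 (r - length ks * d)" for j w
    using Cons that unfolding m_def X_def by auto
  have db: "cmod (deriv (C ks j) z) \<le> 2 * m / d" if "j \<in> J" for j
  proof (rule deriv_bound[OF _ d(1)])
    show "C ks j holomorphic_on ball z d"
      by (rule holomorphic_on_subset[OF hol_C]) (use that Cons.prems sb in auto)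
  qed (use b that sb in auto)
  have t: "cmod (deriv (C ks j) z + C ks j z * L j z) \<le> X / 2 * m" if j: "j \<in> J" for j
  proof -
    have "cmod (deriv (C ks j) z + C ks j z * L j z) \<le> cmod (deriv (C ks j) z) + cmod (C ks j z) * cmod (L j z)"
      by (metis norm_mult norm_triangle_ineq)
    also have "\<dots> \<le> 2 * m / d + m * E"
      using db[OF j] b[OF j sb(3)] L[OF j sb(2)] m by (intro add_mono mult_mono) auto
    also have "\<dots> \<le> X / 2 * m" unfolding X_def using m by (intro coeff_bound_step(1)[OF d E]) auto
    finally show ?thesis .
  qed
  have k: "k \<in> J" and j: "j \<in> J" using Cons.prems by simp_all
  have "cmod (C (k # ks) j z) \<le> X / 2 * m * m + m * (X / 2 * m)"
    unfolding elim_coeff.simps elim_step_def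
    by (intro norm_diff_mult_le t j k b sb(3))
  also have "\<dots> = X ^ (1 + 2 * 4 ^ length ks)"
    by (simp add: m_def power_add power_mult power2_eq_square power_mult_distrib mult.commute)
  also have "\<dots> \<le> X ^ (4 ^ length (k # ks))"
  proof (rule power_increasing)
    have "1 \<le> (4::nat) ^ length ks" by simp
    then have "1 + 2 * (4::nat) ^ length ks \<le> 4 * 4 ^ length ks" by linarith
    then show "1 + 2 * 4 ^ length ks \<le> (4::nat) ^ length (k # ks)" by simp
  qed (use X1 in auto)
  finally show ?case by (simp add: X_def)
qed

text \<open>The operator is linear in \<open>x\<close>, so in every product exactly one factor
  carries \<open>\<epsilon>\<close>; the rest is the count for the coefficients.\<close>

lemma elim_op_bound:
  fixes d E r \<epsilon> :: real
  assumes ks: "set ks \<subseteq> J" and d: "0 < d" "d \<le> 1" and E: "E \<ge> 1" and r: "0 < r" "r \<le> 1"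
    and \<alpha>: "\<And>j z. j \<in> J \<Longrightarrow> z \<in> ball 0 r \<Longrightarrow> cmod (\<alpha> j z) \<le> E"
    and L: "\<And>j z. j \<in> J \<Longrightarrow> z \<in> ball 0 r \<Longrightarrow> cmod (L j z) \<le> E"
    and x: "x holomorphic_on unit_disc" and \<epsilon>: "\<And>z. z \<in> ball 0 r \<Longrightarrow> cmod (x z) \<le> \<epsilon>"
    and z: "z \<in> ball 0 (r - length ks * d)"
  shows "cmod (V ks x z) \<le> \<epsilon> * (6 * E / d) ^ (4 ^ length ks)"
  using ks z
proof (induction ks arbitrary: z)
  case Nil
  have X1: "1 \<le> (6 * E / d)" by (rule coeff_bound_step(3)[OF d E order_refl])
  have e0: "\<epsilon> \<ge> 0" using \<epsilon>[of 0] r(1) norm_ge_zero[of "x 0"] by (simp del: norm_ge_zero)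
  have "cmod (x z) \<le> \<epsilon> * 1" using \<epsilon> Nil by simp
  also have "\<dots> \<le> \<epsilon> * (6 * E / d)" using X1 e0 by (intro mult_left_mono) auto
  finally show ?case by simp
next
  case (Cons k ks)
  define X where "X = 6 * E / d"
  define m where "m = X ^ (4 ^ length ks)"
  have X1: "1 \<le> X" unfolding X_def by (rule coeff_bound_step(3)[OF d E order_refl])
  then have m: "m \<ge> 1" unfolding m_def by (intro one_le_power) auto
  have e0: "\<epsilon> \<ge> 0" using \<epsilon>[of 0] r(1) norm_ge_zero[of "x 0"] by (simp del: norm_ge_zero)
  have "z \<in> ball 0 (r - real (Suc (length ks)) * d)" using Cons.prems by simp
  note sb = shrink_ball[OF d(1) r(2) this]
  have k: "k \<in> J" and ks': "set ks \<subseteq> J" using Cons.prems by simp_all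
  have b: "cmod (C ks k w) \<le> m" if "w \<in> ball 0 (r - length ks * d)" for w
    unfolding m_def X_def using elim_coeff_bound[OF ks' d E r(2) \<alpha> L k that] by blast
  have bV: "cmod (V ks x w) \<le> \<epsilon> * m" if "w \<in> ball 0 (r - length ks * d)" for w
    using Cons that unfolding m_def X_def by auto
  have db: "cmod (deriv (C ks k) z) \<le> 2 * m / d"
  proof (rule deriv_bound[OF _ d(1)])
    show "C ks k holomorphic_on ball z d"
      by (rule holomorphic_on_subset[OF hol_C]) (use k ks' sb in auto)
  qed (use b sb in auto)
  have dV: "cmod (deriv (V ks x) z) \<le> 2 * (\<epsilon> * m) / d"
  proof (rule deriv_bound[OF _ d(1)])
    show "V ks x holomorphic_on ball z d"
      by (rule holomorphic_on_subset[OF hol_V]) (use x ks' sb in auto)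
  qed (use bV sb in auto)
  have t: "cmod (deriv (C ks k) z + C ks k z * L k z) \<le> X / 2 * m"
  proof -
    have "cmod (deriv (C ks k) z + C ks k z * L k z) \<le> cmod (deriv (C ks k) z) + cmod (C ks k z) * cmod (L k z)"
      by (metis norm_mult norm_triangle_ineq)
    also have "\<dots> \<le> 2 * m / d + m * E"
      using db b[OF sb(3)] L[OF k sb(2)] m by (intro add_mono mult_mono) auto
    also have "\<dots> \<le> X / 2 * m" unfolding X_def using m by (intro coeff_bound_step(1)[OF d E]) auto
    finally show ?thesis .
  qed
  have em: "0 \<le> \<epsilon> * m" using e0 m by simp
  have "2 * (\<epsilon> * m) / d \<le> 2 * (\<epsilon> * m) / d + (\<epsilon> * m) * E" using em E by simp
  also have "\<dots> \<le> X / 2 * (\<epsilon> * m)" unfolding X_def by (rule coeff_bound_step(1)[OF d E em])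
  finally have dV': "cmod (deriv (V ks x) z) \<le> X / 2 * (\<epsilon> * m)" using dV by simp
  have "cmod (V (k # ks) x z) \<le> X / 2 * (\<epsilon> * m) * m + (\<epsilon> * m) * (X / 2 * m)"
    unfolding elim_op.simps
    by (intro norm_diff_mult_le t dV' b bV sb(3))
  also have "\<dots> = \<epsilon> * X ^ (1 + 2 * 4 ^ length ks)"
    by (simp add: m_def power_add power_mult power2_eq_square power_mult_distrib mult_ac)
  also have "\<dots> \<le> \<epsilon> * X ^ (4 ^ length (k # ks))"
  proof (intro mult_left_mono power_increasing)
    have "1 \<le> (4::nat) ^ length ks" by simp
    then have "1 + 2 * (4::nat) ^ length ks \<le> 4 * 4 ^ length ks" by linarith
    then show "1 + 2 * 4 ^ length ks \<le> (4::nat) ^ length (k # ks)" by simp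
  qed (use X1 e0 in auto)
  finally show ?case by (simp add: X_def)
qed

end

section \<open>The second main theorem and growth\<close>

lemma power_commutes_exponents: "(x ^ a) ^ b = (x ^ b) ^ (a::nat)" for x :: "'a::monoid_mult"
  by (simp flip: power_mult add: mult.commute)

text \<open>A single term of the series. In the growth argument the sixth power of
  \<open>2 ^ k\<close> is \<open>64 ^ k\<close>; the shrinking gap costs \<open>2 ^ k\<close>, and
  \<open>32 ^ k\<close> still beats \<open>16 ^ k\<close>.\<close>

lemma exp_ge_pow6:
  fixes x :: real assumes "x \<ge> 0" shows "exp x \<ge> x ^ 6 / 720"
proof -
  have "(\<Sum>k\<in>{6}. inverse (fact k) * x ^ k) \<le> (\<Sum>k. inverse (fact k) * x ^ k)"
    using assms summable_exp[of x] by (intro sum_le_suminf) auto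
  also have "\<dots> = exp x" by (simp add: exp_def scaleR_conv_of_real)
  finally show ?thesis by (simp add: fact_numeral field_simps)
qed

text \<open>Iterating the hypothesis at radii \<open>r\<^sub>k\<close> with gaps proportional to \<open>2\<^sup>-\<^sup>k\<close> yields \<open>M r\<^sub>k \<ge> 16\<^sup>k M R2\<close>,
  which is impossible for a bounded \<open>M\<close>.\<close>

lemma logarithmic_self_bound_contradiction:
  fixes C R1 R2 :: real
  assumes C: "C \<ge> 1" and R: "R2 < R1" "R1 - R2 \<le> 1"
  obtains \<epsilon> M0 where "\<epsilon> > 0"
    "\<And>M B. M R2 \<ge> M0 \<Longrightarrow> B \<le> \<epsilon> * M R2 \<Longrightarrow>
      (\<And>r. R2 \<le> r \<Longrightarrow> r \<le> R1 \<Longrightarrow> 1 \<le> M r \<and> M r \<le> M R1) \<Longrightarrow>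
      (\<And>r \<delta>. R2 \<le> r \<Longrightarrow> 0 < \<delta> \<Longrightarrow> r + \<delta> \<le> R1 \<Longrightarrow> M r \<le> C / \<delta> ^ 3 * (B + ln (C * M (r + \<delta>) / \<delta>))) \<Longrightarrow> False"
proof -
  define l where "l = R1 - R2"
  have l: "0 < l" "l \<le> 1" using R by (auto simp: l_def)
  \<comment> \<open>Chosen so that for \<open>\<delta> = l / 2 ^ Suc k\<close> the quantity
    \<open>\<delta> ^ 3 / C * (16 ^ k * \<mu>)\<close> equals
    \<open>2 * (2 ^ k * (c1 * \<mu>))\<close>: one half absorbs \<open>B\<close>, the other remains
    as a lower bound for the logarithm.\<close>
  define c1 where "c1 = l ^ 3 / (16 * C)"
  have c1: "c1 > 0" using l C by (simp add: c1_def)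
  \<comment> \<open>The second entry makes the surplus factor in the induction step at least
    16.\<close>
  define M0 where "M0 = max 1 (16 * 1440 * C / (c1 ^ 6 * l))"
  show ?thesis
  proof (rule that[of c1 M0, OF c1])
    fix M :: "real \<Rightarrow> real" and B
    assume M0: "M R2 \<ge> M0" and B: "B \<le> c1 * M R2"
      and Mb: "\<And>r. R2 \<le> r \<Longrightarrow> r \<le> R1 \<Longrightarrow> 1 \<le> M r \<and> M r \<le> M R1"
      and H: "\<And>r \<delta>. R2 \<le> r \<Longrightarrow> 0 < \<delta> \<Longrightarrow> r + \<delta> \<le> R1 \<Longrightarrow> M r \<le> C / \<delta> ^ 3 * (B + ln (C * M (r + \<delta>) / \<delta>))"
    define \<mu> where "\<mu> = M R2"
    have \<mu>: "\<mu> \<ge> 1" "\<mu> \<ge> 16 * 1440 * C / (c1 ^ 6 * l)" using M0 by (auto simp: M0_def \<mu>_def)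
    define rr where "rr k = R2 + l * (1 - 1 / 2 ^ k)" for k :: nat
    have rr: "R2 \<le> rr k" "rr k \<le> R1" for k
    proof -
      have "1 / 2 ^ k \<le> (1::real)" "0 \<le> 1 / (2::real) ^ k" by (auto simp: divide_le_eq)
      then have "0 \<le> l * (1 - 1 / 2 ^ k)" "l * (1 - 1 / 2 ^ k) \<le> l * 1"
        using l by (auto intro!: mult_nonneg_nonneg mult_left_mono simp: diff_le_eq)
      then show "R2 \<le> rr k" "rr k \<le> R1" by (auto simp: rr_def l_def)
    qed
    have "M (rr k) \<ge> 16 ^ k * \<mu>" for k
    proof (induction k)
      case 0
      then show ?case by (simp add: rr_def \<mu>_def)
    next
      case (Suc k)
      define \<delta> where "\<delta> = l / 2 ^ Suc k"
      have \<delta>: "\<delta> > 0" using l by (simp add: \<delta>_def)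
      have step: "rr k + \<delta> = rr (Suc k)" by (simp add: rr_def \<delta>_def field_simps)
      define x where "x = C * M (rr (Suc k)) / \<delta>"
      have M1: "M (rr (Suc k)) \<ge> 1" using Mb rr by blast
      then have x: "x > 0" using C \<delta> by (simp add: x_def)
      have "M (rr k) \<le> C / \<delta> ^ 3 * (B + ln x)"
        using H[OF rr(1) \<delta>, of k] rr(2)[of "Suc k"] unfolding step x_def by simp
      then have "16 ^ k * \<mu> \<le> C / \<delta> ^ 3 * (B + ln x)" using Suc by simp
      then have "\<delta> ^ 3 / C * (16 ^ k * \<mu>) \<le> B + ln x" using \<delta> C by (simp add: field_simps)
      moreover have "\<delta> ^ 3 / C * (16 ^ k * \<mu>) = 2 * (2 ^ k * (c1 * \<mu>))"
      proof -
        have "(2 ^ Suc k :: real) ^ 3 = 8 * 8 ^ k"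
          by (simp add: power3_eq_cube flip: power_mult_distrib)
        then have "\<delta> ^ 3 = l ^ 3 / (8 * 8 ^ k)" by (simp only: \<delta>_def power_divide)
        moreover have "(16::real) ^ k = 8 ^ k * 2 ^ k" by (simp flip: power_mult_distrib)
        ultimately show ?thesis by (simp add: c1_def)
      qed
      moreover have "B \<le> 2 ^ k * (c1 * \<mu>)"
      proof -
        have "1 * (c1 * \<mu>) \<le> 2 ^ k * (c1 * \<mu>)" using c1 \<mu> by (intro mult_right_mono) auto
        then show ?thesis using B by (simp add: \<mu>_def)
      qed
      ultimately have "2 ^ k * (c1 * \<mu>) \<le> ln x" by linarith
      then have "exp (2 ^ k * (c1 * \<mu>)) \<le> x" using x by (simp add: ln_ge_iff)
      moreover have "(2 ^ k * (c1 * \<mu>)) ^ 6 / 720 \<le> exp (2 ^ k * (c1 * \<mu>))"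
        using c1 \<mu> by (intro exp_ge_pow6) auto
      ultimately have "(2 ^ k * (c1 * \<mu>)) ^ 6 / 720 \<le> C * M (rr (Suc k)) / \<delta>" unfolding x_def by linarith
      then have "(2 ^ k * (c1 * \<mu>)) ^ 6 / 720 * (\<delta> / C) \<le> M (rr (Suc k))" using \<delta> C by (simp add: field_simps)
      also have "(2 ^ k * (c1 * \<mu>)) ^ 6 / 720 * (\<delta> / C) = 32 ^ k * \<mu> * (c1 ^ 6 * l * \<mu> ^ 5 / (1440 * C))"
      proof -
        have "((2::real) ^ k) ^ 6 = (2 ^ 6) ^ k" by (rule power_commutes_exponents)
        also have "\<dots> = 32 ^ k * 2 ^ k" by (simp flip: power_mult_distrib)
        finally have "(2 ^ k * (c1 * \<mu>)) ^ 6 = 32 ^ k * 2 ^ k * (c1 ^ 6 * (\<mu> * \<mu> ^ 5))"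
          using power_Suc[of \<mu> 5] by (simp add: power_mult_distrib del: power_Suc)
        then show ?thesis using C by (simp add: \<delta>_def)
      qed
      finally have 1: "32 ^ k * \<mu> * (c1 ^ 6 * l * \<mu> ^ 5 / (1440 * C)) \<le> M (rr (Suc k))" .
      have "16 \<le> c1 ^ 6 * l * \<mu> ^ 5 / (1440 * C)"
      proof -
        have "\<mu> ^ 1 \<le> \<mu> ^ 5" using \<mu> by (intro power_increasing) auto
        then have "16 * 1440 * C / (c1 ^ 6 * l) \<le> \<mu> ^ 5" using \<mu> by simp
        then show ?thesis using c1 l C by (simp add: field_simps)
      qed
      moreover have "(16::real) ^ k \<le> 32 ^ k" by (intro power_mono) auto
      ultimately have "(16 ^ k * \<mu>) * 16 \<le> 32 ^ k * \<mu> * (c1 ^ 6 * l * \<mu> ^ 5 / (1440 * C))"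
        using \<mu> by (intro mult_mono) auto
      then show ?case using 1 by (simp add: algebra_simps)
    qed
    then have *: "16 ^ k * \<mu> \<le> M R1" for k using Mb rr order_trans by blast
    obtain k where "M R1 < 16 ^ k" using real_arch_pow[of 16 "M R1"] by auto
    moreover have "(16::real) ^ k * 1 \<le> 16 ^ k * \<mu>" using \<mu> by (intro mult_left_mono) auto
    ultimately show False using *[of k] by linarith
  qed
qed

lemma abs_ln_norm_le:
  assumes "exp (- K) \<le> norm z" "norm z \<le> exp K"
  shows "\<bar>ln (norm z)\<bar> \<le> K"
proof -
  have p: "norm z > 0" using assms(1) less_le_trans[OF exp_gt_zero] by blast
  have "ln (exp (- K)) \<le> ln (norm z)" "ln (norm z) \<le> ln (exp K)"
    using assms p by (subst ln_le_cancel_iff; simp)+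
  then show ?thesis by simp
qed

lemma norm_le_exp_abs_ln:
  assumes "\<bar>ln (norm z)\<bar> \<le> K" "z \<noteq> 0"
  shows "exp (- K) \<le> norm z" "norm z \<le> exp K"
proof -
  have "- K \<le> ln (norm z)" "ln (norm z) \<le> K" using assms(1) by linarith+
  then have "exp (- K) \<le> exp (ln (norm z))" "exp (ln (norm z)) \<le> exp K" by simp_all
  then show "exp (- K) \<le> norm z" "norm z \<le> exp K" using assms(2) by simp_all
qed

text \<open>The maximum principle for \<open>f\<close> and for its inverse, both holomorphic because
  \<open>f\<close> has no zeros.\<close>

lemma unit_abs_ln_le_interior:
  assumes hol: "f holomorphic_on ball 0 R" and nz: "\<And>z. z \<in> ball 0 R \<Longrightarrow> f z \<noteq> 0"
    and \<rho>: "0 \<le> \<rho>" "\<rho> < R" and b: "\<And>z. z \<in> sphere 0 \<rho> \<Longrightarrow> \<bar>ln (cmod (f z))\<bar> \<le> K"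
    and z: "z \<in> cball 0 \<rho>"
  shows "\<bar>ln (cmod (f z))\<bar> \<le> K"
proof (cases "\<rho> = 0")
  case True
  then show ?thesis using b z by auto
next
  case False
  have sub: "cball 0 \<rho> \<subseteq> ball 0 R" using \<rho> by auto
  have *: "cmod (g z) \<le> exp K" if "g holomorphic_on ball 0 R" "\<And>w. w \<in> sphere 0 \<rho> \<Longrightarrow> cmod (g w) \<le> exp K" for g
  proof (rule maximum_modulus_frontier[of g "cball 0 \<rho>"])
    show "g holomorphic_on interior (cball 0 \<rho>)"
      by (rule holomorphic_on_subset[OF that(1)]) (use \<rho> in auto)
    show "continuous_on (closure (cball 0 \<rho>)) g"
      using continuous_on_subset[OF holomorphic_on_imp_continuous_on[OF that(1)] sub] by simp
  qed (use that z False in auto)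
  have s: "f w \<noteq> 0" if "w \<in> sphere 0 \<rho>" for w
    by (rule nz) (use that \<rho> in auto)
  have "cmod (f z) \<le> exp K" by (rule *[OF hol]) (rule norm_le_exp_abs_ln(2)[OF b s])
  moreover have "cmod (inverse (f z)) \<le> exp K"
  proof (rule *[of "\<lambda>z. inverse (f z)"])
    show "(\<lambda>z. inverse (f z)) holomorphic_on ball 0 R" by (intro holomorphic_intros hol nz)
    fix w :: complex assume w: "w \<in> sphere 0 \<rho>"
    have "exp (- K) \<le> cmod (f w)" by (rule norm_le_exp_abs_ln(1)[OF b[OF w] s[OF w]])
    then show "cmod (inverse (f w)) \<le> exp K"
      using s[OF w] le_imp_inverse_le[of "exp (- K)" "cmod (f w)"] by (simp add: norm_inverse exp_minus)
  qed
  moreover have "f z \<noteq> 0" by (rule nz) (use z \<rho> in auto)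
  ultimately have "cmod (f z) \<le> exp K" "exp (- K) \<le> cmod (f z)"
    using le_imp_inverse_le[of "inverse (cmod (f z))" "exp K"] by (simp_all add: norm_inverse exp_minus)
  then show ?thesis by (intro abs_ln_norm_le)
qed


text \<open>After all terms except \<open>0\<close> and \<open>i\<close> have been eliminated, \<open>h i\<close> is, up to a small error, the quotient of
  two holomorphic functions whose logarithms are bounded by \<open>ln M\<close>. This plays the role of Nevanlinna's second main theorem.\<close>

lemma (in unit_family) second_main_theorem:
  fixes r \<delta> B M M' Ca :: real and q :: nat and ks :: "nat list"
  assumes J: "finite J" "0 \<in> J" "i \<in> J" "i \<noteq> 0" "set ks = J - {0, i}" "length ks < q"
    and h0: "\<And>z. z \<in> unit_disc \<Longrightarrow> h 0 z = 1"
    and \<alpha>1: "\<And>j z. j \<in> J \<Longrightarrow> z \<in> ball 0 (r + \<delta>) \<Longrightarrow> cmod (\<alpha> j z) \<le> Ca" and Ca: "Ca \<ge> 1"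
    and r: "0 < r" "0 < \<delta>" "r + \<delta> \<le> 1"
    and M: "M \<ge> 1" "\<And>j z. j \<in> J \<Longrightarrow> z \<in> ball 0 (r + \<delta>) \<Longrightarrow> \<bar>ln (cmod (h j z))\<bar> \<le> M"
    and M': "\<And>z. z \<in> ball 0 (r + \<delta>) \<Longrightarrow> \<bar>ln (cmod (h i z))\<bar> \<le> M'"
    and err: "\<And>z. z \<in> ball 0 (r + \<delta>) \<Longrightarrow> cmod (\<Sum>j\<in>J. \<alpha> j z * h j z) \<le> exp (- M')"
    and z0: "z0 \<in> cball 0 r" "cmod (C ks 0 z0 * C ks i z0) \<ge> exp (- B)" and B: "B \<ge> 0"
    and z: "z \<in> cball 0 r"
  shows "\<bar>ln (cmod (h i z))\<bar> \<le>
    (168 * 4 ^ q * (q + 4) ^ 3 * Ca) / \<delta> ^ 3 * (B + ln ((168 * 4 ^ q * (q + 4) ^ 3 * Ca) * M / \<delta>))"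
proof -
  \<comment> \<open>One of \<open>q + 4\<close> equal shares of the gap: one share goes to the
    logarithmic derivatives, one to each pivot, of which there are fewer than \<open>q\<close>, and
    three to the circle on which both surviving coefficients are large.\<close>
  define d where "d = \<delta> / (q + 4)"
  have d: "0 < d" "d \<le> 1" using r by (auto simp: d_def)
  have \<delta>d: "\<delta> = real (q + 4) * d" by (simp add: d_def)
  define r1 where "r1 = r + \<delta> - d"
  define E where "E = Ca + 8 * M / d"
  have E: "E \<ge> 1" using Ca M d by (simp add: E_def add_increasing2)
  have ksJ: "set ks \<subseteq> J" using J by auto
  have \<delta>4: "4 * d \<le> \<delta>" "real (length ks) * d + 4 * d \<le> \<delta> - d"
  proof -
    have "real (length ks) + 1 \<le> real q" using J(6) by simp
    then have "(real (length ks) + 1) * d \<le> real q * d" using d by (intro mult_right_mono) auto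
    then show "real (length ks) * d + 4 * d \<le> \<delta> - d" unfolding \<delta>d by (simp add: algebra_simps)
    then show "4 * d \<le> \<delta>" using d by (smt (verit) mult_nonneg_nonneg of_nat_0_le_iff)
  qed
  have r1: "0 < r1" "r1 \<le> 1" using r d \<delta>4 by (auto simp: r1_def)
  have sub1: "ball z d \<subseteq> ball 0 (r + \<delta>)" if "z \<in> ball 0 r1" for z :: complex
  proof
    fix w :: complex assume "w \<in> ball z d"
    then have "cmod w < d + cmod z" using norm_triangle_ineq2[of w z] by (simp add: dist_norm norm_minus_commute)
    then show "w \<in> ball 0 (r + \<delta>)" using that by (simp add: r1_def)
  qed
  have subU: "ball 0 (r + \<delta>) \<subseteq> unit_disc" using r by auto
  have Lb: "cmod (L j z) \<le> E" if "j \<in> J" "z \<in> ball 0 r1" for j z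
  proof -
    have "cmod (L j z) \<le> 8 * M / d"
    proof (rule log_deriv_bound[OF _ _ d(1)])
      show "h j holomorphic_on ball z d"
        by (rule holomorphic_on_subset[OF hol_h[OF that(1)]]) (use sub1[OF that(2)] subU in blast)
      show "h j w \<noteq> 0" if "w \<in> ball z d" for w
        by (rule h_nz) (use \<open>j \<in> J\<close> that sub1[OF \<open>z \<in> ball 0 r1\<close>] subU in blast)+
    qed (use M(2)[OF that(1)] sub1[OF that(2)] in blast)
    then show ?thesis using Ca by (simp add: E_def)
  qed
  have \<alpha>b: "cmod (\<alpha> j z) \<le> E" if "j \<in> J" "z \<in> ball 0 r1" for j z
  proof -
    have "z \<in> ball 0 (r + \<delta>)" using that d by (auto simp: r1_def)
    then have "cmod (\<alpha> j z) \<le> Ca" using \<alpha>1 that by blast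
    moreover have "0 \<le> 8 * M / d" using M d by simp
    ultimately show ?thesis by (simp add: E_def)
  qed
  define X where "X = (6 * E / d) ^ (4 ^ q)"
  have X0: "1 \<le> 6 * E / d" by (rule coeff_bound_step(3)[OF d E order_refl])
  have X1: "1 \<le> X" unfolding X_def using X0 by (rule one_le_power)
  have Xl: "(6 * E / d) ^ (4 ^ length ks) \<le> X"
    unfolding X_def using X0 J(6) by (intro power_increasing) auto
  define A where "A = ln X"
  have A: "A \<ge> 0" "exp A = X" using X1 by (auto simp: A_def)
  have inr: "w \<in> ball 0 (r1 - length ks * d)" if "cmod w < r + 3 * d" for w :: complex
    using that \<delta>4 d by (simp add: r1_def)
  have Cb: "cmod (C ks j w) \<le> exp A" if "j \<in> J" "cmod w < r + 3 * d" for j w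
    using elim_coeff_bound[OF ksJ d E r1(2) \<alpha>b Lb that(1) inr[OF that(2)]] Xl A by simp
  define e where "e w = (\<Sum>j\<in>J. \<alpha> j w * h j w)" for w
  have hole: "(\<lambda>w. \<alpha> j w * h j w) holomorphic_on unit_disc" if "j \<in> J" for j
    using hol_h hol_\<alpha> that by (intro holomorphic_intros)
  have Ve: "cmod (V ks e w) \<le> exp (- M') * X" if "cmod w < r + 3 * d" for w :: complex
  proof -
    have he: "e holomorphic_on unit_disc" unfolding e_def[abs_def] by (rule holomorphic_on_sum) (rule hole)
    have "cmod (V ks e w) \<le> exp (- M') * (6 * E / d) ^ (4 ^ length ks)"
    proof (rule elim_op_bound[OF ksJ d E r1 \<alpha>b Lb he _ inr[OF that]])
      fix w :: complex assume w: "w \<in> ball 0 r1"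
      then have "w \<in> ball 0 (r + \<delta>)" using d by (auto simp: r1_def)
      then show "cmod (e w) \<le> exp (- M')" unfolding e_def by (rule err)
    qed
    also have "\<dots> \<le> exp (- M') * X" using Xl by (intro mult_left_mono) auto
    finally show ?thesis .
  qed
  have d3: "r + 3 * d \<le> 1" using \<delta>4 r d by linarith
  have Veq: "V ks e w = C ks 0 w + C ks i w * h i w" if w: "w \<in> unit_disc" for w
  proof -
    have "V ks e w = (\<Sum>j\<in>J. V ks (\<lambda>w. \<alpha> j w * h j w) w)"
      unfolding e_def[abs_def] by (rule V_sum[OF ksJ J(1) hole w])
    also have "\<dots> = (\<Sum>j\<in>J. C ks j w * h j w)" using V_term[OF ksJ _ w] by (intro sum.cong) auto
    also have "\<dots> = (\<Sum>j\<in>{0, i}. C ks j w * h j w)"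
      using J C_pivot[OF ksJ _ w] by (intro sum.mono_neutral_right) auto
    also have "\<dots> = C ks 0 w + C ks i w * h i w" using J h0[OF w] by simp
    finally show ?thesis .
  qed
  \<comment> \<open>The product of the two surviving coefficients, so that one circle serves both;
    \<open>z0\<close> is the point where the product is not small.\<close>
  define y where "y w = C ks 0 w * C ks i w" for w
  have "y holomorphic_on unit_disc" unfolding y_def using hol_C[OF ksJ] J by (intro holomorphic_intros)
  then have hy: "y holomorphic_on ball 0 (r + 3 * d)" by (rule holomorphic_on_subset) (use d3 in auto)
  have yb: "cmod (y w) \<le> exp (2 * A)" if "w \<in> ball 0 (r + 3 * d)" for w
  proof -
    have "cmod (C ks 0 w) * cmod (C ks i w) \<le> exp A * exp A"
      using Cb J that by (intro mult_mono) auto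
    then show ?thesis by (simp add: y_def norm_mult flip: exp_add)
  qed
  define K1 where "K1 = 48 / ((r + 3 * d - (r + 2 * d))\<^sup>2 * (r + 2 * d - r)) * (2 * A + B)"
  obtain \<rho> where \<rho>: "r \<le> \<rho>" "\<rho> \<le> r + 2 * d" "\<And>w. w \<in> sphere 0 \<rho> \<Longrightarrow> cmod (y w) \<ge> exp (- K1)"
  proof (rule minimum_modulus_circle[OF hy yb, of "r + 2 * d" z0 B r "r + 2 * d" 0])
    show "z0 \<in> cball 0 (r + 2 * d)" using z0 d by auto
    show "exp (- B) \<le> cmod (y z0)" using z0 by (simp add: y_def)
  next
    fix \<rho> assume "r \<le> \<rho>" "\<rho> \<le> r + 2 * d" "\<And>w. w \<in> sphere 0 \<rho> \<Longrightarrow>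
       exp (- (48 / ((r + 3 * d - (r + 2 * d))\<^sup>2 * (r + 2 * d - r))) * (2 * A + B)) \<le> cmod (y w)"
    then show ?thesis by (intro that[of \<rho>]) (simp_all add: K1_def)
  qed (use r d d3 A in auto)
  have K1: "K1 = 24 / d ^ 3 * (2 * A + B)" using d by (simp add: K1_def power2_eq_square power3_eq_cube)
  have K1p: "K1 \<ge> 0" unfolding K1 using d A B by simp
  \<comment> \<open>Either \<open>M' \<le> K\<close>, and the a priori bound suffices, or the error
    \<open>exp (- M') * exp A\<close> is at most half of the lower bound
    \<open>exp (- K1 - A)\<close> of either coefficient, so that \<open>h i\<close> is comparable to
    their quotient. The summand 2 leaves room for the factors 2.\<close>
  define K where "K = K1 + 3 * A + 2"
  have main: "\<bar>ln (cmod (h i z))\<bar> \<le> K"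
  proof (cases "K \<ge> M'")
    case True
    have "z \<in> ball 0 (r + \<delta>)" using z r by auto
    then show ?thesis using M' True order_trans by blast
  next
    case False
    have hi: "h i holomorphic_on ball 0 1" "\<And>z. z \<in> ball 0 1 \<Longrightarrow> h i z \<noteq> 0" using hol_h h_nz J by auto
    show ?thesis
    proof (rule unit_abs_ln_le_interior[OF hi])
      show "0 \<le> \<rho>" "\<rho> < 1" using \<rho> r d d3 by auto
      show "z \<in> cball 0 \<rho>" using z \<rho> by auto
      fix w :: complex assume w: "w \<in> sphere 0 \<rho>"
      then have w3: "cmod w < r + 3 * d" using \<rho> d by simp
      then have wU: "w \<in> unit_disc" using d3 by simp
      define s0 where "s0 = cmod (C ks 0 w)" define si where "si = cmod (C ks i w)"
      have s: "s0 \<le> exp A" "si \<le> exp A" "0 \<le> s0" "0 \<le> si" using Cb J w3 by (auto simp: s0_def si_def)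
      have p: "exp (- K1) \<le> s0 * si" using \<rho>(3)[OF w] by (simp add: y_def s0_def si_def norm_mult)
      have "s0 * si \<le> s0 * exp A" "s0 * si \<le> exp A * si" using s by (auto intro: mult_mono)
      then have "exp (- K1) * exp (- A) \<le> s0 * exp A * exp (- A)" "exp (- K1) * exp (- A) \<le> exp A * si * exp (- A)"
        using p by (auto intro!: mult_right_mono)
      then have low: "exp (- K1 - A) \<le> s0" "exp (- K1 - A) \<le> si"
        by (simp_all add: mult.assoc exp_diff exp_minus field_simps)
      define v where "v = cmod (V ks e w)"
      have "v \<le> exp (- M') * exp A" using Ve[OF w3] A by (simp add: v_def)
      also have "\<dots> \<le> exp (- (K1 + 3 * A + 2)) * exp A" using False by (intro mult_right_mono) (auto simp: K_def)
      also have "\<dots> \<le> exp (- 1) * exp (- K1 - A)" using A(1) by (simp flip: exp_add)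
      also have "\<dots> \<le> 1 / 2 * exp (- K1 - A)"
      proof (rule mult_right_mono)
        have "exp 1 \<ge> (2::real)" using exp_ge_add_one_self[of 1] by simp
        then show "exp (- 1) \<le> (1 / 2 :: real)" by (simp add: exp_minus field_simps)
      qed simp
      finally have v: "v \<le> 1 / 2 * exp (- K1 - A)" .
      define t where "t = cmod (h i w)"
      have eq: "C ks i w * h i w = V ks e w - C ks 0 w" using Veq[OF wU] by simp
      have nt: "si * t = cmod (V ks e w - C ks 0 w)" unfolding eq[symmetric] by (simp add: si_def t_def norm_mult)
      have up: "si * t \<le> v + s0" unfolding nt v_def s0_def by (rule norm_triangle_ineq4)
      have lo: "s0 - v \<le> si * t" unfolding nt v_def s0_def
        using norm_triangle_ineq2[of "C ks 0 w" "V ks e w"] by (simp add: norm_minus_commute)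
      have e2: "2 \<le> exp (2::real)" using exp_ge_add_one_self[of 2] by simp
      have t0: "0 \<le> t" by (simp add: t_def)
      have "exp (- K1 - A) * t \<le> si * t" using low t0 by (intro mult_right_mono)
      also have "\<dots> \<le> 2 * exp A" using up v low s by linarith
      also have "\<dots> \<le> exp 2 * exp A" using e2 by (intro mult_right_mono) auto
      finally have "exp (K1 + A) * (exp (- K1 - A) * t) \<le> exp (K1 + A) * (exp 2 * exp A)"
        by (intro mult_left_mono) auto
      moreover have "exp (K1 + A) * (exp (- K1 - A) * t) = t"
        unfolding mult.assoc[symmetric] exp_add[symmetric] by simp
      moreover have "exp (K1 + A) * (exp 2 * exp A) \<le> exp K"
        unfolding exp_add[symmetric] K_def using A(1) by simp
      ultimately have t1: "t \<le> exp K" by linarith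
      have "exp (- 2) * exp (- K1 - A) \<le> 1 / 2 * exp (- K1 - A)"
        using e2 by (intro mult_right_mono) (simp_all add: exp_minus field_simps)
      also have "\<dots> \<le> si * t" using lo v low by linarith
      also have "\<dots> \<le> exp A * t" using s t0 by (intro mult_right_mono)
      finally have "exp (- A) * (exp (- 2) * exp (- K1 - A)) \<le> exp (- A) * (exp A * t)"
        by (intro mult_left_mono) auto
      moreover have "exp (- A) * (exp A * t) = t"
        unfolding mult.assoc[symmetric] exp_add[symmetric] by simp
      moreover have "exp (- K) \<le> exp (- A) * (exp (- 2) * exp (- K1 - A))"
        unfolding exp_add[symmetric] K_def using A(1) by simp
      ultimately have "exp (- K) \<le> t" by linarith
      with t1 show "\<bar>ln (cmod (h i w))\<bar> \<le> K" unfolding t_def by (intro abs_ln_norm_le)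
    qed
  qed
  define Q4 where "Q4 = real (q + 4)"
  have Q4: "Q4 \<ge> 4" by (simp add: Q4_def)
  define P where "P = (4::real) ^ q"
  have P: "P \<ge> 1" by (simp add: P_def)
  \<comment> \<open>168 is 24 times 7: 24 is 48 divided by 2, from the circle with gaps
    \<open>d\<close> and \<open>2 * d\<close>, and 7 collects \<open>3 * A + 1 + B\<close> after the
    bound for \<open>A\<close> is inserted. \<open>P\<close> is the elimination exponent, and
    \<open>Q4 ^ 3\<close> comes from \<open>d ^ 3\<close>.\<close>
  define CC where "CC = 168 * P * Q4 ^ 3 * Ca"
  have CCM: "CC * M / \<delta> \<ge> 168 / \<delta>" 
  proof -
    have "168 * 1 \<le> 168 * P * (Q4 ^ 3 * Ca * M)"
      using P Q4 Ca M(1) by (intro mult_mono mult_ge1_I) (auto intro!: mult_ge1_I)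
    then show ?thesis using r by (simp add: CC_def divide_right_mono mult_ac)
  qed
  \<comment> \<open>The coefficients are bounded polynomially in \<open>M / \<delta>\<close>, so
    \<open>A\<close> is only logarithmic in \<open>M\<close>. This is the gain over the trivial
    bound by \<open>M\<close>.\<close>
  have A_le: "A \<le> 2 * P * ln (CC * M / \<delta>)"
  proof -
    have "E \<le> 9 * Ca * M / d"
    proof -
      have "Ca * d \<le> Ca * M" using d M Ca by (intro mult_left_mono) auto
      then have "Ca \<le> Ca * M / d" using d by (simp add: pos_le_divide_eq)
      moreover have "1 * (M / d) \<le> Ca * (M / d)" using Ca M d by (intro mult_right_mono) auto
      ultimately show ?thesis by (simp add: E_def)
    qed
    then have "6 * E / d \<le> 6 * (9 * Ca * M / d) / d" using d by (intro divide_right_mono) auto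
    also have "\<dots> = 54 * Ca * M * Q4\<^sup>2 / \<delta>\<^sup>2"
      using r by (simp add: d_def Q4_def power2_eq_square field_simps)
    also have "\<dots> \<le> (CC * M / \<delta>)\<^sup>2"
    proof -
      have "54 * Ca * M * Q4\<^sup>2 \<le> (CC * M)\<^sup>2"
      proof -
        have a: "54 * Q4\<^sup>2 \<le> (168 * P * Q4 ^ 3)\<^sup>2"
        proof -
          have "54 \<le> 168 * P * Q4\<^sup>2" using P Q4 mult_mono[of 168 "168 * P" 1 "Q4\<^sup>2"] by (simp add: one_le_power)
          then have "54 * 1 \<le> (168 * P * Q4\<^sup>2) * (168 * P * Q4\<^sup>2)" by (intro mult_mono) auto
          then have "54 * 1 * Q4\<^sup>2 \<le> (168 * P * Q4\<^sup>2) * (168 * P * Q4\<^sup>2) * Q4\<^sup>2" by (intro mult_right_mono) auto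
          then show ?thesis by (simp add: power2_eq_square power3_eq_cube mult_ac)
        qed
        have b: "1 * (Ca * M) \<le> (Ca * M) * (Ca * M)"
          using Ca M by (intro mult_right_mono mult_ge1_I) auto
        have "54 * Q4\<^sup>2 * (1 * (Ca * M)) \<le> (168 * P * Q4 ^ 3)\<^sup>2 * ((Ca * M) * (Ca * M))"
          using a b Ca M by (intro mult_mono) auto
        then show ?thesis by (simp add: CC_def power2_eq_square mult_ac)
      qed
      then show ?thesis using r by (simp add: power_divide divide_right_mono)
    qed
    finally have l: "6 * E / d \<le> (CC * M / \<delta>)\<^sup>2" .
    have "A = P * ln (6 * E / d)" using X0 by (simp add: A_def X_def P_def ln_realpow)
    also have "\<dots> \<le> P * ln ((CC * M / \<delta>)\<^sup>2)"
    proof (rule mult_left_mono)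
      show "ln (6 * E / d) \<le> ln ((CC * M / \<delta>)\<^sup>2)"
        using l X0 ln_le_cancel_iff[of "6 * E / d" "(CC * M / \<delta>)\<^sup>2"] by linarith
    qed (use P in auto)
    also have "ln ((CC * M / \<delta>)\<^sup>2) = 2 * ln (CC * M / \<delta>)"
      using CCM r by (subst ln_realpow) (auto intro: less_le_trans[of 0 "168 / \<delta>"])
    finally show ?thesis by simp
  qed
  have lnp: "ln (CC * M / \<delta>) \<ge> 1"
  proof -
    have "168 / 1 \<le> 168 / \<delta>" using r by (intro divide_left_mono) auto
    then have "3 \<le> CC * M / \<delta>" using CCM by linarith
    then show ?thesis using exp_le by (subst ln_ge_iff) auto
  qed
  define l where "l = ln (CC * M / \<delta>)"
  have d3': "1 \<le> 1 / d ^ 3" using d by (simp add: power_le_one)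
  define D where "D = 1 / d ^ 3"
  have "K \<le> 24 / d ^ 3 * (3 * A + 1 + B)"
  proof -
    have "3 * A + 2 \<le> 24 * (A + 1) * 1" using A by simp
    also have "\<dots> \<le> 24 * (A + 1) * (1 / d ^ 3)" using d3' A by (intro mult_left_mono) auto
    finally have *: "3 * A + 2 \<le> 24 * (A + 1) * D" by (simp add: D_def)
    have "24 / d ^ 3 = 24 * D" by (simp add: D_def)
    then show ?thesis unfolding K_def K1 using * by (simp add: algebra_simps)
  qed
  also have "\<dots> \<le> 24 / d ^ 3 * (7 * P * (B + l))"
  proof (rule mult_left_mono)
    have "0 \<le> (7 * P - 1) * B" using P B by simp
    moreover have "3 * A \<le> 6 * P * l" using A_le by (simp add: l_def)
    moreover have "1 * 1 \<le> P * l" using P lnp by (intro mult_mono) (auto simp: l_def)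
    ultimately show "3 * A + 1 + B \<le> 7 * P * (B + l)" by (simp add: algebra_simps)
  qed (use d in auto)
  also have "\<dots> = 168 * P * Q4 ^ 3 / \<delta> ^ 3 * (B + l)"
    by (simp add: d_def Q4_def power_divide)
  also have "\<dots> \<le> CC / \<delta> ^ 3 * (B + l)"
  proof -
    have "168 * P * Q4 ^ 3 * 1 \<le> CC" unfolding CC_def using Ca P Q4 by (intro mult_left_mono) auto
    then show ?thesis using r B lnp by (intro mult_right_mono divide_right_mono) (auto simp: l_def)
  qed
  finally have "K \<le> CC / \<delta> ^ 3 * (B + l)" .
  then show ?thesis using main unfolding CC_def P_def Q4_def l_def by simp
qed

section \<open>Ultrafilters and normal families\<close>

locale ultrafilter =
  fixes U :: "'n filter"
  assumes nontrivial: "U \<noteq> bot"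
    and dichotomy: "eventually P U \<or> eventually (\<lambda>n. \<not> P n) U"
begin

text \<open>The failure of an estimate is again an assertion along \<open>U\<close>; this is used
  wherever an argument by subsequences would thin out the family.\<close>

lemma not_eventually_iff: "\<not> eventually P U \<longleftrightarrow> eventually (\<lambda>n. \<not> P n) U"
proof
  assume "eventually (\<lambda>n. \<not> P n) U"
  then have "eventually (\<lambda>n. False) U" if "eventually P U"
    using that by eventually_elim auto
  then show "\<not> eventually P U" using nontrivial by (auto simp: eventually_False)
qed (use dichotomy in blast)

text \<open>Freezes a choice among finitely many indices that originally depends on
  \<open>n\<close>.\<close>

lemma eventually_finite_Ex:
  assumes "finite S" "eventually (\<lambda>n. \<exists>s\<in>S. P s n) U"
  shows "\<exists>s\<in>S. eventually (P s) U"
proof (rule ccontr)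
  assume "\<not> ?thesis"
  then have "\<forall>s\<in>S. eventually (\<lambda>n. \<not> P s n) U" by (auto simp: not_eventually_iff)
  then have "eventually (\<lambda>n. \<forall>s\<in>S. \<not> P s n) U" using assms(1) by (simp add: eventually_ball_finite)
  then have "\<not> eventually (\<lambda>n. \<exists>s\<in>S. P s n) U" by (simp add: not_eventually_iff)
  then show False using assms by blast
qed

text \<open>The image filter has a cluster point in \<open>K\<close> by compactness, and an
  ultrafilter converges to each of its cluster points.\<close>

lemma compact_limit:
  fixes f :: "'n \<Rightarrow> 'b::topological_space"
  assumes "compact K" "eventually (\<lambda>n. f n \<in> K) U"
  obtains l where "l \<in> K" "(f \<longlongrightarrow> l) U"
proof -
  have "filtermap f U \<noteq> bot" using nontrivial by (simp add: filtermap_bot_iff)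
  moreover have "eventually (\<lambda>x. x \<in> K) (filtermap f U)" using assms by (simp add: eventually_filtermap)
  ultimately obtain l where l: "l \<in> K" "inf (nhds l) (filtermap f U) \<noteq> bot"
    using assms(1) unfolding compact_filter by blast
  have "(f \<longlongrightarrow> l) U"
  proof (rule topological_tendstoI)
    fix S assume S: "open S" "l \<in> S"
    show "eventually (\<lambda>n. f n \<in> S) U"
    proof (rule ccontr)
      assume "\<not> ?thesis"
      then have "eventually (\<lambda>x. x \<notin> S) (filtermap f U)" by (simp add: not_eventually_iff eventually_filtermap)
      moreover have "eventually (\<lambda>x. x \<in> S) (nhds l)" using S by (rule eventually_nhds_in_open)
      ultimately have "eventually (\<lambda>x. False) (inf (nhds l) (filtermap f U))"
        unfolding eventually_inf by blast
      then show False using l by (simp add: eventually_False)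
    qed
  qed
  with l that show ?thesis by blast
qed

text \<open>Pointwise limits exist by compactness. On a smaller disc Cauchy's estimate gives a
  common Lipschitz constant, inherited by the limit, and convergence on a finite net then implies
  uniform convergence.\<close>

lemma montel:
  fixes G :: "'n \<Rightarrow> complex \<Rightarrow> complex"
  assumes hol: "\<And>n. G n holomorphic_on ball 0 R"
    and bd: "\<And>r. 0 < r \<Longrightarrow> r < R \<Longrightarrow> \<exists>B. eventually (\<lambda>n. \<forall>z\<in>cball 0 r. cmod (G n z) \<le> B) U"
  obtains g where "g holomorphic_on ball 0 R"
    "\<And>r. r < R \<Longrightarrow> uniform_limit (cball 0 r) G g U"
proof -
  have "\<exists>l. ((\<lambda>n. G n z) \<longlongrightarrow> l) U" if z: "z \<in> ball 0 R" for z
  proof -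
    define r where "r = (cmod z + R) / 2"
    have r: "0 < r" "r < R" "cmod z \<le> r" using z norm_ge_zero[of z] by (auto simp: r_def simp del: norm_ge_zero)
    obtain B where "eventually (\<lambda>n. \<forall>z\<in>cball 0 r. cmod (G n z) \<le> B) U" using bd[OF r(1,2)] by blast
    then have "eventually (\<lambda>n. G n z \<in> cball 0 B) U" by eventually_elim (use r in auto)
    then show ?thesis using compact_limit[OF compact_cball] by metis
  qed
  then obtain g where g: "\<And>z. z \<in> ball 0 R \<Longrightarrow> ((\<lambda>n. G n z) \<longlongrightarrow> g z) U" by metis
  have ul: "uniform_limit (cball 0 r) G g U" if r: "0 < r" "r < R" for r
  proof (rule uniform_limitI)
    fix \<epsilon> :: real assume \<epsilon>: "\<epsilon> > 0"
    define d where "d = (R - r) / 2"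
    have d: "d > 0" "r + d < R" using r by (auto simp: d_def field_simps)
    obtain B where B: "eventually (\<lambda>n. \<forall>z\<in>cball 0 (r + d). cmod (G n z) \<le> B) U"
      using bd[of "r + d"] r d by auto
    \<comment> \<open>The summand 1 keeps the constant positive even if \<open>B\<close> vanishes,
      so that the mesh \<open>\<eta>\<close> below is positive.\<close>
    define \<Lambda> where "\<Lambda> = 2 * \<bar>B\<bar> / d + 1"
    have \<Lambda>: "\<Lambda> > 0" using d by (simp add: \<Lambda>_def add_nonneg_pos)
    have lip: "cmod (G n z - G n w) \<le> \<Lambda> * cmod (z - w)"
      if n: "\<forall>z\<in>cball 0 (r + d). cmod (G n z) \<le> B" and zw: "z \<in> cball 0 r" "w \<in> cball 0 r" for n z w
    proof (rule field_differentiable_bound[OF convex_cball _ _ zw(1) zw(2)])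
      fix u :: complex assume u: "u \<in> cball 0 r"
      have ub: "ball u d \<subseteq> cball 0 (r + d)"
      proof
        fix v assume "v \<in> ball u d"
        then have "cmod v < d + cmod u" using norm_triangle_ineq2[of v u] by (simp add: dist_norm norm_minus_commute)
        then show "v \<in> cball 0 (r + d)" using u by simp
      qed
      show "(G n has_field_derivative deriv (G n) u) (at u within cball 0 r)"
        using holomorphic_derivI[OF hol[of n] open_ball, of u] u r
        by (auto intro: has_field_derivative_at_within)
      have "cmod (deriv (G n) u) \<le> 2 * B / d"
      proof (rule deriv_bound[OF _ d(1)])
        show "G n holomorphic_on ball u d"
          by (rule holomorphic_on_subset[OF hol]) (use ub d in force)
      qed (use n ub in auto)
      also have "\<dots> \<le> \<Lambda>" using d by (simp add: \<Lambda>_def divide_right_mono add_increasing2)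
      finally show "cmod (deriv (G n) u) \<le> \<Lambda>" .
    qed
    define \<eta> where "\<eta> = \<epsilon> / (6 * \<Lambda>)"
    have \<eta>: "\<eta> > 0" using \<epsilon> \<Lambda> by (simp add: \<eta>_def)
    have "seq_compact (cball (0::complex) r)" using compact_cball by (simp add: compact_eq_seq_compact_metric)
    from seq_compact_imp_totally_bounded[OF this, rule_format, OF \<eta>]
    obtain N :: "complex set" where N: "finite N" "N \<subseteq> cball 0 r" "cball 0 r \<subseteq> (\<Union>x\<in>N. ball x \<eta>)"
      by blast
    have "eventually (\<lambda>n. \<forall>x\<in>N. dist (G n x) (g x) < \<epsilon> / 6) U"
      using N(1,2) r \<epsilon> by (intro eventually_ball_finite ballI tendstoD[OF g]) auto
    then have glip: "cmod (g z - g w) \<le> \<Lambda> * cmod (z - w)" if zw: "z \<in> cball 0 r" "w \<in> cball 0 r" for z w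
    proof -
      have "((\<lambda>n. cmod (G n z - G n w)) \<longlongrightarrow> cmod (g z - g w)) U"
        using zw r by (intro tendsto_intros g) auto
      moreover have "eventually (\<lambda>n. cmod (G n z - G n w) \<le> \<Lambda> * cmod (z - w)) U"
        using B by eventually_elim (use lip zw in auto)
      ultimately show ?thesis using tendsto_upperbound nontrivial by blast
    qed
    have "eventually (\<lambda>n. \<forall>x\<in>N. dist (G n x) (g x) < \<epsilon> / 6) U"
      using N(1,2) r \<epsilon> by (intro eventually_ball_finite ballI tendstoD[OF g]) auto
    with B show "eventually (\<lambda>n. \<forall>z\<in>cball 0 r. dist (G n z) (g z) < \<epsilon>) U"
    proof eventually_elim
      case (elim n)
      show ?case
      proof
        fix z :: complex assume z: "z \<in> cball 0 r"
        then obtain x where x: "x \<in> N" "dist x z < \<eta>" using N(3) by auto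
        have xr: "x \<in> cball 0 r" using x N by blast
        have \<Lambda>\<eta>: "\<Lambda> * cmod (z - x) \<le> \<epsilon> / 6"
        proof -
          have "\<Lambda> * cmod (z - x) \<le> \<Lambda> * \<eta>"
            using x \<Lambda> by (intro mult_left_mono) (auto simp: dist_norm norm_minus_commute)
          then show ?thesis using \<Lambda> by (simp add: \<eta>_def)
        qed
        have "dist (G n z) (g z) \<le> dist (G n z) (G n x) + dist (G n x) (g x) + dist (g x) (g z)"
          by (metis add_right_mono dist_triangle order_trans)
        moreover have "dist (G n z) (G n x) \<le> \<epsilon> / 6"
          using lip[OF elim(1) z xr] \<Lambda>\<eta> by (simp add: dist_norm)
        moreover have "dist (g x) (g z) \<le> \<epsilon> / 6"
          using glip[OF z xr] \<Lambda>\<eta> by (simp add: dist_norm norm_minus_commute)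
        moreover have "dist (G n x) (g x) < \<epsilon> / 6" using elim(2) x by blast
        ultimately show "dist (G n z) (g z) < \<epsilon>" using \<epsilon> by linarith
      qed
    qed
  qed
  have "g holomorphic_on ball 0 R"
  proof (subst holomorphic_on_open[OF open_ball], intro ballI)
    fix z :: complex assume z: "z \<in> ball 0 R"
    define r where "r = (cmod z + R) / 2"
    have r: "0 < r" "r < R" "cmod z < r" using z norm_ge_zero[of z] by (auto simp: r_def simp del: norm_ge_zero)
    have sub: "cball 0 r \<subseteq> ball (0::complex) R" using r by auto
    have "eventually (\<lambda>n. continuous_on (cball 0 r) (G n) \<and> G n holomorphic_on ball 0 r) U"
    proof (intro always_eventually allI conjI)
      show "continuous_on (cball 0 r) (G n)" for n
        by (rule continuous_on_subset[OF holomorphic_on_imp_continuous_on[OF hol] sub])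
      show "G n holomorphic_on ball 0 r" for n
        by (rule holomorphic_on_subset[OF hol]) (use sub in auto)
    qed
    then have "g holomorphic_on ball 0 r"
      using holomorphic_uniform_limit[OF _ ul[OF r(1,2)] nontrivial] by metis
    then show "\<exists>f'. (g has_field_derivative f') (at z)"
      using r holomorphic_derivI[of g "ball 0 r" z] by auto
  qed
  moreover have "uniform_limit (cball 0 r) G g U" if "r < R" for r
  proof (cases "R > 0")
    case True
    define r' where "r' = max r (R/2)"
    have "uniform_limit (cball 0 r') G g U" using True that by (intro ul) (auto simp: r'_def)
    then show ?thesis by (rule uniform_limit_on_subset) (auto simp: r'_def)
  next
    case False
    then show ?thesis using that by (simp add: uniform_limit_iff)
  qed
  ultimately show ?thesis using that by blast
qed

end

text \<open>A free ultrafilter replaces all passages to subsequences.\<close>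

lemma free_ultrafilter_exists:
  fixes F :: "'n set"
  assumes "infinite F"
  obtains U :: "'n filter" where "ultrafilter U" "\<And>E. finite E \<Longrightarrow> eventually (\<lambda>n. n \<in> F - E) U"
proof -
  define F0 where "F0 = (INF E\<in>{E. finite E}. principal (F - E))"
  have ev0: "eventually P F0 \<longleftrightarrow> (\<exists>E. finite E \<and> (\<forall>x\<in>F - E. P x))" for P
  proof -
    have "eventually P F0 \<longleftrightarrow> (\<exists>b\<in>{E. finite E}. eventually P (principal (F - b)))"
      unfolding F0_def
    proof (rule eventually_INF_base)
      fix a b :: "'n set" assume "a \<in> {E. finite E}" "b \<in> {E. finite E}"
      then show "\<exists>x\<in>{E. finite E}. principal (F - x) \<le> inf (principal (F - a)) (principal (F - b))"
        by (intro bexI[of _ "a \<union> b"]) auto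
    qed auto
    then show ?thesis by (simp add: eventually_principal)
  qed
  have F0: "F0 \<noteq> bot"
  proof
    assume "F0 = bot"
    then obtain E where "finite E" "F - E = {}" using ev0[of "\<lambda>_. False"] by auto
    then show False using assms by (metis Diff_eq_empty_iff finite_subset)
  qed
  define A where "A = {G :: 'n filter. G \<noteq> bot \<and> G \<le> F0}"
  \<comment> \<open>Zorn for the reversed order: a minimal proper filter below the cofinite filter
    of \<open>F\<close>. The infimum of a nonempty chain of proper filters is proper, because
    whatever holds eventually for it does so for a member of the chain.\<close>
  have "\<exists>m\<in>A. \<forall>a\<in>A. m \<ge> a \<longrightarrow> a = m"
  proof (rule predicate_Zorn)
    show "partial_order_on A (relation_of (\<ge>) A)"
      by (rule partial_order_on_relation_ofI) auto
    fix Cc assume C: "Cc \<in> Chains (relation_of (\<ge>) A)"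
    then have CA: "Cc \<subseteq> A" by (auto simp: Chains_def relation_of_def)
    have tot: "a \<le> b \<or> b \<le> a" if "a \<in> Cc" "b \<in> Cc" for a b
      using C that by (auto simp: Chains_def relation_of_def)
    show "\<exists>u\<in>A. \<forall>a\<in>Cc. a \<ge> u"
    proof (cases "Cc = {}")
      case True
      then show ?thesis using F0 by (auto simp: A_def)
    next
      case False
      have evI: "eventually P (Inf Cc) \<longleftrightarrow> (\<exists>b\<in>Cc. eventually P b)" for P
        by (rule eventually_Inf_base[OF False]) (use tot in \<open>metis inf.absorb1 inf.absorb2 order_refl\<close>)
      have "Inf Cc \<noteq> bot"
      proof
        assume "Inf Cc = bot"
        then have "eventually (\<lambda>_. False) (Inf Cc)" by simp
        then obtain b where "b \<in> Cc" "eventually (\<lambda>_. False) b" using evI by blast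
        then show False using CA by (auto simp: A_def eventually_False)
      qed
      moreover have "Inf Cc \<le> F0"
        using False CA by (auto simp: A_def intro: Inf_lower2)
      ultimately show ?thesis by (intro bexI[of _ "Inf Cc"]) (auto simp: A_def Inf_lower)
    qed
  qed
  then obtain U where U: "U \<noteq> bot" "U \<le> F0" and max: "\<And>a. a \<noteq> bot \<Longrightarrow> a \<le> U \<Longrightarrow> a = U"
    unfolding A_def by (auto dest: order_trans)
  have "ultrafilter U"
  proof
    show "U \<noteq> bot" by (rule U)
    fix P
    show "eventually P U \<or> eventually (\<lambda>n. \<not> P n) U"
    proof (rule disjCI)
      assume nP: "\<not> eventually (\<lambda>n. \<not> P n) U"
      have "inf U (principal {x. P x}) \<noteq> bot"
      proof
        assume "inf U (principal {x. P x}) = bot"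
        then have "eventually (\<lambda>_. False) (inf U (principal {x. P x}))" by simp
        then show False using nP by (simp add: eventually_inf_principal)
      qed
      then have "inf U (principal {x. P x}) = U" by (intro max) auto
      moreover have "eventually P (inf U (principal {x. P x}))" by (simp add: eventually_inf_principal)
      ultimately show "eventually P U" by simp
    qed
  qed
  moreover have "eventually (\<lambda>n. n \<in> F - E) U" if "finite E" for E
    by (rule filter_leD[OF U(2)]) (use that ev0 in blast)
  ultimately show ?thesis using that by blast
qed

section \<open>Exponential scales\<close>

locale scale = ultrafilter U for U :: "'n filter" +
  fixes T :: "'n \<Rightarrow> real"
  assumes T_at_top: "filterlim T at_top U"
begin

text \<open>The rate is measured against \<open>T\<close> and must be fixed along \<open>U\<close>.
  A tiny family times a subexponential one is tiny, so subexponential factors, in particular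
  everything polynomial in \<open>T\<close>, are harmless at this scale.\<close>

definition tiny :: "complex set \<Rightarrow> ('n \<Rightarrow> complex \<Rightarrow> complex) \<Rightarrow> bool" where
  "tiny S x \<longleftrightarrow> (\<exists>c>0. eventually (\<lambda>n. \<forall>z\<in>S. cmod (x n z) \<le> exp (- c * T n)) U)"

definition subexp :: "complex set \<Rightarrow> ('n \<Rightarrow> complex \<Rightarrow> complex) \<Rightarrow> bool" where
  "subexp S x \<longleftrightarrow> (\<forall>\<epsilon>>0. eventually (\<lambda>n. \<forall>z\<in>S. cmod (x n z) \<le> exp (\<epsilon> * T n)) U)"

lemma T_ge: "eventually (\<lambda>n. T n \<ge> c) U"
  using T_at_top by (simp add: filterlim_at_top)

lemma tinyI: "c > 0 \<Longrightarrow> eventually (\<lambda>n. \<forall>z\<in>S. cmod (x n z) \<le> exp (- c * T n)) U \<Longrightarrow> tiny S x"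
  unfolding tiny_def by blast

lemma tiny_subset: "tiny S x \<Longrightarrow> S' \<subseteq> S \<Longrightarrow> tiny S' x"
  unfolding tiny_def by (fast elim: eventually_mono)

lemma subexp_subset: "subexp S x \<Longrightarrow> S' \<subseteq> S \<Longrightarrow> subexp S' x"
  unfolding subexp_def by (fast elim: eventually_mono)

lemma tiny_cong_ev: "tiny S x \<Longrightarrow> eventually (\<lambda>n. \<forall>z\<in>S. cmod (y n z) \<le> cmod (x n z)) U \<Longrightarrow> tiny S y"
  unfolding tiny_def by (elim exE conjE) (rule exI, rule conjI, assumption, erule (1) eventually_elim2, fastforce)

lemma subexp_bounded: "eventually (\<lambda>n. \<forall>z\<in>S. cmod (x n z) \<le> B) U \<Longrightarrow> subexp S x"
  unfolding subexp_def
proof (intro allI impI)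
  fix \<epsilon> :: real assume \<epsilon>: "\<epsilon> > 0" and B: "eventually (\<lambda>n. \<forall>z\<in>S. cmod (x n z) \<le> B) U"
  from B T_ge[of "(\<bar>B\<bar>) / \<epsilon>"]
  show "eventually (\<lambda>n. \<forall>z\<in>S. cmod (x n z) \<le> exp (\<epsilon> * T n)) U"
  proof eventually_elim
    case (elim n)
    have "\<bar>B\<bar> \<le> \<epsilon> * T n" using elim \<epsilon> by (simp add: field_simps)
    moreover have "\<epsilon> * T n \<le> exp (\<epsilon> * T n)" using exp_ge_add_one_self[of "\<epsilon> * T n"] by linarith
    ultimately show ?case using elim by fastforce
  qed
qed

lemma subexp_mult: "subexp S x \<Longrightarrow> subexp S y \<Longrightarrow> subexp S (\<lambda>n z. x n z * y n z)"
  unfolding subexp_def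
proof (intro allI impI)
  fix \<epsilon> :: real assume \<epsilon>: "\<epsilon> > 0"
    and x: "\<forall>\<epsilon>>0. eventually (\<lambda>n. \<forall>z\<in>S. cmod (x n z) \<le> exp (\<epsilon> * T n)) U"
    and y: "\<forall>\<epsilon>>0. eventually (\<lambda>n. \<forall>z\<in>S. cmod (y n z) \<le> exp (\<epsilon> * T n)) U"
  have "\<epsilon> / 2 > 0" using \<epsilon> by simp
  with x y have "eventually (\<lambda>n. \<forall>z\<in>S. cmod (x n z) \<le> exp (\<epsilon> / 2 * T n)) U"
    "eventually (\<lambda>n. \<forall>z\<in>S. cmod (y n z) \<le> exp (\<epsilon> / 2 * T n)) U" by blast+
  then show "eventually (\<lambda>n. \<forall>z\<in>S. cmod (x n z * y n z) \<le> exp (\<epsilon> * T n)) U"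
  proof eventually_elim
    case (elim n)
    have "exp (\<epsilon> * T n) = exp (\<epsilon> / 2 * T n) * exp (\<epsilon> / 2 * T n)" by (simp flip: exp_add)
    then show ?case using elim by (auto simp: norm_mult intro!: mult_mono)
  qed
qed

lemma tiny_subexp_mult: "tiny S x \<Longrightarrow> subexp S y \<Longrightarrow> tiny S (\<lambda>n z. x n z * y n z)"
proof -
  assume "tiny S x" and y: "subexp S y"
  then obtain c where c: "c > 0" "eventually (\<lambda>n. \<forall>z\<in>S. cmod (x n z) \<le> exp (- c * T n)) U"
    unfolding tiny_def by blast
  have "eventually (\<lambda>n. \<forall>z\<in>S. cmod (y n z) \<le> exp (c / 2 * T n)) U"
    using y c(1) unfolding subexp_def by (meson half_gt_zero)
  with c(2) have "eventually (\<lambda>n. \<forall>z\<in>S. cmod (x n z * y n z) \<le> exp (- (c / 2) * T n)) U"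
  proof eventually_elim
    case (elim n)
    have "exp (- (c / 2) * T n) = exp (- c * T n) * exp (c / 2 * T n)" by (simp flip: exp_add)
    then show ?case using elim by (auto simp: norm_mult intro!: mult_mono)
  qed
  then show ?thesis using c(1) by (intro tinyI[of "c / 2"]) auto
qed

lemma tiny_imp_subexp: "tiny S x \<Longrightarrow> subexp S x"
proof -
  assume "tiny S x"
  then obtain c where c: "c > 0" "eventually (\<lambda>n. \<forall>z\<in>S. cmod (x n z) \<le> exp (- c * T n)) U"
    unfolding tiny_def by blast
  from c(2) T_ge[of 0] have "eventually (\<lambda>n. \<forall>z\<in>S. cmod (x n z) \<le> 1) U"
  proof eventually_elim
    case (elim n)
    then have "exp (- c * T n) \<le> 1" using c by simp
    then show ?case using elim(1) order_trans by blast
  qed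
  then show ?thesis by (rule subexp_bounded)
qed

lemma tiny_add: "tiny S x \<Longrightarrow> tiny S y \<Longrightarrow> tiny S (\<lambda>n z. x n z + y n z)"
proof -
  assume "tiny S x" "tiny S y"
  then obtain c d where c: "c > 0" "eventually (\<lambda>n. \<forall>z\<in>S. cmod (x n z) \<le> exp (- c * T n)) U"
    and d: "d > 0" "eventually (\<lambda>n. \<forall>z\<in>S. cmod (y n z) \<le> exp (- d * T n)) U"
    unfolding tiny_def by blast
  define m where "m = min c d / 2"
  have m: "m > 0" "2 * m \<le> c" "2 * m \<le> d" using c d by (auto simp: m_def)
  from c(2) d(2) T_ge[of "1 / m"]
  have "eventually (\<lambda>n. \<forall>z\<in>S. cmod (x n z + y n z) \<le> exp (- m * T n)) U"
  proof eventually_elim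
    case (elim n)
    have mT: "m * T n \<ge> 1" using elim(3) m by (simp add: field_simps)
    then have T0: "T n \<ge> 0" using m by (metis mult_less_0_iff not_le not_one_le_zero order_trans zero_le_one less_le_not_le)
    have "2 * m * T n \<le> c * T n" "2 * m * T n \<le> d * T n" using m T0 by (auto intro: mult_right_mono)
    then have e: "exp (- c * T n) \<le> exp (- (2 * m) * T n)" "exp (- d * T n) \<le> exp (- (2 * m) * T n)" by auto
    have "2 \<le> exp (m * T n)" using exp_ge_add_one_self[of "m * T n"] mT by linarith
    then have "2 * exp (- (2 * m) * T n) \<le> exp (m * T n) * exp (- (2 * m) * T n)" by (intro mult_right_mono) auto
    also have "\<dots> = exp (- m * T n)" by (simp flip: exp_add)
    finally have "2 * exp (- (2 * m) * T n) \<le> exp (- m * T n)" .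
    moreover have "cmod (x n z + y n z) \<le> exp (- c * T n) + exp (- d * T n)" if "z \<in> S" for z
      using elim that norm_triangle_ineq[of "x n z" "y n z"] by fastforce
    ultimately show ?case using e by (smt (verit))
  qed
  then show ?thesis using m by (intro tinyI[of m]) auto
qed

lemma tiny_zero: "tiny S (\<lambda>n z. 0)"
  by (intro tinyI[of 1]) auto

lemma tiny_sum: "finite K \<Longrightarrow> (\<And>k. k \<in> K \<Longrightarrow> tiny S (x k)) \<Longrightarrow> tiny S (\<lambda>n z. \<Sum>k\<in>K. x k n z)"
  by (induction K rule: finite_induct) (auto intro: tiny_zero tiny_add)

lemma subexp_add: "subexp S x \<Longrightarrow> subexp S y \<Longrightarrow> subexp S (\<lambda>n z. x n z + y n z)"
  unfolding subexp_def
proof (intro allI impI)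
  fix \<epsilon> :: real assume \<epsilon>: "\<epsilon> > 0"
    and x: "\<forall>\<epsilon>>0. eventually (\<lambda>n. \<forall>z\<in>S. cmod (x n z) \<le> exp (\<epsilon> * T n)) U"
    and y: "\<forall>\<epsilon>>0. eventually (\<lambda>n. \<forall>z\<in>S. cmod (y n z) \<le> exp (\<epsilon> * T n)) U"
  have "\<epsilon> / 2 > 0" using \<epsilon> by simp
  with x y have "eventually (\<lambda>n. \<forall>z\<in>S. cmod (x n z) \<le> exp (\<epsilon> / 2 * T n)) U"
    "eventually (\<lambda>n. \<forall>z\<in>S. cmod (y n z) \<le> exp (\<epsilon> / 2 * T n)) U" by blast+
  then show "eventually (\<lambda>n. \<forall>z\<in>S. cmod (x n z + y n z) \<le> exp (\<epsilon> * T n)) U"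
    using T_ge[of "2 / \<epsilon>"]
  proof eventually_elim
    case (elim n)
    have "1 \<le> \<epsilon> / 2 * T n" using elim(3) \<epsilon> by (simp add: field_simps)
    then have "2 \<le> exp (\<epsilon> / 2 * T n)" using exp_ge_add_one_self[of "\<epsilon> / 2 * T n"] by linarith
    then have "2 * exp (\<epsilon> / 2 * T n) \<le> exp (\<epsilon> / 2 * T n) * exp (\<epsilon> / 2 * T n)" by (intro mult_right_mono) auto
    also have "\<dots> = exp (\<epsilon> * T n)" by (simp flip: exp_add)
    finally have *: "2 * exp (\<epsilon> / 2 * T n) \<le> exp (\<epsilon> * T n)" .
    show ?case
    proof
      fix z assume "z \<in> S"
      then show "cmod (x n z + y n z) \<le> exp (\<epsilon> * T n)"
        using elim * norm_triangle_ineq[of "x n z" "y n z"] by fastforce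
    qed
  qed
qed

lemma subexp_sum: "finite K \<Longrightarrow> (\<And>k. k \<in> K \<Longrightarrow> subexp S (x k)) \<Longrightarrow> subexp S (\<lambda>n z. \<Sum>k\<in>K. x k n z)"
  by (induction K rule: finite_induct) (auto intro: tiny_imp_subexp tiny_zero subexp_add)

text \<open>Propagation of smallness. Were \<open>x\<close> larger than
  \<open>exp (- \<epsilon> * T)\<close> somewhere in the large disc, the minimum modulus estimate
  would give a circle inside the small disc on which \<open>x\<close> is at least
  \<open>exp (- 2 * K * \<epsilon> * T)\<close>; with \<open>\<epsilon> = c / (4 * K)\<close> this
  contradicts the rate \<open>c\<close>.\<close>

lemma tiny_spread:
  assumes hol: "\<And>n. x n holomorphic_on unit_disc" and sub: "subexp (cball 0 r') x"
    and r: "0 < r" "r < r'" "r' \<le> 1" and \<rho>: "\<rho> > 0" "cball \<zeta> \<rho> \<subseteq> cball 0 r" and ti: "tiny (cball \<zeta> \<rho>) x"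
  shows "tiny (cball 0 r) x"
proof -
  obtain c where c: "c > 0" "eventually (\<lambda>n. \<forall>z\<in>cball \<zeta> \<rho>. cmod (x n z) \<le> exp (- c * T n)) U"
    using ti unfolding tiny_def by blast
  define K where "K = 48 / ((r' - r)\<^sup>2 * (\<rho> - \<rho>/2))"
  have K: "K > 0" using r \<rho> by (simp add: K_def)
  define \<epsilon> where "\<epsilon> = c / (4 * K)"
  have \<epsilon>: "\<epsilon> > 0" using c K by (simp add: \<epsilon>_def)
  have "eventually (\<lambda>n. \<forall>z\<in>cball 0 r'. cmod (x n z) \<le> exp (\<epsilon> * T n)) U"
    using sub \<epsilon> unfolding subexp_def by blast
  with c(2) T_ge[of 1]
  have "eventually (\<lambda>n. \<forall>z\<in>cball 0 r. cmod (x n z) \<le> exp (- \<epsilon> * T n)) U"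
  proof eventually_elim
    case (elim n)
    show ?case
    proof (rule ccontr)
      assume "\<not> ?thesis"
      then obtain z0 where z0: "z0 \<in> cball 0 r" "cmod (x n z0) \<ge> exp (- (\<epsilon> * T n))" by fastforce
      have h: "x n holomorphic_on ball 0 r'" by (rule holomorphic_on_subset[OF hol]) (use r in auto)
      have b: "cmod (x n z) \<le> exp (\<epsilon> * T n)" if "z \<in> ball 0 r'" for z using elim(3) that by auto
      have \<rho>12: "0 \<le> \<rho>/2" "\<rho>/2 < \<rho>" and A: "\<epsilon> * T n \<ge> 0" using \<rho> \<epsilon> elim by auto
      obtain \<rho>' where \<rho>': "\<rho>/2 \<le> \<rho>'" "\<rho>' \<le> \<rho>"
        "\<And>z. z \<in> sphere \<zeta> \<rho>' \<Longrightarrow> cmod (x n z) \<ge> exp (- K * (\<epsilon> * T n + \<epsilon> * T n))"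
        using minimum_modulus_circle[OF h b r z0 \<rho>12 \<rho>(2) A] unfolding K_def by blast
      have w: "\<zeta> + of_real \<rho>' \<in> sphere \<zeta> \<rho>'" using \<rho> \<rho>' by (simp add: dist_norm)
      then have "\<zeta> + of_real \<rho>' \<in> cball \<zeta> \<rho>" using \<rho>' by simp
      with elim(1) have "cmod (x n (\<zeta> + of_real \<rho>')) \<le> exp (- c * T n)" by blast
      with \<rho>'(3)[OF w] have "exp (- K * (\<epsilon> * T n + \<epsilon> * T n)) \<le> exp (- c * T n)" by (rule order_trans)
      then have "c * T n \<le> K * (\<epsilon> * T n + \<epsilon> * T n)" by simp
      also have "\<dots> = c / 2 * T n" using K by (simp add: \<epsilon>_def field_simps)
      finally show False using c elim by simp
    qed
  qed
  then show ?thesis using \<epsilon> by (intro tinyI)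
qed

text \<open>By the dichotomy, a family that is not tiny exceeds \<open>exp (- \<eta> * T)\<close> at
  some point along \<open>U\<close>, for every \<open>\<eta> > 0\<close>; the minimum modulus
  estimate spreads this to a whole circle. The radius depends on \<open>n\<close>, its range does
  not.\<close>

lemma not_tiny_circle:
  assumes hol: "\<And>n. x n holomorphic_on unit_disc" and sub: "subexp (cball 0 r') x"
    and nt: "\<not> tiny (cball 0 s) x" and r: "0 \<le> \<rho>1" "\<rho>1 < \<rho>2" "s \<le> \<rho>2" "\<rho>2 < r'" "r' \<le> 1" and \<epsilon>: "\<epsilon> > 0"
  shows "eventually (\<lambda>n. \<exists>\<rho>. \<rho>1 \<le> \<rho> \<and> \<rho> \<le> \<rho>2 \<and> (\<forall>z\<in>sphere 0 \<rho>. cmod (x n z) \<ge> exp (- \<epsilon> * T n))) U"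
proof -
  define K where "K = 48 / ((r' - \<rho>2)\<^sup>2 * (\<rho>2 - \<rho>1))"
  have K: "K > 0" using r by (simp add: K_def)
  define \<eta> where "\<eta> = \<epsilon> / (2 * K)"
  have \<eta>: "\<eta> > 0" using \<epsilon> K by (simp add: \<eta>_def)
  have "eventually (\<lambda>n. \<forall>z\<in>cball 0 r'. cmod (x n z) \<le> exp (\<eta> * T n)) U"
    using sub \<eta> unfolding subexp_def by blast
  moreover have "\<not> eventually (\<lambda>n. \<forall>z\<in>cball 0 s. cmod (x n z) \<le> exp (- \<eta> * T n)) U"
    using nt \<eta> unfolding tiny_def by blast
  then have "eventually (\<lambda>n. \<not> (\<forall>z\<in>cball 0 s. cmod (x n z) \<le> exp (- \<eta> * T n))) U"
    by (simp only: not_eventually_iff)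
  ultimately show ?thesis using T_ge[of 1]
  proof eventually_elim
    case (elim n)
    then obtain z0 where z0: "z0 \<in> cball 0 s" "cmod (x n z0) \<ge> exp (- (\<eta> * T n))" by fastforce
    have h: "x n holomorphic_on ball 0 r'" by (rule holomorphic_on_subset[OF hol]) (use r in auto)
    have b: "cmod (x n z) \<le> exp (\<eta> * T n)" if "z \<in> ball 0 r'" for z using elim(1) that by auto
    have A: "\<eta> * T n \<ge> 0" using \<eta> elim by auto
    have z0': "z0 \<in> cball 0 \<rho>2" using z0 r by auto
    have p: "0 < \<rho>2" using r by auto
    obtain \<rho>' where \<rho>': "\<rho>1 \<le> \<rho>'" "\<rho>' \<le> \<rho>2"
      "\<And>z. z \<in> sphere 0 \<rho>' \<Longrightarrow> cmod (x n z) \<ge> exp (- K * (\<eta> * T n + \<eta> * T n))"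
      using minimum_modulus_circle[OF h b p r(4,5) z0' z0(2) r(1,2) order_refl A] unfolding K_def by blast
    moreover have "- K * (\<eta> * T n + \<eta> * T n) = - \<epsilon> * T n"
    proof -
      have "K * (\<eta> * T n + \<eta> * T n) = \<epsilon> * T n" using K by (simp add: \<eta>_def field_simps)
      then show ?thesis by simp
    qed
    ultimately show ?case by metis
  qed
qed

end

section \<open>Exponential growth rates and the splitting of a relation by them\<close>

lemma exists_real_parts_nonzero:
  fixes u :: "'k \<Rightarrow> complex \<Rightarrow> complex"
  assumes "finite P" "\<And>p. p \<in> P \<Longrightarrow> u p holomorphic_on ball 0 R"
    "\<And>p. p \<in> P \<Longrightarrow> \<exists>z\<in>ball 0 R. Re (u p z) \<noteq> 0" "open S" "S \<noteq> {}" "S \<subseteq> ball 0 R"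
  shows "\<exists>z\<in>S. \<forall>p\<in>P. Re (u p z) \<noteq> 0"
  using assms
proof (induction P arbitrary: S rule: finite_induct)
  case empty
  then show ?case by auto
next
  case (insert p P)
  define S' where "S' = {z \<in> S. Re (u p z) \<noteq> 0}"
  have hol: "u p holomorphic_on ball 0 R" using insert by simp
  have "open S'"
  proof -
    have "continuous_on S (\<lambda>z. Re (u p z))"
      by (intro continuous_intros continuous_on_subset[OF holomorphic_on_imp_continuous_on[OF hol]]) (use insert in auto)
    then have "open (S \<inter> (\<lambda>z. Re (u p z)) -` (- {0}))"
      by (intro continuous_open_preimage) (use insert in auto)
    moreover have "S' = S \<inter> (\<lambda>z. Re (u p z)) -` (- {0})" by (auto simp: S'_def)
    ultimately show ?thesis by simp
  qed
  moreover have "S' \<noteq> {}"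
  proof
    assume "S' = {}"
    then have z: "Re (u p z) = 0" if "z \<in> S" for z using that by (auto simp: S'_def)
    show False
    proof (cases "u p constant_on ball 0 R")
      case True
      then obtain c where "\<And>z. z \<in> ball 0 R \<Longrightarrow> u p z = c" unfolding constant_on_def by blast
      then show False using z insert.prems by (metis all_not_in_conv insertI1 subsetD)
    next
      case False
      \<comment> \<open>A real part vanishing on \<open>S\<close> would confine this open image to
        the imaginary axis.\<close>
      have "open (u p ` S)"
        by (rule open_mapping_thm[OF hol open_ball connected_ball _ _ False]) (use insert in auto)
      moreover obtain w where w: "w \<in> S" using insert by auto
      ultimately obtain e where e: "e > 0" "ball (u p w) e \<subseteq> u p ` S" by (meson image_eqI open_contains_ball)
      have "u p w + of_real (e/2) \<in> ball (u p w) e" using e by (simp add: dist_norm)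
      then obtain w' where "w' \<in> S" "u p w + of_real (e/2) = u p w'" using e by auto
      then have "Re (u p w) + e/2 = Re (u p w')" by (metis Re_complex_of_real plus_complex.simps(1))
      then show False using z w \<open>w' \<in> S\<close> e by simp
    qed
  qed
  ultimately obtain z where "z \<in> S'" "\<forall>p\<in>P. Re (u p z) \<noteq> 0"
    using insert.IH[of S'] insert.prems by (auto simp: S'_def)
  then show ?case by (auto simp: S'_def)
qed

context scale
begin

text \<open>An upper rate on the scale \<open>T\<close>, written with the exponential rather than as
  a bound for \<open>ln (cmod (x n z)) / T n\<close>, so that zeros of \<open>x\<close> need no
  exception. Rates add under multiplication; rate \<open>0\<close> is subexponential, and a rate
  below a negative constant is tiny.\<close>

definition growth :: "complex set \<Rightarrow> (complex \<Rightarrow> real) \<Rightarrow> ('n \<Rightarrow> complex \<Rightarrow> complex) \<Rightarrow> bool" where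
  "growth S v x \<longleftrightarrow> (\<forall>\<epsilon>>0. eventually (\<lambda>n. \<forall>z\<in>S. cmod (x n z) \<le> exp (T n * (v z + \<epsilon>))) U)"

lemma growth_subset: "growth S v x \<Longrightarrow> S' \<subseteq> S \<Longrightarrow> growth S' v x"
  unfolding growth_def by (fast elim: eventually_mono)

lemma growth_mult:
  assumes "growth S v x" "growth S w y" shows "growth S (\<lambda>z. v z + w z) (\<lambda>n z. x n z * y n z)"
  unfolding growth_def
proof (intro allI impI)
  fix \<epsilon> :: real assume "\<epsilon> > 0"
  then have "\<epsilon> / 2 > 0" by simp
  with assms have "eventually (\<lambda>n. \<forall>z\<in>S. cmod (x n z) \<le> exp (T n * (v z + \<epsilon> / 2))) U"
    "eventually (\<lambda>n. \<forall>z\<in>S. cmod (y n z) \<le> exp (T n * (w z + \<epsilon> / 2))) U" unfolding growth_def by blast+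
  then show "eventually (\<lambda>n. \<forall>z\<in>S. cmod (x n z * y n z) \<le> exp (T n * (v z + w z + \<epsilon>))) U"
  proof eventually_elim
    case (elim n)
    have "exp (T n * (v z + w z + \<epsilon>)) = exp (T n * (v z + \<epsilon> / 2)) * exp (T n * (w z + \<epsilon> / 2))" for z
      by (simp add: algebra_simps flip: exp_add)
    then show ?case using elim by (auto simp: norm_mult intro!: mult_mono)
  qed
qed

lemma growth_zero_iff: "growth S (\<lambda>_. 0) x \<longleftrightarrow> subexp S x"
  unfolding growth_def subexp_def by (simp add: mult.commute)

lemma growth_cong: "growth S v x \<Longrightarrow> (\<And>z. z \<in> S \<Longrightarrow> v z = w z) \<Longrightarrow> growth S w x"
  unfolding growth_def by simp

lemma growth_tiny:
  assumes "growth S v x" "c > 0" "\<And>z. z \<in> S \<Longrightarrow> v z \<le> - c"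
  shows "tiny S x"
proof (rule tinyI[of "c / 2"])
  have "c / 2 > 0" using assms(2) by simp
  then have "eventually (\<lambda>n. \<forall>z\<in>S. cmod (x n z) \<le> exp (T n * (v z + c / 2))) U"
    using assms(1) unfolding growth_def by blast
  then show "eventually (\<lambda>n. \<forall>z\<in>S. cmod (x n z) \<le> exp (- (c / 2) * T n)) U"
    using T_ge[of 0]
  proof eventually_elim
    case (elim n)
    show ?case
    proof
      fix z assume z: "z \<in> S"
      have "T n * (v z + c / 2) \<le> T n * (- (c / 2))"
        using assms(3)[OF z] elim by (intro mult_left_mono) auto
      then have "exp (T n * (v z + c / 2)) \<le> exp (- (c / 2) * T n)" by (simp add: mult.commute)
      with elim(1) z show "cmod (x n z) \<le> exp (- (c / 2) * T n)" using order_trans by blast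
    qed
  qed
qed (use assms in simp)

lemma tiny_growth:
  assumes "tiny S x" obtains c where "c > 0" "growth S (\<lambda>_. - c) x"
proof -
  obtain c where c: "c > 0" "eventually (\<lambda>n. \<forall>z\<in>S. cmod (x n z) \<le> exp (- c * T n)) U"
    using assms unfolding tiny_def by blast
  have "growth S (\<lambda>_. - c) x" unfolding growth_def
  proof (intro allI impI)
    fix \<epsilon> :: real assume \<epsilon>: "\<epsilon> > 0"
    from c(2) T_ge[of 0] show "eventually (\<lambda>n. \<forall>z\<in>S. cmod (x n z) \<le> exp (T n * (- c + \<epsilon>))) U"
    proof eventually_elim
      case (elim n)
      have "0 \<le> T n * \<epsilon>" using elim \<epsilon> by simp
      then have "exp (- c * T n) \<le> exp (T n * (- c + \<epsilon>))" by (simp add: algebra_simps)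
      then show ?case using elim(1) order_trans by blast
    qed
  qed
  with c that show ?thesis by blast
qed

text \<open>A branch of the logarithm is divided by \<open>T\<close>. Its real part is bounded by
  \<open>1\<close>; once the imaginary part at \<open>0\<close> has been subtracted,
  Borel-Caratheodory bounds the whole function on smaller discs, and Montel applies. Only real parts
  enter the conclusion, so the normalisation is harmless.\<close>

lemma scaled_log_limit:
  fixes h :: "'n \<Rightarrow> complex \<Rightarrow> complex"
  assumes hol: "\<And>n. h n holomorphic_on unit_disc" and nz: "\<And>n z. z \<in> unit_disc \<Longrightarrow> h n z \<noteq> 0"
    and R: "0 < R" "R \<le> 1"
    and bd: "eventually (\<lambda>n. \<forall>z\<in>ball 0 R. \<bar>ln (cmod (h n z))\<bar> \<le> T n) U"
  obtains G where "G holomorphic_on ball 0 R"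
    "\<And>r \<epsilon>. r < R \<Longrightarrow> \<epsilon> > 0 \<Longrightarrow>
      eventually (\<lambda>n. \<forall>z\<in>cball 0 r. \<bar>ln (cmod (h n z)) - T n * Re (G z)\<bar> \<le> \<epsilon> * T n) U"
proof -
  have "\<exists>g. g holomorphic_on unit_disc \<and> (\<forall>z\<in>unit_disc. ln (cmod (h n z)) = Re (g z))" for n
    using ball_holomorphic_log[OF hol nz] by metis
  then obtain g where g: "\<And>n. g n holomorphic_on unit_disc" "\<And>n z. z \<in> unit_disc \<Longrightarrow> ln (cmod (h n z)) = Re (g n z)"
    by metis
  define G where "G n z = (g n z - of_real (Im (g n 0)) * \<i>) / of_real (T n)" for n z
  have sub: "ball 0 R \<subseteq> unit_disc" using R by auto
  have holG: "G n holomorphic_on ball 0 R" for n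
  proof (cases "T n = 0")
    case True
    then have "G n = (\<lambda>z. 0)" by (simp add: G_def fun_eq_iff)
    then show ?thesis by simp
  next
    case False
    then show ?thesis unfolding G_def
      by (intro holomorphic_intros holomorphic_on_subset[OF g(1) sub]) auto
  qed
  have ReG: "Re (G n z) = ln (cmod (h n z)) / T n" if "z \<in> ball 0 R" for n z
    using g(2)[of z n] sub that by (auto simp: G_def Re_divide_of_real)
  have "\<exists>B. eventually (\<lambda>n. \<forall>z\<in>cball 0 r. cmod (G n z) \<le> B) U" if r: "0 < r" "r < R" for r
  proof -
    from bd T_ge[of 1] have "eventually (\<lambda>n. \<forall>z\<in>cball 0 r. cmod (G n z) \<le> 1 + 2 * 2 * r / (R - r)) U"
    proof eventually_elim
      case (elim n)
      have Re1: "\<bar>Re (G n z)\<bar> \<le> 1" if "z \<in> ball 0 R" for z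
        using elim that ReG[OF that, of n] by (simp add: abs_divide divide_le_eq)
      show ?case
      proof
        fix z :: complex assume z: "z \<in> cball 0 r"
        then have zR: "z \<in> ball 0 R" using r by auto
        have "(\<lambda>z. G n z + 1) holomorphic_on ball 0 R" by (intro holomorphic_intros holG)
        moreover have "Re (G n z + 1) \<ge> 0" if "z \<in> ball 0 R" for z using Re1[OF that] by simp
        ultimately have "cmod (G n z + 1 - (G n 0 + 1)) \<le> 2 * Re (G n 0 + 1) * dist z 0 / (R - dist z 0)"
          using positive_real_part_bounds(1)[of "\<lambda>z. G n z + 1" 0 R z] zR R by blast
        also have "\<dots> \<le> 2 * 2 * r / (R - r)"
          using Re1[of 0] z r R by (intro frac_le mult_mono) auto
        finally have "cmod (G n z - G n 0) \<le> 2 * 2 * r / (R - r)" by simp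
        moreover have "cmod (G n 0) \<le> 1"
        proof -
          have "Im (G n 0) = 0" by (simp add: G_def Im_divide_of_real)
          then have "cmod (G n 0) = \<bar>Re (G n 0)\<bar>" by (simp add: cmod_eq_Re)
          then show ?thesis using Re1[of 0] R by simp
        qed
        ultimately show "cmod (G n z) \<le> 1 + 2 * 2 * r / (R - r)"
          using norm_triangle_ineq2[of "G n z" "G n 0"] by linarith
      qed
    qed
    then show ?thesis by blast
  qed
  then obtain Gl where Gl: "Gl holomorphic_on ball 0 R" "\<And>r. r < R \<Longrightarrow> uniform_limit (cball 0 r) G Gl U"
    using montel[of G R] holG by blast
  have "eventually (\<lambda>n. \<forall>z\<in>cball 0 r. \<bar>ln (cmod (h n z)) - T n * Re (Gl z)\<bar> \<le> \<epsilon> * T n) U"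
    if r: "r < R" "\<epsilon> > 0" for r \<epsilon>
  proof -
    have "eventually (\<lambda>n. \<forall>z\<in>cball 0 r. dist (G n z) (Gl z) < \<epsilon>) U"
      using Gl(2)[OF r(1)] r(2) by (simp add: uniform_limit_iff)
    then show ?thesis using T_ge[of 1]
    proof eventually_elim
      case (elim n)
      show ?case
      proof
        fix z :: complex assume z: "z \<in> cball 0 r"
        then have zR: "z \<in> ball 0 R" using r by auto
        have "\<bar>Re (G n z) - Re (Gl z)\<bar> \<le> \<epsilon>"
          using elim(1) z abs_Re_le_cmod[of "G n z - Gl z"] by (fastforce simp: dist_norm)
        then have "T n * \<bar>ln (cmod (h n z)) / T n - Re (Gl z)\<bar> \<le> T n * \<epsilon>"
          unfolding ReG[OF zR] using elim by (intro mult_left_mono) auto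
        moreover have "T n * \<bar>ln (cmod (h n z)) / T n - Re (Gl z)\<bar> = \<bar>T n * (ln (cmod (h n z)) / T n - Re (Gl z))\<bar>"
          using elim by (simp add: abs_mult)
        moreover have "T n * (ln (cmod (h n z)) / T n - Re (Gl z)) = ln (cmod (h n z)) - T n * Re (Gl z)"
          using elim by (simp add: right_diff_distrib)
        ultimately show "\<bar>ln (cmod (h n z)) - T n * Re (Gl z)\<bar> \<le> \<epsilon> * T n" by (simp add: mult.commute)
      qed
    qed
  qed
  with Gl(1) that show ?thesis by blast
qed

end

lemma isCont_obtain_delta:
  fixes f :: "'a::metric_space \<Rightarrow> 'b::metric_space"
  assumes "isCont f x" "e > 0"
  obtains d where "d > 0" "\<And>z. dist z x < d \<Longrightarrow> dist (f z) (f x) < e"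
  using assms unfolding continuous_at_eps_delta by blast

context scale
begin

text \<open>The limits \<open>v\<close> of the scaled logarithms split the terms into classes of equal \<open>v\<close>. If a class sum is
  not exponentially small, then near a point where its \<open>v\<close> is maximal all exponentially small class sums
  are negligible. At a nearby point where the remaining \<open>v\<close> are pairwise distinct, one class would be
  larger than everything that must cancel it.\<close>

lemma dominant_class_tiny:
  fixes h \<alpha> :: "'n \<Rightarrow> nat \<Rightarrow> complex \<Rightarrow> complex" and J :: "nat set"
  assumes J: "finite J" "0 \<in> J"
    and hol: "\<And>n j. j \<in> J \<Longrightarrow> h n j holomorphic_on unit_disc"
    and nz: "\<And>n j z. j \<in> J \<Longrightarrow> z \<in> unit_disc \<Longrightarrow> h n j z \<noteq> 0"
    and h0: "\<And>n z. z \<in> unit_disc \<Longrightarrow> h n 0 z = 1"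
    and hol\<alpha>: "\<And>n j. j \<in> J \<Longrightarrow> \<alpha> n j holomorphic_on unit_disc"
    and R: "0 \<le> s" "s < R" "R \<le> 1"
    and bd: "eventually (\<lambda>n. \<forall>j\<in>J. \<forall>z\<in>ball 0 R. \<bar>ln (cmod (h n j z))\<bar> \<le> T n) U"
    and sub\<alpha>: "\<And>j. j \<in> J \<Longrightarrow> subexp (ball 0 R) (\<lambda>n. \<alpha> n j)"
    and err: "tiny (ball 0 R) (\<lambda>n z. \<Sum>j\<in>J. \<alpha> n j z * h n j z)"
    and pts: "eventually (\<lambda>n. zz n \<in> cball 0 s) U"
      "\<And>\<epsilon>. \<epsilon> > 0 \<Longrightarrow> eventually (\<lambda>n. \<forall>j\<in>J. ln (cmod (h n j (zz n))) \<le> \<epsilon> * T n) U"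
  obtains Q where "Q \<subseteq> J" "0 \<in> Q"
    "\<And>j r \<epsilon>. j \<in> Q \<Longrightarrow> r < R \<Longrightarrow> \<epsilon> > 0 \<Longrightarrow>
       eventually (\<lambda>n. \<forall>z\<in>cball 0 r. \<bar>ln (cmod (h n j z))\<bar> \<le> \<epsilon> * T n) U"
    "\<And>r. 0 < r \<Longrightarrow> r < R \<Longrightarrow> tiny (cball 0 r) (\<lambda>n z. \<Sum>j\<in>Q. \<alpha> n j z * h n j z)"
proof -
  have R0: "R > 0" using R by simp
  have subU: "ball 0 R \<subseteq> unit_disc" using R by auto
  have "\<exists>G. G holomorphic_on ball 0 R \<and> (\<forall>r \<epsilon>. r < R \<longrightarrow> \<epsilon> > 0 \<longrightarrow>
      eventually (\<lambda>n. \<forall>z\<in>cball 0 r. \<bar>ln (cmod (h n j z)) - T n * Re (G z)\<bar> \<le> \<epsilon> * T n) U)" if j: "j \<in> J" for j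
  proof -
    have *: "eventually (\<lambda>n. \<forall>z\<in>ball 0 R. \<bar>ln (cmod (h n j z))\<bar> \<le> T n) U"
      using bd by eventually_elim (use j in blast)
    show ?thesis
    proof (rule scaled_log_limit[where h = "\<lambda>n. h n j", OF _ _ R0 R(3) *])
      show "h n j holomorphic_on unit_disc" for n by (rule hol[OF j])
      show "h n j z \<noteq> 0" if "z \<in> unit_disc" for n z by (rule nz[OF j that])
    qed blast
  qed
  then obtain G where G: "\<And>j. j \<in> J \<Longrightarrow> G j holomorphic_on ball 0 R"
    and Glim: "\<And>j r \<epsilon>. j \<in> J \<Longrightarrow> r < R \<Longrightarrow> \<epsilon> > 0 \<Longrightarrow>
      eventually (\<lambda>n. \<forall>z\<in>cball 0 r. \<bar>ln (cmod (h n j z)) - T n * Re (G j z)\<bar> \<le> \<epsilon> * T n) U"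
  proof -
    assume *: "\<And>G. (\<And>j. j \<in> J \<Longrightarrow> G j holomorphic_on ball 0 R) \<Longrightarrow>
      (\<And>j r \<epsilon>. j \<in> J \<Longrightarrow> r < R \<Longrightarrow> \<epsilon> > 0 \<Longrightarrow>
        eventually (\<lambda>n. \<forall>z\<in>cball 0 r. \<bar>ln (cmod (h n j z)) - T n * Re (G j z)\<bar> \<le> \<epsilon> * T n) U) \<Longrightarrow> thesis"
    assume "\<And>j. j \<in> J \<Longrightarrow> \<exists>G. G holomorphic_on ball 0 R \<and> (\<forall>r \<epsilon>. r < R \<longrightarrow> \<epsilon> > 0 \<longrightarrow>
      eventually (\<lambda>n. \<forall>z\<in>cball 0 r. \<bar>ln (cmod (h n j z)) - T n * Re (G z)\<bar> \<le> \<epsilon> * T n) U)"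
    then have "\<forall>j\<in>J. \<exists>G. G holomorphic_on ball 0 R \<and> (\<forall>r \<epsilon>. r < R \<longrightarrow> \<epsilon> > 0 \<longrightarrow>
      eventually (\<lambda>n. \<forall>z\<in>cball 0 r. \<bar>ln (cmod (h n j z)) - T n * Re (G z)\<bar> \<le> \<epsilon> * T n) U)" by blast
    from bchoice[OF this] show thesis using * by blast
  qed
  define v where "v j z = Re (G j z)" for j z
  have contv: "continuous_on (ball 0 R) (v j)" if "j \<in> J" for j
    unfolding v_def by (intro continuous_intros holomorphic_on_imp_continuous_on G that)
  have gr: "growth (cball 0 r) (v j) (\<lambda>n. h n j)" "growth (cball 0 r) (\<lambda>z. - v j z) (\<lambda>n z. inverse (h n j z))"
    if j: "j \<in> J" and r: "r < R" for j r
  proof -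
    have *: "eventually (\<lambda>n. \<forall>z\<in>cball 0 r. cmod (h n j z) \<le> exp (T n * (v j z + \<epsilon>)) \<and>
        cmod (inverse (h n j z)) \<le> exp (T n * (- v j z + \<epsilon>))) U" if \<epsilon>: "\<epsilon> > 0" for \<epsilon>
      using Glim[OF j r \<epsilon>]
    proof eventually_elim
      case (elim n)
      show ?case
      proof (intro ballI conjI)
        fix z :: complex assume z: "z \<in> cball 0 r"
        then have hz: "h n j z \<noteq> 0" using r R by (intro nz[OF j]) auto
        have a: "\<bar>ln (cmod (h n j z)) - T n * v j z\<bar> \<le> \<epsilon> * T n" using elim z unfolding v_def by blast
        then have "exp (ln (cmod (h n j z))) \<le> exp (T n * (v j z + \<epsilon>))" by (simp add: algebra_simps abs_le_iff)
        then show "cmod (h n j z) \<le> exp (T n * (v j z + \<epsilon>))" using hz by simp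
        have "exp (- ln (cmod (h n j z))) \<le> exp (T n * (- v j z + \<epsilon>))" using a by (simp add: algebra_simps abs_le_iff)
        then show "cmod (inverse (h n j z)) \<le> exp (T n * (- v j z + \<epsilon>))" using hz by (simp add: exp_minus norm_inverse)
      qed
    qed
    show "growth (cball 0 r) (v j) (\<lambda>n. h n j)" "growth (cball 0 r) (\<lambda>z. - v j z) (\<lambda>n z. inverse (h n j z))"
      unfolding growth_def by (intro allI impI, rule eventually_mono[OF *], assumption, blast)+
  qed
  have T_pos: "eventually (\<lambda>n. T n > 0) U" using T_ge[of 1] by eventually_elim simp
  have v0: "v 0 z = 0" if z: "z \<in> ball 0 R" for z
  proof (rule ccontr)
    assume "v 0 z \<noteq> 0"
    then have "\<bar>v 0 z\<bar> / 2 > 0" by simp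
    from Glim[OF J(2) _ this, of "cmod z"] z
    have "eventually (\<lambda>n. \<bar>ln (cmod (h n 0 z)) - T n * v 0 z\<bar> \<le> \<bar>v 0 z\<bar> / 2 * T n) U"
      by (auto simp: v_def elim!: eventually_mono)
    with T_pos have "eventually (\<lambda>n. False) U"
    proof eventually_elim
      case (elim n)
      have "h n 0 z = 1" using h0 z subU by blast
      then have "T n * \<bar>v 0 z\<bar> \<le> \<bar>v 0 z\<bar> / 2 * T n" using elim by (simp add: abs_mult)
      then have "\<bar>v 0 z\<bar> * T n \<le> 0" by (simp add: mult.commute)
      then show False using elim \<open>v 0 z \<noteq> 0\<close> by (simp add: mult_le_0_iff)
    qed
    then show False using nontrivial by (simp add: eventually_False)
  qed
  \<comment> \<open>Indices are grouped by equality of the limit functions \<open>v\<close> on the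
    whole disc; the least index represents a class, so that \<open>0\<close> represents its
    own.\<close>
  define P where "P j i \<longleftrightarrow> i \<in> J \<and> (\<forall>z\<in>ball 0 R. v i z = v j z)" for i j
  define rep where "rep j = (LEAST i. P j i)" for j
  define K where "K = rep ` J"
  define cls where "cls k = {i \<in> J. rep i = k}" for k
  have Prep: "P j (rep j)" if "j \<in> J" for j
    unfolding rep_def by (rule LeastI[of _ j]) (use that in \<open>simp add: P_def\<close>)
  have repeq: "rep i = rep j" if "P j i" for i j
  proof -
    have "P i = P j" using that by (auto simp: P_def fun_eq_iff)
    then show ?thesis by (simp add: rep_def)
  qed
  have rep0: "rep 0 = 0" unfolding rep_def by (rule Least_eq_0) (use J in \<open>simp add: P_def\<close>)
  have KJ: "K \<subseteq> J" using Prep by (auto simp: K_def P_def)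
  have finK: "finite K" using J by (simp add: K_def)
  have K0: "0 \<in> K" using rep0 J by (force simp: K_def)
  have vcls: "v i z = v k z" if "i \<in> cls k" "z \<in> ball 0 R" for i k z
    using Prep[of i] that by (auto simp: cls_def P_def)
  have vK: "\<exists>z\<in>ball 0 R. v k z \<noteq> v l z" if kl: "k \<in> K" "l \<in> K" "k \<noteq> l" for k l
  proof (rule ccontr)
    assume "\<not> ?thesis"
    then have "P l k" using kl KJ by (auto simp: P_def)
    then have "rep k = rep l" by (rule repeq)
    moreover have "rep k = k" "rep l = l"
      using kl repeq Prep by (auto simp: K_def)
    ultimately show False using kl by simp
  qed
  \<comment> \<open>The class sum divided by the representative unit. Within a class the rates
    cancel, so \<open>b k\<close> is subexponential and all growth sits in
    \<open>h k\<close>.\<close>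
  define b where "b k n z = (\<Sum>i\<in>cls k. \<alpha> n i z * (h n i z * inverse (h n k z)))" for k n z
  have finc: "finite (cls k)" for k using J by (simp add: cls_def)
  have clsJ: "cls k \<subseteq> J" for k by (auto simp: cls_def)
  have holb: "b k n holomorphic_on unit_disc" if "k \<in> K" for k n
    unfolding b_def using clsJ KJ that nz hol hol\<alpha>
    by (intro holomorphic_intros) (auto simp: subset_eq)
  have subb: "subexp (cball 0 r) (b k)" if k: "k \<in> K" and r: "r < R" for k r
    unfolding b_def
  proof (rule subexp_sum[OF finc], rule subexp_mult)
    fix i assume i: "i \<in> cls k"
    show "subexp (cball 0 r) (\<lambda>n. \<alpha> n i)"
      by (rule subexp_subset[OF sub\<alpha>]) (use i clsJ r in auto)
    have "growth (cball 0 r) (\<lambda>z. v i z + - v k z) (\<lambda>n z. h n i z * inverse (h n k z))"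
      using i k clsJ KJ r by (intro growth_mult gr) auto
    then have "growth (cball 0 r) (\<lambda>z. 0) (\<lambda>n z. h n i z * inverse (h n k z))"
      by (rule growth_cong) (use vcls[OF i] r in auto)
    then show "subexp (cball 0 r) (\<lambda>n z. h n i z * inverse (h n k z))" by (simp add: growth_zero_iff)
  qed
  have bh: "b k n z * h n k z = (\<Sum>i\<in>cls k. \<alpha> n i z * h n i z)" if "k \<in> K" "z \<in> unit_disc" for k n z
  proof -
    have "h n k z \<noteq> 0" using nz that KJ by blast
    then show ?thesis unfolding b_def sum_distrib_right by (intro sum.cong) auto
  qed
  have total: "(\<Sum>j\<in>J. \<alpha> n j z * h n j z) = (\<Sum>k\<in>K. b k n z * h n k z)" if z: "z \<in> unit_disc" for n z
  proof -
    have "(\<Sum>j\<in>J. \<alpha> n j z * h n j z) = (\<Sum>k\<in>K. \<Sum>i\<in>cls k. \<alpha> n i z * h n i z)"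
      unfolding K_def cls_def by (rule sum.image_gen[OF J(1)])
    then show ?thesis using bh z by simp
  qed
  \<comment> \<open>By propagation of smallness a class is null as soon as \<open>b k\<close> is
    tiny on one small disc, so the local analysis near \<open>zs\<close> is enough.\<close>
  define null where "null k \<longleftrightarrow> (\<forall>r. 0 < r \<longrightarrow> r < R \<longrightarrow> tiny (cball 0 r) (b k))" for k
  have spread: "null k" if k: "k \<in> K" and \<rho>: "\<rho> > 0" "cball \<zeta> \<rho> \<subseteq> ball 0 R" and ti: "tiny (cball \<zeta> \<rho>) (b k)" for k \<zeta> \<rho>
    unfolding null_def
  proof (intro allI impI)
    fix r assume r: "0 < r" "r < R"
    have "cmod \<zeta> + \<rho> < R" using \<rho> R0 by (simp add: cball_subset_ball_iff dist_norm)
    define r1 where "r1 = max r (cmod \<zeta> + \<rho>)"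
    have r1: "0 < r1" "r1 < R" "r \<le> r1" using r \<open>cmod \<zeta> + \<rho> < R\<close> by (auto simp: r1_def)
    have "tiny (cball 0 r1) (b k)"
    proof (rule tiny_spread[OF holb[OF k] _ r1(1) _ _ \<rho>(1) _ ti])
      show "subexp (cball 0 ((r1 + R) / 2)) (b k)" by (rule subb[OF k]) (use r1 in auto)
      show "cball \<zeta> \<rho> \<subseteq> cball 0 r1" by (simp add: cball_subset_cball_iff dist_norm r1_def)
    qed (use r1 R in auto)
    then show "tiny (cball 0 r) (b k)" by (rule tiny_subset) (use r1 in auto)
  qed
  have "null 0"
  proof (rule ccontr)
    assume nn: "\<not> null 0"
    \<comment> \<open>At the limit \<open>zs\<close> of the points \<open>zz\<close> no rate is
      positive, while the rate of \<open>0\<close> vanishes: the class of \<open>0\<close> is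
      maximal there.\<close>
    obtain zs where zs: "zs \<in> cball 0 s" "(zz \<longlongrightarrow> zs) U" using compact_limit[OF compact_cball pts(1)] by blast
    have zsR: "zs \<in> ball 0 R" using zs R by auto
    define r where "r = (s + R) / 2"
    have r: "0 < r" "s < r" "r < R" using R by (auto simp: r_def)
    have vzs: "v j zs \<le> 0" if j: "j \<in> J" for j
    proof (rule field_le_epsilon)
      fix \<epsilon> :: real assume \<epsilon>: "\<epsilon> > 0"
      then have \<epsilon>2: "\<epsilon> / 2 > 0" by simp
      have "isCont (v j) zs" using contv[OF j] zsR by (simp add: continuous_on_eq_continuous_at)
      then have "((\<lambda>n. v j (zz n)) \<longlongrightarrow> v j zs) U" using zs(2) by (rule isCont_tendsto_compose)
      moreover have "eventually (\<lambda>n. v j (zz n) \<le> \<epsilon>) U"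
        using pts(1) pts(2)[OF \<epsilon>2] Glim[OF j r(3) \<epsilon>2] T_pos
      proof eventually_elim
        case (elim n)
        have "zz n \<in> cball 0 r" using elim r by auto
        then have "\<bar>ln (cmod (h n j (zz n))) - T n * v j (zz n)\<bar> \<le> \<epsilon> / 2 * T n" using elim \<epsilon> unfolding v_def by auto
        moreover have "ln (cmod (h n j (zz n))) \<le> \<epsilon> / 2 * T n" using elim j \<epsilon> by auto
        moreover have "\<epsilon> / 2 * T n + \<epsilon> / 2 * T n = T n * \<epsilon>" by simp
        ultimately have "T n * v j (zz n) \<le> T n * \<epsilon>" by linarith
        then show ?case using elim by simp
      qed
      ultimately show "v j zs \<le> 0 + \<epsilon>" using tendsto_upperbound[of "\<lambda>n. v j (zz n)" "v j zs" U \<epsilon>] nontrivial by simp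
    qed
    have nbhd: "\<exists>\<rho>>0. cball zs \<rho> \<subseteq> cball 0 r \<and> (\<forall>z\<in>cball zs \<rho>. v j z \<le> v j zs + \<eta>)" if jn: "j \<in> J" "\<eta> > 0" for j \<eta>
    proof -
      have "isCont (v j) zs" using contv[OF jn(1)] zsR by (simp add: continuous_on_eq_continuous_at)
      then obtain d where d: "d > 0" "\<And>z. dist z zs < d \<Longrightarrow> dist (v j z) (v j zs) < \<eta>"
        using isCont_obtain_delta[OF _ jn(2)] by blast
      define \<rho> where "\<rho> = min (d / 2) (r - s)"
      have \<rho>: "\<rho> > 0" "\<rho> < d" "\<rho> \<le> r - s" using d r by (auto simp: \<rho>_def)
      have "v j z \<le> v j zs + \<eta>" if "z \<in> cball zs \<rho>" for z
        using d(2)[of z] that \<rho> by (force simp: dist_real_def dist_commute)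
      moreover have "cball zs \<rho> \<subseteq> cball 0 r" using zs(1) \<rho> by (simp add: cball_subset_cball_iff dist_norm)
      ultimately show ?thesis using \<rho>(1) by blast
    qed
    \<comment> \<open>The classes that can still compete near \<open>zs\<close>. All others
      contribute exponentially small sums there: for a null class the gain in \<open>b k\<close>
      outweighs a possible small positive rate of \<open>h k\<close>, and the rest have negative
      rate at \<open>zs\<close>.\<close>
    define NJ where "NJ = {k \<in> K. v k zs = 0 \<and> \<not> null k}"
    have NJ0: "0 \<in> NJ" using K0 v0[OF zsR] nn by (simp add: NJ_def)
    have small: "\<exists>\<rho>>0. cball zs \<rho> \<subseteq> cball 0 r \<and> tiny (cball zs \<rho>) (\<lambda>n z. b k n z * h n k z)" if k: "k \<in> K - NJ" for k
    proof (cases "null k")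
      case True
      then obtain c where c: "c > 0" "growth (cball 0 r) (\<lambda>_. - c) (b k)" using r tiny_growth unfolding null_def by metis
      obtain \<rho> where \<rho>: "\<rho> > 0" "cball zs \<rho> \<subseteq> cball 0 r" "\<forall>z\<in>cball zs \<rho>. v k z \<le> v k zs + c / 2"
        using nbhd[of k "c / 2"] k KJ c by auto
      have "growth (cball zs \<rho>) (\<lambda>z. - c + v k z) (\<lambda>n z. b k n z * h n k z)"
        by (rule growth_subset[OF growth_mult[OF c(2) gr(1)] \<rho>(2)]) (use k KJ r in auto)
      then have "tiny (cball zs \<rho>) (\<lambda>n z. b k n z * h n k z)"
      proof (rule growth_tiny)
        show "c / 2 > 0" using c by simp
        fix z assume "z \<in> cball zs \<rho>"
        then have "v k z \<le> v k zs + c / 2" using \<rho>(3) by blast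
        then show "- c + v k z \<le> - (c / 2)" using vzs[of k] k KJ by auto
      qed
      with \<rho> show ?thesis by blast
    next
      case False
      define c where "c = - v k zs"
      have c: "c > 0" using k False vzs[of k] KJ by (force simp: NJ_def c_def less_le)
      obtain \<rho> where \<rho>: "\<rho> > 0" "cball zs \<rho> \<subseteq> cball 0 r" "\<forall>z\<in>cball zs \<rho>. v k z \<le> v k zs + c / 2"
        using nbhd[of k "c / 2"] k KJ c by auto
      have "growth (cball 0 r) (\<lambda>_. 0) (b k)" unfolding growth_zero_iff using k r by (intro subb) auto
      from growth_mult[OF this gr(1)[of k r]] have "growth (cball zs \<rho>) (\<lambda>z. 0 + v k z) (\<lambda>n z. b k n z * h n k z)"
        using k KJ r by (intro growth_subset[OF _ \<rho>(2)]) auto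
      then have "tiny (cball zs \<rho>) (\<lambda>n z. b k n z * h n k z)"
        by (rule growth_tiny[where c = "c / 2"]) (use c \<rho>(3) in \<open>auto simp: c_def\<close>)
      with \<rho> show ?thesis by blast
    qed
    have shrink: "\<exists>\<rho>>0. cball zs \<rho> \<subseteq> cball 0 r \<and> (\<forall>k\<in>A. tiny (cball zs \<rho>) (\<lambda>n z. b k n z * h n k z))" if "A \<subseteq> K - NJ" for A
    proof -
      have "finite A" using finK that finite_subset by blast
      then show ?thesis using that
      proof (induction A rule: finite_induct)
        case empty
        then show ?case using nbhd[OF J(2), of 1] by auto
      next
        case (insert k A)
        then obtain \<rho> where \<rho>: "\<rho> > 0" "cball zs \<rho> \<subseteq> cball 0 r" "\<forall>k\<in>A. tiny (cball zs \<rho>) (\<lambda>n z. b k n z * h n k z)" by auto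
        obtain \<rho>' where \<rho>': "\<rho>' > 0" "cball zs \<rho>' \<subseteq> cball 0 r" "tiny (cball zs \<rho>') (\<lambda>n z. b k n z * h n k z)"
          using small[of k] insert by auto
        show ?case
          by (rule exI[of _ "min \<rho> \<rho>'"]) (use \<rho> \<rho>' in \<open>auto intro: tiny_subset\<close>)
      qed
    qed
    from shrink[OF order_refl] obtain \<rho> where \<rho>: "\<rho> > 0" "cball zs \<rho> \<subseteq> cball 0 r"
      "\<And>k. k \<in> K - NJ \<Longrightarrow> tiny (cball zs \<rho>) (\<lambda>n z. b k n z * h n k z)" by auto
    have ballR: "cball zs \<rho> \<subseteq> ball 0 R" using \<rho>(2) r by auto
    \<comment> \<open>Moving away from \<open>zs\<close> separates the rates of different classes,
      whose differences are real parts of holomorphic functions and not identically zero.\<close>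
    have "\<exists>z1\<in>ball zs \<rho>. \<forall>p\<in>{(k, l). k \<in> K \<and> l \<in> K \<and> k \<noteq> l}. Re (G (fst p) z1 - G (snd p) z1) \<noteq> 0"
    proof (rule exists_real_parts_nonzero)
      show "finite {(k, l). k \<in> K \<and> l \<in> K \<and> k \<noteq> l}"
        by (rule finite_subset[of _ "K \<times> K"]) (use finK in auto)
      show "\<exists>z\<in>ball 0 R. Re (G (fst p) z - G (snd p) z) \<noteq> 0" if "p \<in> {(k, l). k \<in> K \<and> l \<in> K \<and> k \<noteq> l}" for p
        using vK that by (auto simp: v_def)
      show "(\<lambda>z. G (fst p) z - G (snd p) z) holomorphic_on ball 0 R" if "p \<in> {(k, l). k \<in> K \<and> l \<in> K \<and> k \<noteq> l}" for p
        using that KJ by (intro holomorphic_intros G) auto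
    qed (use \<rho> ballR in auto)
    then obtain z1 where z1: "z1 \<in> ball zs \<rho>" "\<And>k l. k \<in> K \<Longrightarrow> l \<in> K \<Longrightarrow> k \<noteq> l \<Longrightarrow> v k z1 \<noteq> v l z1"
      unfolding v_def by fastforce
    have finNJ: "finite NJ" using finK by (simp add: NJ_def)
    \<comment> \<open>The largest rate at \<open>z1\<close> among the competitors is strictly
      largest and, as \<open>0\<close> competes, nonnegative. Division by \<open>h n j\<close>
      therefore keeps tiny sums tiny near \<open>z1\<close> and makes the other competitors tiny as
      well.\<close>
    obtain j where j: "j \<in> NJ" "\<And>k. k \<in> NJ \<Longrightarrow> v k z1 \<le> v j z1"
      using obtains_MAX[OF finNJ, of "\<lambda>k. v k z1"] NJ0 by (metis Max_ge empty_iff finNJ finite_imageI imageI)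
    have z1R: "z1 \<in> ball 0 R" by (rule subsetD[OF ballR]) (use z1(1) in auto)
    have NJK: "NJ \<subseteq> K" by (auto simp: NJ_def)
    have vj0: "v j z1 \<ge> 0" using j(2)[OF NJ0] v0[OF z1R] by simp
    have tk: "\<exists>\<rho>'>0. cball z1 \<rho>' \<subseteq> cball zs \<rho> \<and> tiny (cball z1 \<rho>') (\<lambda>n z. b k n z * h n k z * inverse (h n j z))"
      if k: "k \<in> NJ - {j}" for k
    proof -
      have kJ: "k \<in> J" "j \<in> J" using k j NJK KJ by auto
      define \<eta> where "\<eta> = v j z1 - v k z1"
      have \<eta>: "\<eta> > 0" using j(2)[of k] z1(2)[of k j] k j NJK by (force simp: \<eta>_def less_le)
      have "isCont (\<lambda>z. v k z - v j z) z1"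
        using contv[OF kJ(1)] contv[OF kJ(2)] z1R by (intro continuous_intros) (auto simp: continuous_on_eq_continuous_at)
      then obtain d where d: "d > 0" "\<And>z. dist z z1 < d \<Longrightarrow> dist (v k z - v j z) (v k z1 - v j z1) < \<eta> / 2"
        using isCont_obtain_delta[OF _ half_gt_zero[OF \<eta>]] by blast
      define \<rho>' where "\<rho>' = min (d / 2) (\<rho> - dist zs z1)"
      have \<rho>': "\<rho>' > 0" "\<rho>' < d" "\<rho>' \<le> \<rho> - dist zs z1" using d z1(1) by (auto simp: \<rho>'_def)
      have sub: "cball z1 \<rho>' \<subseteq> cball zs \<rho>" using \<rho>' by (simp add: cball_subset_cball_iff dist_commute)
      have r': "cball z1 \<rho>' \<subseteq> cball 0 r" using sub \<rho>(2) by blast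
      have "growth (cball 0 r) (\<lambda>_. 0) (b k)" unfolding growth_zero_iff using k NJK r by (intro subb) auto
      then have "growth (cball 0 r) (\<lambda>z. 0 + v k z + - v j z) (\<lambda>n z. b k n z * h n k z * inverse (h n j z))"
        using kJ r by (intro growth_mult gr) auto
      then have "growth (cball z1 \<rho>') (\<lambda>z. 0 + v k z + - v j z) (\<lambda>n z. b k n z * h n k z * inverse (h n j z))"
        using r' by (rule growth_subset)
      then have "tiny (cball z1 \<rho>') (\<lambda>n z. b k n z * h n k z * inverse (h n j z))"
      proof (rule growth_tiny)
        show "\<eta> / 2 > 0" using \<eta> by simp
        fix z assume "z \<in> cball z1 \<rho>'"
        then have "dist z z1 < d" using \<rho>' by (simp add: dist_commute)
        from d(2)[OF this] have "v k z - v j z < v k z1 - v j z1 + \<eta> / 2"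
          unfolding dist_real_def abs_diff_less_iff by simp
        then show "0 + v k z + - v j z \<le> - (\<eta> / 2)" unfolding \<eta>_def by (simp add: field_simps)
      qed
      with \<rho>'(1) sub show ?thesis by blast
    qed
    have inv: "\<exists>\<rho>'>0. cball z1 \<rho>' \<subseteq> cball zs \<rho> \<and> tiny (cball z1 \<rho>') (\<lambda>n z. x n z * inverse (h n j z))"
      if x: "tiny (cball zs \<rho>) x" for x
    proof -
      have jJ: "j \<in> J" using j NJK KJ by auto
      obtain c where c: "c > 0" "growth (cball zs \<rho>) (\<lambda>_. - c) x" using tiny_growth[OF x] by blast
      have "isCont (v j) z1" using contv[OF jJ] z1R by (simp add: continuous_on_eq_continuous_at)
      then obtain d where d: "d > 0" "\<And>z. dist z z1 < d \<Longrightarrow> dist (v j z) (v j z1) < c / 2"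
        using isCont_obtain_delta[OF _ half_gt_zero[OF c(1)]] by blast
      define \<rho>' where "\<rho>' = min (d / 2) (\<rho> - dist zs z1)"
      have \<rho>': "\<rho>' > 0" "\<rho>' < d" "\<rho>' \<le> \<rho> - dist zs z1" using d z1(1) by (auto simp: \<rho>'_def)
      have sub: "cball z1 \<rho>' \<subseteq> cball zs \<rho>" using \<rho>' by (simp add: cball_subset_cball_iff dist_commute)
      have "growth (cball z1 \<rho>') (\<lambda>z. - c + - v j z) (\<lambda>n z. x n z * inverse (h n j z))"
        using growth_subset[OF c(2) sub] growth_subset[OF gr(2)[OF jJ r(3)] order_trans[OF sub \<rho>(2)]]
        by (rule growth_mult)
      then have "tiny (cball z1 \<rho>') (\<lambda>n z. x n z * inverse (h n j z))"
      proof (rule growth_tiny)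
        show "c / 2 > 0" using c by simp
        fix z assume "z \<in> cball z1 \<rho>'"
        then have "dist z z1 < d" using \<rho>' by (simp add: dist_commute)
        from d(2)[OF this] have "v j z1 - c / 2 < v j z" unfolding dist_real_def abs_diff_less_iff by simp
        then show "- c + - v j z \<le> - (c / 2)" using vj0 by (simp add: field_simps)
      qed
      with \<rho>'(1) sub show ?thesis by blast
    qed
    define e where "e n z = (\<Sum>j\<in>J. \<alpha> n j z * h n j z)" for n z
    have all: "\<exists>\<rho>'>0. cball z1 \<rho>' \<subseteq> cball zs \<rho> \<and> tiny (cball z1 \<rho>') (\<lambda>n z. b k n z * h n k z * inverse (h n j z))"
      if "k \<in> K - {j}" for k
      using tk[of k] inv[OF \<rho>(3)[of k]] that by (cases "k \<in> NJ") auto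
    have shrink': "\<exists>\<rho>'>0. cball z1 \<rho>' \<subseteq> cball zs \<rho> \<and> tiny (cball z1 \<rho>') (\<lambda>n z. e n z * inverse (h n j z)) \<and>
       (\<forall>k\<in>A. tiny (cball z1 \<rho>') (\<lambda>n z. b k n z * h n k z * inverse (h n j z)))" if "A \<subseteq> K - {j}" for A
    proof -
      have "finite A" using finK that finite_subset by blast
      then show ?thesis using that
      proof (induction A rule: finite_induct)
        case empty
        have "tiny (cball zs \<rho>) e" unfolding e_def[abs_def] by (rule tiny_subset[OF err ballR])
        from inv[OF this] show ?case by simp
      next
        case (insert k A)
        then obtain \<rho>1 where \<rho>1: "\<rho>1 > 0" "cball z1 \<rho>1 \<subseteq> cball zs \<rho>" "tiny (cball z1 \<rho>1) (\<lambda>n z. e n z * inverse (h n j z))"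
          "\<forall>k\<in>A. tiny (cball z1 \<rho>1) (\<lambda>n z. b k n z * h n k z * inverse (h n j z))" by auto
        obtain \<rho>2 where \<rho>2: "\<rho>2 > 0" "cball z1 \<rho>2 \<subseteq> cball zs \<rho>" "tiny (cball z1 \<rho>2) (\<lambda>n z. b k n z * h n k z * inverse (h n j z))"
          using all[of k] insert by auto
        show ?case
          by (rule exI[of _ "min \<rho>1 \<rho>2"]) (use \<rho>1 \<rho>2 in \<open>auto intro: tiny_subset\<close>)
      qed
    qed
    from shrink'[OF order_refl] obtain \<rho>' where \<rho>': "\<rho>' > 0" "cball z1 \<rho>' \<subseteq> cball zs \<rho>" "tiny (cball z1 \<rho>') (\<lambda>n z. e n z * inverse (h n j z))"
       "\<And>k. k \<in> K - {j} \<Longrightarrow> tiny (cball z1 \<rho>') (\<lambda>n z. b k n z * h n k z * inverse (h n j z))" by auto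
    \<comment> \<open>The relation solved for \<open>b j\<close>: this makes \<open>b j\<close> tiny
      near \<open>z1\<close>, hence the class of \<open>j\<close> null, contrary to
      \<open>j \<in> NJ\<close>.\<close>
    define y' where "y' n z = e n z * inverse (h n j z) + (- 1) * (\<Sum>k\<in>K - {j}. b k n z * h n k z * inverse (h n j z))" for n z
    have s1: "tiny (cball z1 \<rho>') (\<lambda>n z. \<Sum>k\<in>K - {j}. b k n z * h n k z * inverse (h n j z))"
      by (rule tiny_sum) (use finK \<rho>'(4) in auto)
    then have "tiny (cball z1 \<rho>') (\<lambda>n z. (- 1) * (\<Sum>k\<in>K - {j}. b k n z * h n k z * inverse (h n j z)))"
      by (rule tiny_cong_ev) simp
    with \<rho>'(3) have "tiny (cball z1 \<rho>') y'" unfolding y'_def[abs_def] by (rule tiny_add)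
    then have "tiny (cball z1 \<rho>') (b j)"
    proof (rule tiny_cong_ev, intro always_eventually allI ballI)
      fix n z assume z: "z \<in> cball z1 \<rho>'"
      then have zU: "z \<in> unit_disc" using \<rho>'(2) ballR subU by blast
      have hj: "h n j z \<noteq> 0" using nz j NJK KJ zU by blast
      have "e n z = b j n z * h n j z + (\<Sum>k\<in>K - {j}. b k n z * h n k z)"
        unfolding e_def total[OF zU] using finK j NJK by (subst sum.remove[of K j]) auto
      then have "e n z * inverse (h n j z) = b j n z + (\<Sum>k\<in>K - {j}. b k n z * h n k z * inverse (h n j z))"
        using hj by (simp add: distrib_right sum_distrib_right)
      then have "b j n z = y' n z" by (simp add: y'_def)
      then show "cmod (b j n z) \<le> cmod (y' n z)" by simp
    qed
    then have "null j" using spread[of j \<rho>' z1] j NJK \<rho>' ballR by auto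
    then show False using j by (simp add: NJ_def)
  qed
  show ?thesis
  proof (rule that[of "cls 0"])
    show "cls 0 \<subseteq> J" by (rule clsJ)
    show "0 \<in> cls 0" using J rep0 by (simp add: cls_def)
    show "eventually (\<lambda>n. \<forall>z\<in>cball 0 r. \<bar>ln (cmod (h n j z))\<bar> \<le> \<epsilon> * T n) U"
      if j: "j \<in> cls 0" and r: "r < R" and \<epsilon>: "\<epsilon> > 0" for j r \<epsilon>
    proof -
      have "Re (G j z) = 0" if "z \<in> cball 0 r" for z :: complex
        using vcls[OF j, of z] v0[of z] that r by (simp add: v_def)
      then show ?thesis using Glim[OF _ r \<epsilon>, of j] j clsJ by (auto elim!: eventually_mono)
    qed
    show "tiny (cball 0 r) (\<lambda>n z. \<Sum>j\<in>cls 0. \<alpha> n j z * h n j z)" if r: "0 < r" "r < R" for r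
    proof -
      have "tiny (cball 0 r) (b 0)" using \<open>null 0\<close> r by (simp add: null_def)
      then show ?thesis
      proof (rule tiny_cong_ev, intro always_eventually allI ballI)
        fix n and z :: complex assume "z \<in> cball 0 r"
        then have z: "z \<in> unit_disc" using r R by auto
        show "cmod (\<Sum>j\<in>cls 0. \<alpha> n j z * h n j z) \<le> cmod (b 0 n z)"
          using bh[OF K0 z, of n] h0[OF z] by simp
      qed
    qed
  qed
qed

end

section \<open>Integrating an elimination step\<close>

text \<open>The mean value inequality along the arc from \<open>\<rho>\<close> to \<open>z\<close>,
  parametrised by the angle; 8 exceeds \<open>2 * pi\<close>.\<close>

lemma circle_oscillation_bound:
  fixes F F' :: "complex \<Rightarrow> complex"
  assumes \<rho>: "0 \<le> \<rho>" and der: "\<And>z. z \<in> sphere 0 \<rho> \<Longrightarrow> (F has_field_derivative F' z) (at z)"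
    and B: "\<And>z. z \<in> sphere 0 \<rho> \<Longrightarrow> cmod (F' z) \<le> B" and z: "z \<in> sphere 0 \<rho>"
  shows "cmod (F z - F (of_real \<rho>)) \<le> 8 * \<rho> * B"
proof -
  define \<gamma> where "\<gamma> t = of_real \<rho> * exp (\<i> * of_real t)" for t :: real
  have \<gamma>: "\<gamma> t \<in> sphere 0 \<rho>" for t using \<rho> by (simp add: \<gamma>_def norm_mult)
  define t where "t = Arg2pi z"
  have t: "0 \<le> t" "t < 2 * pi" "\<gamma> t = z"
    using Arg2pi[of z] z by (auto simp: t_def \<gamma>_def is_Arg_def)
  have B0: "B \<ge> 0" using B[OF z] norm_ge_zero order_trans by blast
  show ?thesis
  proof (cases "t = 0")
    case True
    then have "z = of_real \<rho>" using t by (simp add: \<gamma>_def)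
    then show ?thesis using \<rho> B0 by simp
  next
    case False
    then have t0: "0 < t" using t by simp
    have d\<gamma>: "(\<gamma> has_vector_derivative (\<i> * \<gamma> u)) (at u)" for u
      unfolding \<gamma>_def[abs_def]
      by (rule has_vector_derivative_real_field) (auto intro!: derivative_eq_intros)
    have d: "((\<lambda>u. F (\<gamma> u)) has_vector_derivative (\<i> * \<gamma> u * F' (\<gamma> u))) (at u)" for u
      using field_vector_diff_chain_at[OF d\<gamma> der[OF \<gamma>]] by (simp add: o_def)
    have "\<exists>u\<in>{0<..<t}. norm (F (\<gamma> t) - F (\<gamma> 0)) \<le> norm ((t - 0) *\<^sub>R (\<i> * \<gamma> u * F' (\<gamma> u)))"
    proof (rule mvt_general[OF t0])
      show "continuous_on {0..t} (\<lambda>u. F (\<gamma> u))"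
        using has_vector_derivative_continuous[OF d] by (simp add: continuous_at_imp_continuous_on)
      show "((\<lambda>u. F (\<gamma> u)) has_derivative (\<lambda>h. h *\<^sub>R (\<i> * \<gamma> u * F' (\<gamma> u)))) (at u)" for u
        using d[of u] by (simp add: has_vector_derivative_def)
    qed
    then obtain u where u: "norm (F (\<gamma> t) - F (\<gamma> 0)) \<le> norm ((t - 0) *\<^sub>R (\<i> * \<gamma> u * F' (\<gamma> u)))" by blast
    have "cmod (\<gamma> u) = \<rho>" using \<gamma>[of u] by simp
    then have "norm ((t - 0) *\<^sub>R (\<i> * \<gamma> u * F' (\<gamma> u))) = t * (\<rho> * cmod (F' (\<gamma> u)))"
      using t0 by (simp add: norm_mult)
    also have "\<dots> \<le> 8 * (\<rho> * B)"
    proof (rule mult_mono)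
      show "t \<le> 8" using t pi_less_4 by linarith
      show "\<rho> * cmod (F' (\<gamma> u)) \<le> \<rho> * B" using B[OF \<gamma>] \<rho> by (rule mult_left_mono)
    qed (use \<rho> B0 in auto)
    finally have "norm (F (\<gamma> t) - F (\<gamma> 0)) \<le> 8 * (\<rho> * B)" using u by linarith
    then show ?thesis using t by (simp add: \<gamma>_def)
  qed
qed

lemma norm_le_on_cball_of_sphere:
  assumes "g holomorphic_on unit_disc" "0 < \<rho>" "\<rho> < 1" "\<And>w. w \<in> sphere 0 \<rho> \<Longrightarrow> cmod (g w) \<le> B" "z \<in> cball 0 \<rho>"
  shows "cmod (g z) \<le> B"
proof (rule maximum_modulus_frontier[of g "cball 0 \<rho>"])
  have sub: "cball 0 \<rho> \<subseteq> unit_disc" using assms by auto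
  show "g holomorphic_on interior (cball 0 \<rho>)"
    by (rule holomorphic_on_subset[OF assms(1)]) (use assms in auto)
  show "continuous_on (closure (cball 0 \<rho>)) g"
    using continuous_on_subset[OF holomorphic_on_imp_continuous_on[OF assms(1)] sub] by simp
qed (use assms in auto)

text \<open>Integrating back one elimination step: \<open>(V ks x / V ks (\<alpha> k * h k))' = V (k # ks) x / ((C ks k)\<^sup>2 * h k)\<close>.\<close>

lemma (in unit_family) integrate_elim_step:
  assumes ks: "set ks \<subseteq> J" "k \<in> J" and x: "x holomorphic_on unit_disc" and \<rho>: "0 < \<rho>" "\<rho> < 1"
    and b: "b > 0" "\<And>z. z \<in> sphere 0 \<rho> \<Longrightarrow> cmod (C ks k z) \<ge> b" "\<And>z. z \<in> sphere 0 \<rho> \<Longrightarrow> cmod (C ks k z) \<le> b'"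
    and H: "\<And>z. z \<in> sphere 0 \<rho> \<Longrightarrow> cmod (h k z) \<le> H" "\<And>z. z \<in> sphere 0 \<rho> \<Longrightarrow> cmod (inverse (h k z)) \<le> H"
    and \<epsilon>: "\<And>z. z \<in> sphere 0 \<rho> \<Longrightarrow> cmod (V (k # ks) x z) \<le> \<epsilon>"
  obtains c where "\<And>z. z \<in> cball 0 \<rho> \<Longrightarrow> cmod (V ks (\<lambda>w. x w + c * (\<alpha> k w * h k w)) z) \<le> 8 * (\<epsilon> * H / b\<^sup>2) * (b' * H)"
proof -
  define y where "y = V ks x"
  define w where "w z = C ks k z * h k z" for z
  have hy: "y holomorphic_on unit_disc" unfolding y_def by (rule hol_V[OF ks(1) x])
  have hC: "C ks k holomorphic_on unit_disc" by (rule hol_C[OF ks])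
  have sU: "sphere 0 \<rho> \<subseteq> unit_disc" using \<rho> by auto
  define F' where "F' z = V (k # ks) x z / ((C ks k z)\<^sup>2 * h k z)" for z
  have C0: "C ks k z \<noteq> 0" if "z \<in> sphere 0 \<rho>" for z using b(1) b(2)[OF that] by auto
  have \<epsilon>0: "\<epsilon> \<ge> 0" and H0: "H \<ge> 0"
  proof -
    have s: "of_real \<rho> \<in> sphere (0::complex) \<rho>" using \<rho> by simp
    show "\<epsilon> \<ge> 0" "H \<ge> 0" using \<epsilon>[OF s] H(1)[OF s] norm_ge_zero order_trans by blast+
  qed
  have der: "((\<lambda>z. y z / w z) has_field_derivative F' z) (at z)" if z: "z \<in> sphere 0 \<rho>" for z
  proof -
    have zU: "z \<in> unit_disc" using z sU by blast
    have dy: "(y has_field_derivative deriv y z) (at z)" by (rule holomorphic_derivI[OF hy open_ball zU])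
    have dC: "(C ks k has_field_derivative deriv (C ks k) z) (at z)" by (rule holomorphic_derivI[OF hC open_ball zU])
    have dh: "(h k has_field_derivative deriv (h k) z) (at z)" by (rule holomorphic_derivI[OF hol_h[OF ks(2)] open_ball zU])
    have nz: "C ks k z \<noteq> 0" "h k z \<noteq> 0" using C0[OF z] h_nz[OF ks(2) zU] by auto
    have "((\<lambda>z. y z / (C ks k z * h k z)) has_field_derivative
       (deriv y z * (C ks k z * h k z) - y z * (C ks k z * deriv (h k) z + deriv (C ks k) z * h k z)) / ((C ks k z * h k z) * (C ks k z * h k z))) (at z)"
      by (intro DERIV_divide dy DERIV_mult' dC dh) (use nz in auto)
    moreover have "(deriv y z * (C ks k z * h k z) - y z * (C ks k z * deriv (h k) z + deriv (C ks k) z * h k z)) / ((C ks k z * h k z) * (C ks k z * h k z)) = F' z"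
      using nz by (simp add: F'_def y_def power2_eq_square field_simps)
    ultimately show ?thesis by (simp add: w_def)
  qed
  have F'b: "cmod (F' z) \<le> \<epsilon> * H / b\<^sup>2" if z: "z \<in> sphere 0 \<rho>" for z
  proof -
    have "cmod (F' z) = cmod (V (k # ks) x z) * cmod (inverse (h k z)) / (cmod (C ks k z))\<^sup>2"
      by (simp add: F'_def norm_divide norm_mult norm_power norm_inverse field_simps)
    also have "\<dots> \<le> \<epsilon> * H / b\<^sup>2"
      using \<epsilon>[OF z] H(2)[OF z] b(2)[OF z] b(1) \<epsilon>0 H0 by (intro frac_le mult_mono power_mono) auto
    finally show ?thesis .
  qed
  \<comment> \<open>The constant of integration, read off at one point of the circle. With the
    opposite sign it becomes the coefficient of the recovered pivot term.\<close>
  define c where "c = y (of_real \<rho>) / w (of_real \<rho>)"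
  have osc: "cmod (y z / w z - c) \<le> 8 * (\<epsilon> * H / b\<^sup>2)" if z: "z \<in> sphere 0 \<rho>" for z
  proof -
    have "cmod (y z / w z - c) \<le> 8 * \<rho> * (\<epsilon> * H / b\<^sup>2)"
      unfolding c_def using circle_oscillation_bound[OF _ der F'b z] \<rho> by simp
    also have "\<dots> \<le> 8 * 1 * (\<epsilon> * H / b\<^sup>2)"
      using \<rho> \<epsilon>0 H0 by (intro mult_right_mono mult_left_mono) auto
    finally show ?thesis by simp
  qed
  have eqV: "V ks (\<lambda>u. x u + (- c) * (\<alpha> k u * h k u)) z = y z - c * w z" if "z \<in> unit_disc" for z
    using V_lincomb[OF ks(1) x _ that, of "\<lambda>u. \<alpha> k u * h k u" "- c"] V_term[OF ks that] hol_\<alpha>[OF ks(2)] hol_h[OF ks(2)]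
    by (simp add: y_def w_def holomorphic_on_mult)
  show ?thesis
  proof (rule that[of "- c"])
    fix z :: complex assume z: "z \<in> cball 0 \<rho>"
    have hol: "V ks (\<lambda>u. x u + (- c) * (\<alpha> k u * h k u)) holomorphic_on unit_disc"
      by (intro hol_V[OF ks(1)] holomorphic_intros x hol_\<alpha> hol_h ks)
    show "cmod (V ks (\<lambda>w. x w + - c * (\<alpha> k w * h k w)) z) \<le> 8 * (\<epsilon> * H / b\<^sup>2) * (b' * H)"
    \<comment> \<open>The quotient is controlled on the circle only, since \<open>C ks k\<close> may
      vanish inside. Multiplied by \<open>w\<close> the estimate concerns a holomorphic function,
      and the maximum principle extends it.\<close>
    proof (rule norm_le_on_cball_of_sphere[OF hol \<rho> _ z])
      fix u :: complex assume u: "u \<in> sphere 0 \<rho>"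
      then have uU: "u \<in> unit_disc" using sU by blast
      have wn: "w u \<noteq> 0" using C0[OF u] h_nz[OF ks(2) uU] by (simp add: w_def)
      have "cmod (y u - c * w u) = cmod (y u / w u - c) * cmod (w u)"
        using wn by (simp add: norm_mult[symmetric] algebra_simps)
      also have "\<dots> \<le> 8 * (\<epsilon> * H / b\<^sup>2) * (b' * H)"
        using osc[OF u] b(3)[OF u] H(1)[OF u] \<epsilon>0 H0 unfolding w_def norm_mult
        by (intro mult_mono) (auto intro: order_trans[OF norm_ge_zero])
      finally show "cmod (V ks (\<lambda>w. x w + - c * (\<alpha> k w * h k w)) u) \<le> 8 * (\<epsilon> * H / b\<^sup>2) * (b' * H)"
        using eqV[OF uU] by simp
    qed
  qed
qed

text \<open>A sum of suprema rather than a maximum: bounds for the single terms pass to the whole at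
  the cost of their number. The summand 1 keeps the size at least \<open>1\<close>, so that
  logarithms of it and quotients by it are safe.\<close>

definition log_size :: "(nat \<Rightarrow> complex \<Rightarrow> complex) \<Rightarrow> nat set \<Rightarrow> real \<Rightarrow> real" where
  "log_size h Q r = 1 + (\<Sum>j\<in>Q. SUP z\<in>cball 0 r. \<bar>ln (cmod (h j z))\<bar>)"

lemma log_size_facts:
  assumes Q: "finite Q" and hol: "\<And>j. j \<in> Q \<Longrightarrow> h j holomorphic_on unit_disc"
    and nz: "\<And>j z. j \<in> Q \<Longrightarrow> z \<in> unit_disc \<Longrightarrow> h j z \<noteq> 0"
    and r: "0 \<le> r" "r < 1"
  shows log_size_ge_1: "log_size h Q r \<ge> 1"
    and log_size_ge: "\<And>j z. j \<in> Q \<Longrightarrow> z \<in> cball 0 r \<Longrightarrow> \<bar>ln (cmod (h j z))\<bar> \<le> log_size h Q r"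
    and log_size_le: "\<And>B::real. (\<And>j z. j \<in> Q \<Longrightarrow> z \<in> cball 0 r \<Longrightarrow> \<bar>ln (cmod (h j z))\<bar> \<le> B) \<Longrightarrow> log_size h Q r \<le> 1 + card Q * B"
    and log_size_mono: "\<And>r'. 0 \<le> r' \<Longrightarrow> r' \<le> r \<Longrightarrow> log_size h Q r' \<le> log_size h Q r"
proof -
  have ne: "cball (0::complex) r \<noteq> {}" using r by simp
  have bdd: "bdd_above ((\<lambda>z. \<bar>ln (cmod (h j z))\<bar>) ` cball 0 r)" if j: "j \<in> Q" for j
  proof -
    have sub: "cball 0 r \<subseteq> unit_disc" using r by auto
    have "continuous_on (cball 0 r) (\<lambda>z. \<bar>ln (cmod (h j z))\<bar>)"
      by (intro continuous_intros continuous_on_subset[OF holomorphic_on_imp_continuous_on[OF hol[OF j]] sub])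
        (use nz[OF j] sub in auto)
    then have "compact ((\<lambda>z. \<bar>ln (cmod (h j z))\<bar>) ` cball 0 r)" by (intro compact_continuous_image) auto
    then show ?thesis by (intro bounded_imp_bdd_above compact_imp_bounded)
  qed
  have up: "\<bar>ln (cmod (h j z))\<bar> \<le> (SUP z\<in>cball 0 r. \<bar>ln (cmod (h j z))\<bar>)" if "j \<in> Q" "z \<in> cball 0 r" for j z
    using bdd[OF that(1)] that(2) by (rule cSUP_upper2) simp
  have pos: "0 \<le> (SUP z\<in>cball 0 r. \<bar>ln (cmod (h j z))\<bar>)" if "j \<in> Q" for j
    using up[OF that, of 0] r by (meson abs_ge_zero centre_in_cball order_trans)
  show "log_size h Q r \<ge> 1" using pos by (simp add: log_size_def sum_nonneg)
  show "\<bar>ln (cmod (h j z))\<bar> \<le> log_size h Q r" if "j \<in> Q" "z \<in> cball 0 r" for j z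
  proof -
    have "(SUP z\<in>cball 0 r. \<bar>ln (cmod (h j z))\<bar>) \<le> (\<Sum>j\<in>Q. SUP z\<in>cball 0 r. \<bar>ln (cmod (h j z))\<bar>)"
      using Q that pos by (intro member_le_sum) auto
    then show ?thesis using up[OF that] by (simp add: log_size_def)
  qed
  show "log_size h Q r \<le> 1 + card Q * B" if "\<And>j z. j \<in> Q \<Longrightarrow> z \<in> cball 0 r \<Longrightarrow> \<bar>ln (cmod (h j z))\<bar> \<le> B" for B :: real
  proof -
    have "(\<Sum>j\<in>Q. SUP z\<in>cball 0 r. \<bar>ln (cmod (h j z))\<bar>) \<le> of_nat (card Q) * B"
      using that by (intro sum_bounded_above cSUP_least[OF ne]) auto
    then show ?thesis by (simp add: log_size_def)
  qed
  show "log_size h Q r' \<le> log_size h Q r" if r': "0 \<le> r'" "r' \<le> r" for r'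
    unfolding log_size_def using bdd r' 
    by (intro add_left_mono sum_mono cSUP_subset_mono) auto
qed

section \<open>Elimination measured on the exponential scale\<close>

context scale
begin

lemma subexp_dominated:
  "subexp S y \<Longrightarrow> eventually (\<lambda>n. \<forall>z\<in>S. cmod (x n z) \<le> cmod (y n z)) U \<Longrightarrow> subexp S x"
  unfolding subexp_def
proof (intro allI impI)
  fix \<epsilon> :: real assume y: "\<forall>\<epsilon>>0. eventually (\<lambda>n. \<forall>z\<in>S. cmod (y n z) \<le> exp (\<epsilon> * T n)) U" and "\<epsilon> > 0"
    and le: "eventually (\<lambda>n. \<forall>z\<in>S. cmod (x n z) \<le> cmod (y n z)) U"
  then have "eventually (\<lambda>n. \<forall>z\<in>S. cmod (y n z) \<le> exp (\<epsilon> * T n)) U" by blast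
  with le show "eventually (\<lambda>n. \<forall>z\<in>S. cmod (x n z) \<le> exp (\<epsilon> * T n)) U"
    by eventually_elim (blast intro: order_trans)
qed

lemma subexp_power: "subexp S x \<Longrightarrow> subexp S (\<lambda>n z. x n z ^ k)"
proof (induction k)
  case 0
  then show ?case by (intro subexp_bounded[of S _ 1] always_eventually) auto
qed (simp add: subexp_mult)

lemma subexp_T: "subexp S (\<lambda>n z. of_real (T n))"
  unfolding subexp_def
proof (intro allI impI)
  fix \<epsilon> :: real assume "\<epsilon> > 0"
  then have "eventually (\<lambda>x. \<bar>x\<bar> \<le> exp (\<epsilon> * x)) at_top" by real_asymp
  then have "eventually (\<lambda>n. \<bar>T n\<bar> \<le> exp (\<epsilon> * T n)) U"
    using T_at_top by (rule eventually_compose_filterlim)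
  then show "eventually (\<lambda>n. \<forall>z\<in>S. cmod (of_real (T n)) \<le> exp (\<epsilon> * T n)) U"
    by eventually_elim simp
qed

text \<open>The elimination bound has base \<open>6 * E / d\<close> with \<open>E\<close> linear in
  \<open>T\<close>, so it is a fixed power of a linear function of \<open>T\<close>.\<close>

lemma elim_coeff_subexp:
  assumes fam: "\<And>n. unit_family (H n) (\<alpha> n) J" and R: "0 < r" "r < R" "R \<le> 1"
    and H: "eventually (\<lambda>n. \<forall>j\<in>J. \<forall>z\<in>ball 0 R. \<bar>ln (cmod (H n j z))\<bar> \<le> T n) U"
    and \<alpha>: "eventually (\<lambda>n. \<forall>j\<in>J. \<forall>z\<in>ball 0 R. cmod (\<alpha> n j z) \<le> Ca) U"
    and ks: "set ks \<subseteq> J" "j \<in> J"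
  shows "subexp (cball 0 r) (\<lambda>n. elim_coeff (H n) (\<alpha> n) ks j)"
proof -
  define d where "d = (R - r) / (length ks + 2)"
  have d: "0 < d" "d \<le> 1" using R by (auto simp: d_def divide_le_eq)
  have Rd: "R - r = real (length ks + 2) * d" by (simp add: d_def)
  define N :: nat where "N = 4 ^ length ks"
  define E where "E n = \<bar>Ca\<bar> + 1 + 8 * T n / d" for n
  have "subexp (cball 0 r) (\<lambda>n z. (of_real ((\<bar>Ca\<bar> + 1) * 6 / d) + of_real (T n) * of_real (48 / d\<^sup>2)) ^ N)"
    by (intro subexp_power subexp_add subexp_mult subexp_T)
      (rule subexp_bounded[OF always_eventually], auto)+
  then show ?thesis
  proof (rule subexp_dominated)
    show "eventually (\<lambda>n. \<forall>z\<in>cball 0 r. cmod (elim_coeff (H n) (\<alpha> n) ks j z)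
       \<le> cmod ((of_real ((\<bar>Ca\<bar> + 1) * 6 / d) + of_real (T n) * of_real (48 / d\<^sup>2)) ^ N)) U"
      using H \<alpha> T_ge[of 1]
    proof eventually_elim
      case (elim n)
      interpret unit_family "H n" "\<alpha> n" J by (rule fam)
      have E1: "E n \<ge> 1" using elim d by (simp add: E_def)
      have R1: "R - d \<le> 1" using R d by simp
      have Lb: "cmod (L i z) \<le> E n" if "i \<in> J" "z \<in> ball 0 (R - d)" for i z
      proof -
        have sub: "ball z d \<subseteq> ball 0 R"
        proof
          fix w :: complex assume "w \<in> ball z d"
          then have "cmod w < d + cmod z" using norm_triangle_ineq2[of w z] by (simp add: dist_norm norm_minus_commute)
          then show "w \<in> ball 0 R" using that by simp
        qed
        have subU: "ball 0 R \<subseteq> unit_disc" using R by auto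
        have "cmod (L i z) \<le> 8 * T n / d"
        proof (rule log_deriv_bound[OF _ _ d(1)])
          show "H n i holomorphic_on ball z d"
            by (rule holomorphic_on_subset[OF hol_h[OF that(1)]]) (use sub subU in blast)
          show "H n i w \<noteq> 0" if "w \<in> ball z d" for w
            by (rule h_nz) (use \<open>i \<in> J\<close> that sub subU in blast)+
        qed (use elim that sub in blast)
        then show ?thesis by (simp add: E_def)
      qed
      have \<alpha>b: "cmod (\<alpha> n i z) \<le> E n" if "i \<in> J" "z \<in> ball 0 (R - d)" for i z
      proof -
        have "z \<in> ball 0 R" using that d by auto
        then have "cmod (\<alpha> n i z) \<le> Ca" using elim that by blast
        moreover have "0 \<le> 8 * T n / d" using elim d by simp
        ultimately show ?thesis by (simp add: E_def)
      qed
      have eq: "6 * E n / d = (\<bar>Ca\<bar> + 1) * 6 / d + T n * (48 / d\<^sup>2)"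
        using d by (simp add: E_def power2_eq_square field_simps)
      have "6 * E n / d \<ge> 0" using E1 d by simp
      then have n6: "cmod (of_real ((\<bar>Ca\<bar> + 1) * 6 / d) + of_real (T n) * of_real (48 / d\<^sup>2)) = 6 * E n / d"
        unfolding eq by (metis abs_of_nonneg norm_of_real of_real_add of_real_mult)
      show ?case
      proof
        fix z :: complex assume z: "z \<in> cball 0 r"
        have "z \<in> ball 0 (R - d - real (length ks) * d)"
          using z Rd d by (simp add: algebra_simps)
        from elim_coeff_bound[OF ks(1) d E1 R1 \<alpha>b Lb ks(2) this]
        show "cmod (elim_coeff (H n) (\<alpha> n) ks j z)
          \<le> cmod ((of_real ((\<bar>Ca\<bar> + 1) * 6 / d) + of_real (T n) * of_real (48 / d\<^sup>2)) ^ N)"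
          unfolding norm_power n6 N_def .
      qed
    qed
  qed
qed

text \<open>Undoes the eliminations starting from the head of \<open>ks\<close>, the last pivot.
  Each time a constant multiple of a pivot term is added to \<open>x\<close>. The required division
  by a pivot coefficient is possible on a circle because that coefficient, formed with the pivots
  \<open>vs\<close> eliminated before \<open>k\<close>, is not tiny.\<close>

lemma integrate_elimination:
  assumes fam: "\<And>n. unit_family (H n) (\<alpha> n) J" and R: "R \<le> 1"
    and subC: "\<And>ks j. set ks \<subseteq> J \<Longrightarrow> j \<in> J \<Longrightarrow> subexp (cball 0 R) (\<lambda>n. elim_coeff (H n) (\<alpha> n) ks j)"
    and subH: "\<And>j. j \<in> J \<Longrightarrow> subexp (cball 0 R) (\<lambda>n. H n j)"
      "\<And>j. j \<in> J \<Longrightarrow> subexp (cball 0 R) (\<lambda>n z. inverse (H n j z))"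
    and piv: "\<And>us k vs. ks = us @ k # vs \<Longrightarrow> \<not> tiny (cball 0 s) (\<lambda>n. elim_coeff (H n) (\<alpha> n) vs k)"
    and ks: "set ks \<subseteq> J" "distinct ks" and hol: "\<And>n. x n holomorphic_on unit_disc"
    and r: "0 < r2" "s \<le> r2" "r2 < r" "r < R"
    and ti: "tiny (cball 0 r) (\<lambda>n. elim_op (H n) (\<alpha> n) ks (x n))"
  shows "\<exists>c. tiny (cball 0 r2) (\<lambda>n z. x n z + (\<Sum>k\<in>set ks. c n k * (\<alpha> n k z * H n k z)))"
  using piv ks hol r ti
proof (induction ks arbitrary: x r)
  case Nil
  then show ?case by (intro exI[of _ "\<lambda>_ _. 0"]) (auto intro: tiny_subset)
next
  case (Cons k ks)
  define \<rho>1 where "\<rho>1 = (2 * r2 + r) / 3"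
  define \<rho>2 where "\<rho>2 = (r2 + 2 * r) / 3"
  have \<rho>: "r2 < \<rho>1" "\<rho>1 < \<rho>2" "\<rho>2 < r" using Cons.prems by (auto simp: \<rho>1_def \<rho>2_def)
  have kJ: "k \<in> J" "set ks \<subseteq> J" using Cons.prems by auto
  have nt: "\<not> tiny (cball 0 s) (\<lambda>n. elim_coeff (H n) (\<alpha> n) ks k)" using Cons.prems(1)[of "[]"] by simp
  have holC: "elim_coeff (H n) (\<alpha> n) ks k holomorphic_on unit_disc" for n
    using unit_family.hol_C[OF fam kJ(2,1)] .
  obtain c where c: "c > 0"
    "eventually (\<lambda>n. \<forall>z\<in>cball 0 r. cmod (elim_op (H n) (\<alpha> n) (k # ks) (x n) z) \<le> exp (- c * T n)) U"
    using Cons.prems unfolding tiny_def by blast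
  \<comment> \<open>One integration contributes \<open>exp (\<eta> * T n)\<close> five times, so
    half of the rate \<open>c\<close> is left; a further quarter of \<open>c\<close> absorbs the
    factor 8.\<close>
  define \<eta> where "\<eta> = c / 10"
  have \<eta>: "\<eta> > 0" using c by (simp add: \<eta>_def)
  have e1: "eventually (\<lambda>n. \<exists>\<rho>. \<rho>1 \<le> \<rho> \<and> \<rho> \<le> \<rho>2 \<and> (\<forall>z\<in>sphere 0 \<rho>. cmod (elim_coeff (H n) (\<alpha> n) ks k z) \<ge> exp (- \<eta> * T n))) U"
    by (rule not_tiny_circle[OF holC subC[OF kJ(2,1)] nt]) (use \<rho> Cons.prems R \<eta> in auto)
  have e2: "eventually (\<lambda>n. \<forall>z\<in>cball 0 R. cmod (elim_coeff (H n) (\<alpha> n) ks k z) \<le> exp (\<eta> * T n)) U"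
    "eventually (\<lambda>n. \<forall>z\<in>cball 0 R. cmod (H n k z) \<le> exp (\<eta> * T n)) U"
    "eventually (\<lambda>n. \<forall>z\<in>cball 0 R. cmod (inverse (H n k z)) \<le> exp (\<eta> * T n)) U"
    using subC[OF kJ(2,1)] subH(1)[OF kJ(1)] subH(2)[OF kJ(1)] \<eta> unfolding subexp_def by blast+
  define P where "P n c0 \<longleftrightarrow> (\<forall>z\<in>cball 0 \<rho>1. cmod (elim_op (H n) (\<alpha> n) ks (\<lambda>w. x n w + c0 * (\<alpha> n k w * H n k w)) z)
     \<le> exp (- (c / 4) * T n))" for n c0
  have "eventually (\<lambda>n. \<exists>c0. P n c0) U"
    using e1 e2 c(2) T_ge[of "28 / c"]
  proof eventually_elim
    case (elim n)
    interpret unit_family "H n" "\<alpha> n" J by (rule fam)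
    obtain \<rho> where \<rho>': "\<rho>1 \<le> \<rho>" "\<rho> \<le> \<rho>2" "\<And>z. z \<in> sphere 0 \<rho> \<Longrightarrow> cmod (C ks k z) \<ge> exp (- \<eta> * T n)"
      using elim(1) by blast
    have \<rho>01: "0 < \<rho>" "\<rho> < 1" using \<rho>' \<rho> Cons.prems R by auto
    have s1: "sphere 0 \<rho> \<subseteq> cball 0 R" "sphere 0 \<rho> \<subseteq> cball 0 r" using \<rho>' \<rho> Cons.prems by auto
    have b1: "cmod (C ks k z) \<le> exp (\<eta> * T n)" "cmod (H n k z) \<le> exp (\<eta> * T n)"
      "cmod (inverse (H n k z)) \<le> exp (\<eta> * T n)" "cmod (V (k # ks) (x n) z) \<le> exp (- c * T n)"
      if "z \<in> sphere 0 \<rho>" for z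
      using elim(2-5) s1 that by blast+
    obtain c0 where c0: "\<And>z. z \<in> cball 0 \<rho> \<Longrightarrow> cmod (V ks (\<lambda>w. x n w + c0 * (\<alpha> n k w * H n k w)) z)
        \<le> 8 * (exp (- c * T n) * exp (\<eta> * T n) / (exp (- \<eta> * T n))\<^sup>2) * (exp (\<eta> * T n) * exp (\<eta> * T n))"
      using integrate_elim_step[OF kJ(2,1) Cons.prems(4) \<rho>01 exp_gt_zero \<rho>'(3) b1(1,2,3,4)] by blast
    have "8 * (exp (- c * T n) * exp (\<eta> * T n) / (exp (- \<eta> * T n))\<^sup>2) * (exp (\<eta> * T n) * exp (\<eta> * T n))
        = 8 * exp (- (c / 2) * T n)"
      by (simp add: \<eta>_def power2_eq_square field_simps flip: exp_add exp_diff)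
    also have "\<dots> \<le> exp (c / 4 * T n) * exp (- (c / 2) * T n)"
    proof (rule mult_right_mono)
      have "7 \<le> c / 4 * T n" using elim c by (simp add: field_simps)
      then show "8 \<le> exp (c / 4 * T n)" using exp_ge_add_one_self[of "c / 4 * T n"] by linarith
    qed simp
    also have "\<dots> = exp (- (c / 4) * T n)" by (simp flip: exp_add)
    finally have bound: "8 * (exp (- c * T n) * exp (\<eta> * T n) / (exp (- \<eta> * T n))\<^sup>2) * (exp (\<eta> * T n) * exp (\<eta> * T n))
        \<le> exp (- (c / 4) * T n)" .
    have "P n c0" unfolding P_def
      by (intro ballI order_trans[OF c0 bound]) (use \<rho>' in auto)
    then show ?case by blast
  qed
  \<comment> \<open>The coefficient exists only for almost all \<open>n\<close>; the choice operator
    makes it a function of \<open>n\<close>.\<close>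
  then have ev: "eventually (\<lambda>n. P n (SOME c0. P n c0)) U" by eventually_elim (rule someI_ex)
  define c0 where "c0 n = (SOME c0. P n c0)" for n
  define x' where "x' n w = x n w + c0 n * (\<alpha> n k w * H n k w)" for n w
  have hx': "x' n holomorphic_on unit_disc" for n
    unfolding x'_def using unit_family.hol_h[OF fam kJ(1)] unit_family.hol_\<alpha>[OF fam kJ(1)]
    by (intro holomorphic_intros Cons.prems)
  have "tiny (cball 0 \<rho>1) (\<lambda>n. elim_op (H n) (\<alpha> n) ks (x' n))"
    by (rule tinyI[of "c / 4"]) (use c ev in \<open>simp_all add: P_def c0_def x'_def[abs_def]\<close>)
  then have "\<exists>c. tiny (cball 0 r2) (\<lambda>n z. x' n z + (\<Sum>k\<in>set ks. c n k * (\<alpha> n k z * H n k z)))"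
    using Cons.prems \<rho> hx' by (intro Cons.IH[of x' \<rho>1]) auto
  then obtain c' where c': "tiny (cball 0 r2) (\<lambda>n z. x' n z + (\<Sum>k\<in>set ks. c' n k * (\<alpha> n k z * H n k z)))" by blast
  define c'' where "c'' n = (c' n)(k := c0 n)" for n
  have "x' n z + (\<Sum>i\<in>set ks. c' n i * (\<alpha> n i z * H n i z)) = x n z + (\<Sum>i\<in>set (k # ks). c'' n i * (\<alpha> n i z * H n i z))" for n z
  proof -
    have "(\<Sum>i\<in>set ks. c'' n i * (\<alpha> n i z * H n i z)) = (\<Sum>i\<in>set ks. c' n i * (\<alpha> n i z * H n i z))"
      using Cons.prems by (intro sum.cong) (auto simp: c''_def)
    then show ?thesis using Cons.prems by (simp add: x'_def c''_def)
  qed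
  then show ?case using c' by auto
qed

end

text \<open>Harnack for the unit \<open>\<delta> / h\<close>, whose modulus is at most
  \<open>1\<close>: a lower bound on a disc and an upper bound at one point control \<open>h\<close>
  from both sides.\<close>

lemma unit_abs_ln_le_of_lower_bound:
  fixes \<delta> K r R :: real
  assumes hol: "h holomorphic_on ball 0 R" and \<delta>: "\<delta> > 0" "\<And>z. z \<in> ball 0 R \<Longrightarrow> cmod (h z) \<ge> \<delta>"
    and K: "K \<ge> 1" "cmod (h z0) \<le> K" and r: "0 \<le> r" "r < R" and z0: "z0 \<in> cball 0 r" and z: "z \<in> cball 0 r"
  shows "\<bar>ln (cmod (h z))\<bar> \<le> \<bar>ln \<delta>\<bar> + ((R + r) / (R - r))\<^sup>2 * (ln K + \<bar>ln \<delta>\<bar>)"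
proof -
  have nz: "h z \<noteq> 0" if "z \<in> ball 0 R" for z using \<delta>(1) \<delta>(2)[OF that] by auto
  define g where "g w = of_real \<delta> / h w" for w
  have zR: "z \<in> ball 0 R" "z0 \<in> ball 0 R" using z z0 r by auto
  have ln_g: "- ln (cmod (g w)) = ln (cmod (h w)) - ln \<delta>" if "w \<in> ball 0 R" for w
    using nz[OF that] \<delta>(1) by (simp add: g_def norm_divide ln_div)
  have "- ln (cmod (g z)) \<le> ((R + r) / (R - r))\<^sup>2 * (- ln (cmod (g z0)))"
  proof (rule harnack_unit[OF _ _ _ r z z0])
    show "g holomorphic_on ball 0 R" unfolding g_def using nz by (intro holomorphic_intros hol) auto
    show "g w \<noteq> 0" if "w \<in> ball 0 R" for w using nz[OF that] \<delta>(1) by (simp add: g_def)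
    show "cmod (g w) \<le> 1" if "w \<in> ball 0 R" for w
      using \<delta>(1) \<delta>(2)[OF that] nz[OF that] by (simp add: g_def norm_divide divide_le_eq)
  qed
  also have "\<dots> \<le> ((R + r) / (R - r))\<^sup>2 * (ln K + \<bar>ln \<delta>\<bar>)"
  proof (rule mult_left_mono)
    have "ln (cmod (h z0)) \<le> ln K" using K nz[OF zR(2)] by simp
    then show "- ln (cmod (g z0)) \<le> ln K + \<bar>ln \<delta>\<bar>" using ln_g[OF zR(2)] by linarith
  qed simp
  finally have "ln (cmod (h z)) \<le> ln \<delta> + ((R + r) / (R - r))\<^sup>2 * (ln K + \<bar>ln \<delta>\<bar>)"
    using ln_g[OF zR(1)] by simp
  moreover have "ln (cmod (h z)) \<ge> ln \<delta>" using \<delta>(1) \<delta>(2)[OF zR(1)] nz[OF zR(1)] by simp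
  moreover have "0 \<le> ((R + r) / (R - r))\<^sup>2 * (ln K + \<bar>ln \<delta>\<bar>)" using K by simp
  ultimately show ?thesis by linarith
qed

section \<open>Approximate relations between units\<close>

text \<open>The error is small compared with every power of the sizes of the terms and of their inverses.\<close>

definition (in ultrafilter) near_relation ::
  "nat set \<Rightarrow> ('n \<Rightarrow> nat \<Rightarrow> complex \<Rightarrow> complex) \<Rightarrow> ('n \<Rightarrow> complex \<Rightarrow> complex) \<Rightarrow> ('n \<Rightarrow> complex) \<Rightarrow> complex \<Rightarrow> real \<Rightarrow> real \<Rightarrow> bool" where
  "near_relation Q h a zz w s R \<longleftrightarrow>
    (\<forall>n. \<forall>j\<in>Q. h n j holomorphic_on unit_disc \<and> (\<forall>z\<in>unit_disc. h n j z \<noteq> 0)) \<and>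
    (\<forall>n. a n holomorphic_on unit_disc) \<and>
    (\<exists>Ca. eventually (\<lambda>n. \<forall>z\<in>cball 0 R. cmod (a n z) \<le> Ca) U) \<and>
    (\<exists>ca>0. eventually (\<lambda>n. cmod (a n w) \<ge> ca) U) \<and>
    eventually (\<lambda>n. zz n \<in> cball 0 s) U \<and>
    (\<exists>K. eventually (\<lambda>n. \<forall>j\<in>Q. cmod (h n j (zz n)) \<le> K) U) \<and>
    (\<exists>M \<kappa>. filterlim \<kappa> at_top U \<and> eventually (\<lambda>n. 1 \<le> M n) U \<and>
      eventually (\<lambda>n. \<forall>j\<in>Q. \<forall>z\<in>cball 0 R. \<bar>ln (cmod (h n j z))\<bar> \<le> M n) U \<and>
      eventually (\<lambda>n. \<forall>z\<in>cball 0 R. cmod (a n z + (\<Sum>j\<in>Q. h n j z)) \<le> exp (- \<kappa> n * M n)) U)"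

text \<open>Brings a relation with constant coefficients and tiny error into the form required by
  the induction. Terms with exponentially small coefficients go to the error; the other coefficients
  are absorbed in the units. The size \<open>M\<close> of the new units is of smaller order than
  \<open>T\<close>, so the error \<open>exp (- c * T)\<close> is small beyond every power at the new
  scale, with \<open>\<kappa> = c * T / M\<close>.\<close>

lemma (in scale) reduce_near_relation:
  assumes IH: "\<And>Q'' h' a' R1 R2. Q'' \<subseteq> Q' \<Longrightarrow> near_relation Q'' h' a' zz w s R1 \<Longrightarrow> s < R2 \<Longrightarrow> R2 < R1 \<Longrightarrow> R1 < 1 \<Longrightarrow>
      \<exists>i\<in>Q''. \<exists>B. eventually (\<lambda>n. \<forall>z\<in>cball 0 R2. \<bar>ln (cmod (h' n i z))\<bar> \<le> B) U"
    and fin: "finite Q'"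
    and hol: "\<And>n j. j \<in> Q' \<Longrightarrow> h n j holomorphic_on unit_disc"
    and nz: "\<And>n j z. j \<in> Q' \<Longrightarrow> z \<in> unit_disc \<Longrightarrow> h n j z \<noteq> 0"
    and hola: "\<And>n. a n holomorphic_on unit_disc"
    and ab: "eventually (\<lambda>n. \<forall>z\<in>cball 0 R. cmod (a n z) \<le> Ca) U"
    and al: "ca > 0" "eventually (\<lambda>n. cmod (a n w) \<ge> ca) U"
    and pts: "eventually (\<lambda>n. zz n \<in> cball 0 s) U" "eventually (\<lambda>n. \<forall>j\<in>Q'. cmod (h n j (zz n)) \<le> K) U"
    and small: "\<And>j \<epsilon>. j \<in> Q' \<Longrightarrow> \<epsilon> > 0 \<Longrightarrow> eventually (\<lambda>n. \<forall>z\<in>cball 0 R. \<bar>ln (cmod (h n j z))\<bar> \<le> \<epsilon> * T n) U"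
    and coef: "eventually (\<lambda>n. \<forall>j\<in>Q'. cmod (e n j) \<le> 2) U"
    and ti: "tiny (cball 0 R) (\<lambda>n z. a n z + (\<Sum>j\<in>Q'. e n j * h n j z))"
    and R: "0 \<le> s" "s < R'" "R' < R" "R < 1"
  shows "\<exists>i\<in>Q'. \<exists>B. eventually (\<lambda>n. \<forall>z\<in>cball 0 R'. \<bar>ln (cmod (h n i z))\<bar> \<le> B) U"
proof -
  define Q'' where "Q'' = {j \<in> Q'. \<forall>\<epsilon>>0. eventually (\<lambda>n. cmod (e n j) \<ge> exp (- \<epsilon> * T n)) U}"
  have Q'': "Q'' \<subseteq> Q'" "finite Q''" using fin by (auto simp: Q''_def)
  have subh: "subexp (cball 0 R) (\<lambda>n. h n j)" if j: "j \<in> Q'" for j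
    unfolding subexp_def
  proof (intro allI impI)
    fix \<epsilon> :: real assume "\<epsilon> > 0"
    from small[OF j this] show "eventually (\<lambda>n. \<forall>z\<in>cball 0 R. cmod (h n j z) \<le> exp (\<epsilon> * T n)) U"
    proof eventually_elim
      case (elim n)
      show ?case
        by (intro ballI norm_le_exp_abs_ln(2) nz[OF j]) (use elim R in auto)
    qed
  qed
  have "tiny (cball 0 R) (\<lambda>n z. e n j * h n j z)" if j: "j \<in> Q' - Q''" for j
  proof -
    obtain \<epsilon> where \<epsilon>: "\<epsilon> > 0" "\<not> eventually (\<lambda>n. cmod (e n j) \<ge> exp (- \<epsilon> * T n)) U"
      using j by (auto simp: Q''_def)
    then have "eventually (\<lambda>n. \<not> cmod (e n j) \<ge> exp (- \<epsilon> * T n)) U" by (simp only: not_eventually_iff)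
    then have "eventually (\<lambda>n. \<forall>z\<in>cball (0::complex) R. cmod (e n j) \<le> exp (- \<epsilon> * T n)) U"
      by eventually_elim auto
    from tinyI[OF \<epsilon>(1), of "cball 0 R" "\<lambda>n z. e n j", OF this]
    show ?thesis using subh[of j] j by (intro tiny_subexp_mult) auto
  qed
  then have s: "tiny (cball 0 R) (\<lambda>n z. \<Sum>j\<in>Q' - Q''. e n j * h n j z)" using fin by (intro tiny_sum) auto
  then have "tiny (cball 0 R) (\<lambda>n z. - (\<Sum>j\<in>Q' - Q''. e n j * h n j z))" by (rule tiny_cong_ev) simp
  with ti have "tiny (cball 0 R) (\<lambda>n z. a n z + (\<Sum>j\<in>Q'. e n j * h n j z) + - (\<Sum>j\<in>Q' - Q''. e n j * h n j z))"
    by (rule tiny_add)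
  moreover have "a n z + (\<Sum>j\<in>Q'. e n j * h n j z) + - (\<Sum>j\<in>Q' - Q''. e n j * h n j z) = a n z + (\<Sum>j\<in>Q''. e n j * h n j z)" for n z
    using sum.subset_diff[OF Q''(1) fin, of "\<lambda>j. e n j * h n j z"] by simp
  ultimately have ti2: "tiny (cball 0 R) (\<lambda>n z. a n z + (\<Sum>j\<in>Q''. e n j * h n j z))" by (simp only:)
  \<comment> \<open>A retained coefficient is nonzero for almost all \<open>n\<close>; the value
    \<open>1\<close> otherwise keeps \<open>h' n j\<close> a unit for every \<open>n\<close>, as
    \<open>near_relation\<close> demands.\<close>
  define h' where "h' n j = (if e n j = 0 then (\<lambda>z. 1) else (\<lambda>z. e n j * h n j z))" for n j
  have holh': "h' n j holomorphic_on unit_disc" if "j \<in> Q''" for n j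
    using hol[of j n] Q'' that by (auto simp: h'_def intro!: holomorphic_intros)
  have nzh': "h' n j z \<noteq> 0" if "j \<in> Q''" "z \<in> unit_disc" for n j z
    using nz[of j z n] Q'' that by (auto simp: h'_def)
  have e0: "eventually (\<lambda>n. \<forall>j\<in>Q''. e n j \<noteq> 0) U"
  proof (subst eventually_ball_finite_distrib[OF Q''(2)], intro ballI)
    fix j assume "j \<in> Q''"
    then have "eventually (\<lambda>n. cmod (e n j) \<ge> exp (- 1 * T n)) U" unfolding Q''_def using zero_less_one by blast
    then show "eventually (\<lambda>n. e n j \<noteq> 0) U"
      by eventually_elim (metis exp_gt_zero norm_zero not_le)
  qed
  have lnh': "eventually (\<lambda>n. \<forall>j\<in>Q''. \<forall>z\<in>cball 0 R. \<bar>ln (cmod (h' n j z))\<bar> \<le> \<epsilon> * T n) U" if \<epsilon>: "\<epsilon> > 0" for \<epsilon>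
  proof (subst eventually_ball_finite_distrib[OF Q''(2)], intro ballI)
    fix j assume j: "j \<in> Q''"
    have e2: "\<epsilon> / 2 > 0" using \<epsilon> by simp
    have ej: "eventually (\<lambda>n. cmod (e n j) \<ge> exp (- (\<epsilon> / 2) * T n)) U" using j e2 unfolding Q''_def by blast
    have jQ: "j \<in> Q'" using j Q'' by auto
    show "eventually (\<lambda>n. \<forall>z\<in>cball 0 R. \<bar>ln (cmod (h' n j z))\<bar> \<le> \<epsilon> * T n) U"
      using small[OF jQ e2] ej coef e0 T_ge[of "2 / \<epsilon>"]
    proof eventually_elim
      case (elim n)
      have ej0: "e n j \<noteq> 0" using elim j by blast
      have "1 \<le> \<epsilon> / 2 * T n" using elim \<epsilon> by (simp add: field_simps)
      then have "2 \<le> exp (\<epsilon> / 2 * T n)" using exp_ge_add_one_self[of "\<epsilon> / 2 * T n"] by linarith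
      then have "cmod (e n j) \<le> exp (\<epsilon> / 2 * T n)" using elim jQ by fastforce
      moreover have "exp (- (\<epsilon> / 2 * T n)) \<le> cmod (e n j)" using elim by simp
      ultimately have le: "\<bar>ln (cmod (e n j))\<bar> \<le> \<epsilon> / 2 * T n" by (intro abs_ln_norm_le)
      show ?case
      proof
        fix z :: complex assume z: "z \<in> cball 0 R"
        then have "h n j z \<noteq> 0" using R by (intro nz[OF jQ]) auto
        then have "ln (cmod (h' n j z)) = ln (cmod (e n j)) + ln (cmod (h n j z))"
          using ej0 by (simp add: h'_def norm_mult ln_mult)
        moreover have "\<bar>ln (cmod (h n j z))\<bar> \<le> \<epsilon> / 2 * T n" using elim z by blast
        ultimately show "\<bar>ln (cmod (h' n j z))\<bar> \<le> \<epsilon> * T n" using le by (simp add: abs_le_iff) linarith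
      qed
    qed
  qed
  have R0: "0 \<le> R" using R by simp
  define M where "M n = log_size (h' n) Q'' R" for n
  obtain c where c: "c > 0" "eventually (\<lambda>n. \<forall>z\<in>cball 0 R. cmod (a n z + (\<Sum>j\<in>Q''. e n j * h n j z)) \<le> exp (- c * T n)) U"
    using ti2 unfolding tiny_def by blast
  have ls: "1 \<le> log_size (h' n) Q'' R"
    "\<And>j z. j \<in> Q'' \<Longrightarrow> z \<in> cball 0 R \<Longrightarrow> \<bar>ln (cmod (h' n j z))\<bar> \<le> log_size (h' n) Q'' R"
    "\<And>B::real. (\<And>j z. j \<in> Q'' \<Longrightarrow> z \<in> cball 0 R \<Longrightarrow> \<bar>ln (cmod (h' n j z))\<bar> \<le> B) \<Longrightarrow> log_size (h' n) Q'' R \<le> 1 + card Q'' * B" for n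
    using log_size_facts(1-3)[of Q'' "h' n" R] Q''(2) holh' nzh' R0 R(4) by blast+
  have M1: "M n \<ge> 1" for n unfolding M_def by (rule ls(1))
  have Msmall: "eventually (\<lambda>n. M n \<le> \<epsilon> * T n) U" if \<epsilon>: "\<epsilon> > 0" for \<epsilon>
  proof -
    define \<eta> where "\<eta> = \<epsilon> / (2 * (card Q'' + 1))"
    have \<eta>: "\<eta> > 0" using \<epsilon> by (simp add: \<eta>_def)
    show ?thesis using lnh'[OF \<eta>] T_ge[of "2 / \<epsilon>"]
    proof eventually_elim
      case (elim n)
      have T1: "1 \<le> \<epsilon> / 2 * T n" using elim \<epsilon> by (simp add: field_simps)
      then have T0: "T n \<ge> 0" using \<epsilon> by (smt (verit) half_gt_zero mult_nonneg_nonpos2 mult.commute)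
      have "M n \<le> 1 + card Q'' * (\<eta> * T n)" unfolding M_def by (rule ls(3)) (use elim in blast)
      also have "card Q'' * (\<eta> * T n) \<le> (card Q'' + 1) * (\<eta> * T n)" using T0 \<eta> by (intro mult_right_mono) auto
      also have "\<dots> = \<epsilon> / 2 * T n" by (simp add: \<eta>_def field_simps)
      finally have "M n \<le> 1 + \<epsilon> / 2 * T n" by simp
      also have "\<dots> \<le> \<epsilon> / 2 * T n + \<epsilon> / 2 * T n" using T1 by simp
      finally show ?case by (simp add: field_simps)
    qed
  qed
  define \<kappa> where "\<kappa> n = c * T n / M n" for n
  have \<kappa>: "filterlim \<kappa> at_top U"
    unfolding filterlim_at_top_gt[where c = 0]
  proof (intro allI impI)
    fix Z :: real assume Z: "Z > 0"
    then have "c / Z > 0" using c by simp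
    from Msmall[OF this] show "eventually (\<lambda>n. Z \<le> \<kappa> n) U"
    proof eventually_elim
      case (elim n)
      have "Z * M n \<le> c * T n" using elim Z by (simp add: field_simps)
      then show ?case using M1[of n] by (simp add: \<kappa>_def pos_le_divide_eq)
    qed
  qed
  have "near_relation Q'' h' a zz w s R"
    unfolding near_relation_def
  proof (intro conjI)
    show "\<exists>Ca. eventually (\<lambda>n. \<forall>z\<in>cball 0 R. cmod (a n z) \<le> Ca) U" using ab by blast
    show "\<exists>ca>0. eventually (\<lambda>n. cmod (a n w) \<ge> ca) U" using al by blast
    have "eventually (\<lambda>n. \<forall>j\<in>Q''. cmod (h' n j (zz n)) \<le> 2 * K) U"
      using pts(2) coef e0
    proof eventually_elim
      case (elim n)
      show ?case
      proof
        fix j assume j: "j \<in> Q''"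
        have "cmod (e n j) * cmod (h n j (zz n)) \<le> 2 * K" using elim j Q'' by (intro mult_mono) auto
        then show "cmod (h' n j (zz n)) \<le> 2 * K" using elim j by (simp add: h'_def norm_mult)
      qed
    qed
    then show "\<exists>K. eventually (\<lambda>n. \<forall>j\<in>Q''. cmod (h' n j (zz n)) \<le> K) U" by blast
    show "\<exists>M \<kappa>. filterlim \<kappa> at_top U \<and> eventually (\<lambda>n. 1 \<le> M n) U \<and>
      eventually (\<lambda>n. \<forall>j\<in>Q''. \<forall>z\<in>cball 0 R. \<bar>ln (cmod (h' n j z))\<bar> \<le> M n) U \<and>
      eventually (\<lambda>n. \<forall>z\<in>cball 0 R. cmod (a n z + (\<Sum>j\<in>Q''. h' n j z)) \<le> exp (- \<kappa> n * M n)) U"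
    proof (rule exI[of _ M], rule exI[of _ \<kappa>], intro conjI)
      show "eventually (\<lambda>n. 1 \<le> M n) U" using M1 by simp
      show "eventually (\<lambda>n. \<forall>j\<in>Q''. \<forall>z\<in>cball 0 R. \<bar>ln (cmod (h' n j z))\<bar> \<le> M n) U"
        using ls(2) by (intro always_eventually) (simp add: M_def)
      show "eventually (\<lambda>n. \<forall>z\<in>cball 0 R. cmod (a n z + (\<Sum>j\<in>Q''. h' n j z)) \<le> exp (- \<kappa> n * M n)) U"
        using c(2) e0
      proof eventually_elim
        case (elim n)
        have "\<kappa> n * M n = c * T n" using M1[of n] by (simp add: \<kappa>_def)
        moreover have "(\<Sum>j\<in>Q''. h' n j z) = (\<Sum>j\<in>Q''. e n j * h n j z)" for z
          using elim by (intro sum.cong) (auto simp: h'_def)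
        ultimately show ?case using elim by simp
      qed
    qed (rule \<kappa>)
  qed (use holh' nzh' hola pts in auto)
  moreover define R2 where "R2 = (R' + R) / 2"
  moreover have R2: "s < R2" "R' < R2" "R2 < R" using R by (auto simp: R2_def)
  ultimately obtain i B where i: "i \<in> Q''" and B: "eventually (\<lambda>n. \<forall>z\<in>cball 0 R2. \<bar>ln (cmod (h' n i z))\<bar> \<le> B) U"
    using IH[of Q'' h' a R R2] Q'' R by blast
  have iQ: "i \<in> Q'" using i Q'' by auto
  \<comment> \<open>Back from \<open>e * h\<close> to \<open>h\<close>: since
    \<open>cmod (e n i) \<le> 2\<close>, a lower bound for the product gives one for
    \<open>h n i\<close>, and the upper bound at \<open>zz n\<close> completes it by
    Harnack.\<close>
  define \<delta> where "\<delta> = exp (- B) / 2"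
  define K' where "K' = max 1 K"
  have "eventually (\<lambda>n. \<forall>z\<in>cball 0 R'. \<bar>ln (cmod (h n i z))\<bar> \<le> \<bar>ln \<delta>\<bar> + ((R2 + R') / (R2 - R'))\<^sup>2 * (ln K' + \<bar>ln \<delta>\<bar>)) U"
    using B e0 coef pts
  proof eventually_elim
    case (elim n)
    have hb: "h n i holomorphic_on ball 0 R2" by (rule holomorphic_on_subset[OF hol[OF iQ]]) (use R2 R in auto)
    have lb: "cmod (h n i z) \<ge> \<delta>" if "z \<in> ball 0 R2" for z
    proof -
      have zU: "z \<in> unit_disc" using that R2 R by auto
      have "exp (- B) \<le> cmod (h' n i z)"
        by (rule norm_le_exp_abs_ln(1)) (use elim that nzh'[OF i zU] in auto)
      also have "\<dots> = cmod (e n i) * cmod (h n i z)" using elim i by (simp add: h'_def norm_mult)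
      also have "\<dots> \<le> 2 * cmod (h n i z)" using elim iQ by (intro mult_right_mono) auto
      finally show ?thesis by (simp add: \<delta>_def)
    qed
    show ?case
    proof
      fix z :: complex assume z: "z \<in> cball 0 R'"
      show "\<bar>ln (cmod (h n i z))\<bar> \<le> \<bar>ln \<delta>\<bar> + ((R2 + R') / (R2 - R'))\<^sup>2 * (ln K' + \<bar>ln \<delta>\<bar>)"
      proof (rule unit_abs_ln_le_of_lower_bound[OF hb _ lb _ _ _ _ _ z])
        show "cmod (h n i (zz n)) \<le> K'" using elim iQ by (auto simp: K'_def le_max_iff_disj)
        show "zz n \<in> cball 0 R'" using elim R by auto
      qed (use R R2 in \<open>auto simp: \<delta>_def K'_def\<close>)
    qed
  qed
  then show ?thesis using iQ by blast
qed

section \<open>One step of the induction on the number of terms\<close>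

lemma exists_maximal_index:
  fixes c :: "'a \<Rightarrow> real"
  assumes "finite A" "A \<noteq> {}"
  shows "\<exists>k\<in>A. \<forall>j\<in>A. c j \<le> c k"
proof -
  have "Max (c ` A) \<in> c ` A" using assms by (intro Max_in) auto
  then obtain k where k: "k \<in> A" "Max (c ` A) = c k" by blast
  have "c j \<le> c k" if "j \<in> A" for j using Max_ge[of "c ` A" "c j"] assms that k by simp
  then show ?thesis using k(1) by blast
qed

text \<open>The scale \<open>T\<close> is the size at \<open>R2\<close>. Between \<open>R2\<close>
  and \<open>R1\<close> the growth argument takes place, the size at \<open>R3\<close> is compared
  with \<open>T\<close>, and \<open>R4\<close>, \<open>R5\<close> are spent on spreading smallness
  and on integrating back. The same \<open>zz\<close> and \<open>w\<close> serve all shorter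
  relations.\<close>

locale reduction = scale U T for U :: "'n filter" and T :: "'n \<Rightarrow> real" +
  fixes Q :: "nat set" and h :: "'n \<Rightarrow> nat \<Rightarrow> complex \<Rightarrow> complex" and a :: "'n \<Rightarrow> complex \<Rightarrow> complex"
    and zz :: "'n \<Rightarrow> complex" and w :: complex and s R' R5 R4 R3 R2 R1 R Ca ca K :: real and M \<kappa> :: "'n \<Rightarrow> real"
  assumes Q: "finite Q" "0 \<notin> Q"
    and holh: "\<And>n j. j \<in> Q \<Longrightarrow> h n j holomorphic_on unit_disc"
    and nzh: "\<And>n j z. j \<in> Q \<Longrightarrow> z \<in> unit_disc \<Longrightarrow> h n j z \<noteq> 0"
    and hola: "\<And>n. a n holomorphic_on unit_disc"
    and a_bound: "eventually (\<lambda>n. \<forall>z\<in>cball 0 R. cmod (a n z) \<le> Ca) U"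
    and a_low: "ca > 0" "eventually (\<lambda>n. cmod (a n w) \<ge> ca) U"
    and zz: "eventually (\<lambda>n. zz n \<in> cball 0 s) U" and K: "eventually (\<lambda>n. \<forall>j\<in>Q. cmod (h n j (zz n)) \<le> K) U"
    and \<kappa>: "filterlim \<kappa> at_top U" and M: "eventually (\<lambda>n. 1 \<le> M n) U"
      "eventually (\<lambda>n. \<forall>j\<in>Q. \<forall>z\<in>cball 0 R. \<bar>ln (cmod (h n j z))\<bar> \<le> M n) U"
    and err: "eventually (\<lambda>n. \<forall>z\<in>cball 0 R. cmod (a n z + (\<Sum>j\<in>Q. h n j z)) \<le> exp (- \<kappa> n * M n)) U"
    and rad: "0 \<le> s" "s < R'" "R' < R5" "R5 < R4" "R4 < R3" "R3 < R2" "R2 < R1" "R1 < R" "R < 1"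
    and T_def: "\<And>n. T n = log_size (h n) Q R2"
    and IH: "\<And>Q'' h' a' R1 R2. Q'' \<subset> Q \<Longrightarrow> near_relation Q'' h' a' zz w s R1 \<Longrightarrow> s < R2 \<Longrightarrow> R2 < R1 \<Longrightarrow> R1 < 1 \<Longrightarrow>
      \<exists>i\<in>Q''. \<exists>B. eventually (\<lambda>n. \<forall>z\<in>cball 0 R2. \<bar>ln (cmod (h' n i z))\<bar> \<le> B) U"
begin

abbreviation "comparable \<equiv> \<exists>i\<in>Q. \<exists>B. eventually (\<lambda>n. \<forall>z\<in>cball 0 R'. \<bar>ln (cmod (h n i z))\<bar> \<le> B) U"

abbreviation "J \<equiv> insert 0 Q"
text \<open>The function \<open>a\<close> may have zeros, so it becomes the coefficient of the unit
  \<open>1\<close> at the free index \<open>0\<close>; all other coefficients are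
  \<open>1\<close>.\<close>

definition "H n = (h n)(0 := (\<lambda>z. 1))"
definition "\<alpha> n j = (if j = 0 then a n else (\<lambda>z. 1))"

lemma fam: "unit_family (H n) (\<alpha> n) J"
  using Q holh nzh hola by unfold_locales (auto simp: H_def \<alpha>_def)

lemma H_Q: "j \<in> Q \<Longrightarrow> H n j = h n j" and \<alpha>_Q: "j \<in> Q \<Longrightarrow> \<alpha> n j = (\<lambda>z. 1)"
  and H_0: "H n 0 = (\<lambda>z. 1)" and \<alpha>_0: "\<alpha> n 0 = a n"
  using Q by (auto simp: H_def \<alpha>_def)

lemma sum_terms: "S \<subseteq> Q \<Longrightarrow> (\<Sum>j\<in>insert 0 S. \<alpha> n j z * H n j z) = a n z + (\<Sum>j\<in>S. h n j z)"
proof -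
  assume S: "S \<subseteq> Q"
  then have "finite S" "0 \<notin> S" using Q finite_subset by auto
  then have "(\<Sum>j\<in>insert 0 S. \<alpha> n j z * H n j z) = a n z + (\<Sum>j\<in>S. \<alpha> n j z * H n j z)"
    by (simp add: H_0 \<alpha>_0)
  moreover have "(\<Sum>j\<in>S. \<alpha> n j z * H n j z) = (\<Sum>j\<in>S. h n j z)"
    using S by (intro sum.cong) (auto simp: H_Q \<alpha>_Q)
  ultimately show ?thesis by simp
qed

lemma size_facts:
  fixes B :: real
  assumes "0 \<le> r" "r < 1"
  shows "1 \<le> log_size (h n) Q r"
    "j \<in> Q \<Longrightarrow> z \<in> cball 0 r \<Longrightarrow> \<bar>ln (cmod (h n j z))\<bar> \<le> log_size (h n) Q r"
    "(\<And>j z. j \<in> Q \<Longrightarrow> z \<in> cball 0 r \<Longrightarrow> \<bar>ln (cmod (h n j z))\<bar> \<le> B) \<Longrightarrow> log_size (h n) Q r \<le> 1 + card Q * B"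
    "0 \<le> r' \<Longrightarrow> r' \<le> r \<Longrightarrow> log_size (h n) Q r' \<le> log_size (h n) Q r"
  by (rule log_size_facts[OF Q(1) holh nzh assms]; (assumption | blast))+

text \<open>\<open>T\<close> is at most \<open>(1 + card Q) * M\<close>, so the error beats the rate
  1 once \<open>\<kappa>\<close> reaches \<open>1 + card Q\<close>.\<close>

lemma relation_tiny: "tiny (cball 0 R) (\<lambda>n z. a n z + (\<Sum>j\<in>Q. h n j z))"
proof (rule tinyI[of 1])
  have "eventually (\<lambda>n. \<kappa> n \<ge> 1 + card Q) U" using \<kappa> by (simp add: filterlim_at_top)
  with err M show "eventually (\<lambda>n. \<forall>z\<in>cball 0 R. cmod (a n z + (\<Sum>j\<in>Q. h n j z)) \<le> exp (- 1 * T n)) U"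
  proof eventually_elim
    case (elim n)
    have "T n \<le> 1 + card Q * M n" unfolding T_def using rad elim by (intro size_facts(3)) auto
    also have "\<dots> \<le> (1 + card Q) * M n" using elim by (simp add: algebra_simps)
    also have "\<dots> \<le> \<kappa> n * M n" using elim by (intro mult_right_mono) auto
    finally have "exp (- \<kappa> n * M n) \<le> exp (- 1 * T n)" by simp
    then show ?case using elim(1) order_trans by blast
  qed
qed simp

lemma H_bound: "eventually (\<lambda>n. \<forall>j\<in>J. \<forall>z\<in>ball 0 R2. \<bar>ln (cmod (H n j z))\<bar> \<le> T n) U"
proof (intro always_eventually allI ballI)
  fix n j and z :: complex assume j: "j \<in> J" and z: "z \<in> ball 0 R2"
  have "1 \<le> T n" unfolding T_def using rad by (intro size_facts) auto
  moreover have "\<bar>ln (cmod (h n j z))\<bar> \<le> T n" if "j \<in> Q" unfolding T_def using rad z that by (intro size_facts) auto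
  ultimately show "\<bar>ln (cmod (H n j z))\<bar> \<le> T n" using j by (cases "j = 0") (auto simp: H_0 H_Q)
qed

text \<open>The class of \<open>0\<close> already satisfies a relation with tiny error. It cannot
  comprise all of \<open>Q\<close>, for then all logarithms at radius \<open>R3\<close> would be of
  smaller order than \<open>T\<close>, against the assumption; so the relation is shorter and the
  induction hypothesis applies.\<close>

lemma doubling_case:
  assumes c: "c > 0" "eventually (\<lambda>n. c * T n \<le> log_size (h n) Q R3) U"
  shows comparable
proof -
  obtain Qc where Qc: "Qc \<subseteq> J" "0 \<in> Qc"
    "\<And>j r \<epsilon>. j \<in> Qc \<Longrightarrow> r < R2 \<Longrightarrow> \<epsilon> > 0 \<Longrightarrow>
       eventually (\<lambda>n. \<forall>z\<in>cball 0 r. \<bar>ln (cmod (H n j z))\<bar> \<le> \<epsilon> * T n) U"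
    "\<And>r. 0 < r \<Longrightarrow> r < R2 \<Longrightarrow> tiny (cball 0 r) (\<lambda>n z. \<Sum>j\<in>Qc. \<alpha> n j z * H n j z)"
  proof (rule dominant_class_tiny[of J H \<alpha> s R2 zz])
    show "finite J" "0 \<in> J" using Q by auto
    show "H n j holomorphic_on unit_disc" "\<alpha> n j holomorphic_on unit_disc" if "j \<in> J" for n j
      using unit_family.hol_h[OF fam that] unit_family.hol_\<alpha>[OF fam that] .
    show "H n j z \<noteq> 0" if "j \<in> J" "z \<in> unit_disc" for n j z
      using unit_family.h_nz[OF fam that] .
    show "H n 0 z = 1" for n z by (simp add: H_0)
    show "0 \<le> s" "s < R2" "R2 \<le> 1" using rad by auto
    show "eventually (\<lambda>n. \<forall>j\<in>J. \<forall>z\<in>ball 0 R2. \<bar>ln (cmod (H n j z))\<bar> \<le> T n) U"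
      by (rule H_bound)
    show "subexp (ball 0 R2) (\<lambda>n. \<alpha> n j)" if "j \<in> J" for j
    proof (rule subexp_bounded[where B = "max 1 Ca"])
      show "eventually (\<lambda>n. \<forall>z\<in>ball 0 R2. cmod (\<alpha> n j z) \<le> max 1 Ca) U"
        using a_bound by eventually_elim (use rad in \<open>auto simp: \<alpha>_def le_max_iff_disj\<close>)
    qed
    have "tiny (ball 0 R2) (\<lambda>n z. a n z + (\<Sum>j\<in>Q. h n j z))"
      by (rule tiny_subset[OF relation_tiny]) (use rad in auto)
    then show "tiny (ball 0 R2) (\<lambda>n z. \<Sum>j\<in>J. \<alpha> n j z * H n j z)" by (simp only: sum_terms[OF order_refl])
    show "eventually (\<lambda>n. zz n \<in> cball 0 s) U" by (rule zz)
    show "eventually (\<lambda>n. \<forall>j\<in>J. ln (cmod (H n j (zz n))) \<le> \<epsilon> * T n) U" if "\<epsilon> > 0" for \<epsilon>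
      using K T_ge[of "ln (max 1 K) / \<epsilon>"] zz T_ge[of 0]
    proof eventually_elim
      case (elim n)
      have e: "ln (max 1 K) \<le> \<epsilon> * T n" using elim that by (simp add: field_simps)
      show ?case
      proof
        fix j assume j: "j \<in> J"
        show "ln (cmod (H n j (zz n))) \<le> \<epsilon> * T n"
        proof (cases "j = 0")
          case True
          then show ?thesis using elim that by (simp add: H_0)
        next
          case False
          then have jQ: "j \<in> Q" using j by simp
          have "zz n \<in> unit_disc" using elim rad by auto
          then have "h n j (zz n) \<noteq> 0" using nzh jQ by blast
          then have "ln (cmod (h n j (zz n))) \<le> ln (max 1 K)"
            using elim jQ by (intro ln_mono) (auto simp: le_max_iff_disj)
          then show ?thesis using e jQ by (simp add: H_Q)
        qed
      qed
    qed
  qed blast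
  define Q' where "Q' = Qc - {0}"
  have Q': "Q' \<subseteq> Q" "Qc = insert 0 Q'" using Qc by (auto simp: Q'_def)
  have small: "eventually (\<lambda>n. \<forall>z\<in>cball 0 r. \<bar>ln (cmod (h n j z))\<bar> \<le> \<epsilon> * T n) U"
    if "j \<in> Q'" "r < R2" "\<epsilon> > 0" for j r \<epsilon>
    using Qc(3)[of j r \<epsilon>] that Q' by (auto simp: H_Q subset_eq)
  have "Q' \<noteq> Q"
  proof
    assume eq: "Q' = Q"
    define \<eta> where "\<eta> = c / (2 * (card Q + 1))"
    have \<eta>: "\<eta> > 0" using c by (simp add: \<eta>_def)
    have "eventually (\<lambda>n. \<forall>j\<in>Q. \<forall>z\<in>cball 0 R3. \<bar>ln (cmod (h n j z))\<bar> \<le> \<eta> * T n) U"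
      using small \<eta> rad eq by (subst eventually_ball_finite_distrib[OF Q(1)]) auto
    with c(2) T_ge[of "4 / c"] have "eventually (\<lambda>n. False) U"
    proof eventually_elim
      case (elim n)
      have T0: "T n \<ge> 0" "c * T n \<ge> 4" using elim c by (auto simp: field_simps intro: order_trans[of 0 "4 / c"])
      have "log_size (h n) Q R3 \<le> 1 + card Q * (\<eta> * T n)"
        using elim rad by (intro size_facts) auto
      also have "card Q * (\<eta> * T n) \<le> (card Q + 1) * (\<eta> * T n)" using T0 \<eta> by (intro mult_right_mono) auto
      also have "\<dots> = c / 2 * T n" by (simp add: \<eta>_def field_simps)
      finally show False using elim T0 by simp
    qed
    then show False using nontrivial by (simp add: eventually_False)
  qed
  then have psub: "Q' \<subset> Q" using Q' by auto
  have finQ': "finite Q'" using Q' Q finite_subset by blast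
  have Q'D: "j \<in> Q" if "j \<in> Q'" for j using that Q' by auto
  have ti: "tiny (cball 0 R4) (\<lambda>n z. a n z + (\<Sum>j\<in>Q'. 1 * h n j z))"
  proof -
    have "tiny (cball 0 R4) (\<lambda>n z. \<Sum>j\<in>Qc. \<alpha> n j z * H n j z)" using rad by (intro Qc(4)) auto
    then show ?thesis unfolding Q'(2) by (simp add: sum_terms[OF Q'(1)])
  qed
  have "\<exists>i\<in>Q'. \<exists>B. eventually (\<lambda>n. \<forall>z\<in>cball 0 R'. \<bar>ln (cmod (h n i z))\<bar> \<le> B) U"
  proof (rule reduce_near_relation[where e = "\<lambda>_ _. 1", OF _ finQ' _ _ hola _ a_low zz _ _ _ ti])
    show "\<exists>i\<in>Q''. \<exists>B. eventually (\<lambda>n. \<forall>z\<in>cball 0 R2. \<bar>ln (cmod (h' n i z))\<bar> \<le> B) U"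
      if "Q'' \<subseteq> Q'" "near_relation Q'' h' a' zz w s R1" "s < R2" "R2 < R1" "R1 < 1" for Q'' h' a' R1 R2
      using IH[OF _ that(2-5)] that(1) psub by blast
    show "eventually (\<lambda>n. \<forall>z\<in>cball 0 R4. cmod (a n z) \<le> Ca) U"
      using a_bound by eventually_elim (use rad in auto)
    show "eventually (\<lambda>n. \<forall>j\<in>Q'. cmod (h n j (zz n)) \<le> K) U" using K by eventually_elim (use Q' in auto)
  qed (use Q'D holh nzh small rad in auto)
  then show ?thesis using Q' by blast
qed

text \<open>A multiple of the second relation is subtracted from the given one to cancel the term
  with the largest coefficient. In the applications \<open>\<delta>\<close> is \<open>1\<close> or
  \<open>0\<close> according to whether the second relation contains \<open>a\<close>. The bound
  \<open>1 + \<delta>\<close> gives \<open>\<delta> / cmod (d n k0) \<le> 1 / 2\<close>, so the new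
  function \<open>a'\<close> is still bounded below at \<open>w\<close>, and maximality bounds the
  new coefficients by 2.\<close>

lemma relation_case:
  fixes \<delta> :: real
  assumes sg: "\<And>c. c > 0 \<Longrightarrow> eventually (\<lambda>n. log_size (h n) Q R3 \<le> c * T n) U"
    and S: "S \<subseteq> Q" and \<delta>: "0 \<le> \<delta>" "\<delta> \<le> 1"
    and rel: "tiny (cball 0 R5) (\<lambda>n z. of_real \<delta> * a n z + (\<Sum>k\<in>S. d n k * h n k z))"
    and d: "eventually (\<lambda>n. \<exists>k\<in>S. cmod (d n k) \<ge> 1 + \<delta>) U"
  shows comparable
proof -
  have finS: "finite S" using S Q finite_subset by blast
  have "eventually (\<lambda>n. \<exists>k0\<in>S. cmod (d n k0) \<ge> 1 + \<delta> \<and> (\<forall>k\<in>S. cmod (d n k) \<le> cmod (d n k0))) U"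
    using d
  proof eventually_elim
    case (elim n)
    then obtain k where k: "k \<in> S" "cmod (d n k) \<ge> 1 + \<delta>" by blast
    then obtain k0 where "k0 \<in> S" "\<forall>k\<in>S. cmod (d n k) \<le> cmod (d n k0)"
      using exists_maximal_index[OF finS, of "\<lambda>k. cmod (d n k)"] by blast
    then show ?case using k order_trans by (intro bexI[of _ k0] conjI) blast+
  qed
  from eventually_finite_Ex[OF finS this] obtain k0 where k0: "k0 \<in> S"
    and dk0: "eventually (\<lambda>n. cmod (d n k0) \<ge> 1 + \<delta> \<and> (\<forall>k\<in>S. cmod (d n k) \<le> cmod (d n k0))) U" by blast
  define e where "e n l = (if l \<in> S then 1 - d n l / d n k0 else 1)" for n l
  define a' where "a' n z = (1 - of_real \<delta> / d n k0) * a n z" for n z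
  define rl where "rl n z = of_real \<delta> * a n z + (\<Sum>k\<in>S. d n k * h n k z)" for n z
  have t1: "tiny (cball 0 R5) (\<lambda>n z. - (1 / d n k0) * rl n z)"
  proof (rule tiny_cong_ev)
    show "tiny (cball 0 R5) rl" using rel by (simp add: rl_def[abs_def])
    show "eventually (\<lambda>n. \<forall>z\<in>cball 0 R5. cmod (- (1 / d n k0) * rl n z) \<le> cmod (rl n z)) U"
      using dk0
    proof eventually_elim
      case (elim n)
      have "cmod (1 / d n k0) \<le> 1" using elim \<delta> by (simp add: norm_divide divide_le_eq)
      then have "cmod (1 / d n k0) * cmod (rl n z) \<le> 1 * cmod (rl n z)" for z by (intro mult_right_mono) auto
      then show ?case by (simp add: norm_mult norm_divide)
    qed
  qed
  have "tiny (cball 0 R5) (\<lambda>n z. a n z + (\<Sum>j\<in>Q. h n j z))"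
    by (rule tiny_subset[OF relation_tiny]) (use rad in auto)
  from tiny_add[OF this t1]
  have ti: "tiny (cball 0 R5) (\<lambda>n z. a' n z + (\<Sum>l\<in>Q - {k0}. e n l * h n l z))"
  proof (rule tiny_cong_ev)
    show "eventually (\<lambda>n. \<forall>z\<in>cball 0 R5. cmod (a' n z + (\<Sum>l\<in>Q - {k0}. e n l * h n l z))
        \<le> cmod (a n z + (\<Sum>j\<in>Q. h n j z) + - (1 / d n k0) * rl n z)) U"
      using dk0
    proof eventually_elim
      case (elim n)
      have d0: "d n k0 \<noteq> 0" using elim \<delta> by auto
      have eq: "a n z + (\<Sum>j\<in>Q. h n j z) + - (1 / d n k0) * rl n z = a' n z + (\<Sum>l\<in>Q - {k0}. e n l * h n l z)" for z
      proof -
        have kQ: "k0 \<in> Q" using k0 S by auto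
        have "(\<Sum>k\<in>S. d n k * h n k z) = (\<Sum>l\<in>Q. (if l \<in> S then d n l else 0) * h n l z)"
          using S Q by (intro sum.mono_neutral_cong_left) auto
        then have "(\<Sum>j\<in>Q. h n j z) - 1 / d n k0 * (\<Sum>k\<in>S. d n k * h n k z)
          = (\<Sum>l\<in>Q. h n l z - 1 / d n k0 * ((if l \<in> S then d n l else 0) * h n l z))"
          by (simp only: sum_subtractf sum_distrib_left)
        also have "\<dots> = (\<Sum>l\<in>Q. e n l * h n l z)"
          by (intro sum.cong) (auto simp: e_def algebra_simps)
        also have "\<dots> = e n k0 * h n k0 z + (\<Sum>l\<in>Q - {k0}. e n l * h n l z)"
          by (rule sum.remove[OF Q(1) kQ])
        also have "e n k0 = 0" using k0 d0 by (simp add: e_def)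
        finally show ?thesis by (simp add: rl_def a'_def algebra_simps)
      qed
      show ?case unfolding eq by simp
    qed
  qed
  have fin': "finite (Q - {k0})" using Q by simp
  have small: "eventually (\<lambda>n. \<forall>z\<in>cball 0 R5. \<bar>ln (cmod (h n j z))\<bar> \<le> \<epsilon> * T n) U" if j: "j \<in> Q - {k0}" and \<epsilon>: "\<epsilon> > 0" for j \<epsilon>
    using sg[OF \<epsilon>]
  proof eventually_elim
    case (elim n)
    show ?case
    proof
      fix z :: complex assume "z \<in> cball 0 R5"
      then have "\<bar>ln (cmod (h n j z))\<bar> \<le> log_size (h n) Q R3" using j rad by (intro size_facts) auto
      then show "\<bar>ln (cmod (h n j z))\<bar> \<le> \<epsilon> * T n" using elim by linarith
    qed
  qed
  have q: "cmod (of_real \<delta> / d n k0) \<le> 1 / 2 \<and> (\<forall>l\<in>S. cmod (d n l / d n k0) \<le> 1)"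
    if n: "cmod (d n k0) \<ge> 1 + \<delta> \<and> (\<forall>k\<in>S. cmod (d n k) \<le> cmod (d n k0))" for n
  proof -
    have p: "cmod (d n k0) > 0" using n \<delta> by linarith
    have "\<delta> \<le> 1 / 2 * cmod (d n k0)" using n \<delta> by simp
    then show ?thesis using n p \<delta> by (auto simp: norm_divide divide_le_eq)
  qed
  have "\<exists>i\<in>Q - {k0}. \<exists>B. eventually (\<lambda>n. \<forall>z\<in>cball 0 R'. \<bar>ln (cmod (h n i z))\<bar> \<le> B) U"
  proof (rule reduce_near_relation[where e = e, OF _ fin' _ _ _ _ _ _ zz _ small _ ti, where ca = "ca / 2" and Ca = "2 * Ca"])
    show "\<exists>i\<in>Q''. \<exists>B. eventually (\<lambda>n. \<forall>z\<in>cball 0 R2. \<bar>ln (cmod (h' n i z))\<bar> \<le> B) U"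
      if "Q'' \<subseteq> Q - {k0}" "near_relation Q'' h' a' zz w s R1" "s < R2" "R2 < R1" "R1 < 1" for Q'' h' a' R1 R2
      using IH[OF _ that(2-5)] that(1) k0 S by blast
    show "a' n holomorphic_on unit_disc" for n unfolding a'_def by (intro holomorphic_intros hola)
    show "eventually (\<lambda>n. \<forall>z\<in>cball 0 R5. cmod (a' n z) \<le> 2 * Ca) U" using a_bound dk0
    proof eventually_elim
      case (elim n)
      have "cmod (1 - of_real \<delta> / d n k0) \<le> 2"
        using norm_triangle_ineq4[of 1 "of_real \<delta> / d n k0"] q[OF elim(2)] by simp
      then show ?case unfolding a'_def norm_mult using elim(1) rad by (intro ballI mult_mono) auto
    qed
    show "eventually (\<lambda>n. ca / 2 \<le> cmod (a' n w)) U" using a_low(2) dk0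
    proof eventually_elim
      case (elim n)
      have "cmod (1 - of_real \<delta> / d n k0) \<ge> 1 / 2"
        using norm_triangle_ineq2[of 1 "of_real \<delta> / d n k0"] q[OF elim(2)] by simp
      then have "1 / 2 * ca \<le> cmod (1 - of_real \<delta> / d n k0) * cmod (a n w)"
        using elim(1) a_low(1) by (intro mult_mono) auto
      then show ?case by (simp add: a'_def norm_mult)
    qed
    show "eventually (\<lambda>n. \<forall>j\<in>Q - {k0}. cmod (h n j (zz n)) \<le> K) U" using K by eventually_elim auto
    show "eventually (\<lambda>n. \<forall>j\<in>Q - {k0}. cmod (e n j) \<le> 2) U" using dk0
    proof eventually_elim
      case (elim n)
      show ?case
      proof
        fix j
        show "cmod (e n j) \<le> 2"
          using norm_triangle_ineq4[of 1 "d n j / d n k0"] q[OF elim] by (fastforce simp: e_def)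
      qed
    qed
  qed (use holh nzh rad a_low in auto)
  then show ?thesis by blast
qed

abbreviation "cf ks j n \<equiv> elim_coeff (H n) (\<alpha> n) ks j"

lemma \<alpha>_bound: "eventually (\<lambda>n. \<forall>j\<in>J. \<forall>z\<in>cball 0 R. cmod (\<alpha> n j z) \<le> max 1 Ca) U"
  using a_bound by eventually_elim (auto simp: \<alpha>_def le_max_iff_disj)

lemma coeff_subexp: "set ks \<subseteq> J \<Longrightarrow> j \<in> J \<Longrightarrow> subexp (cball 0 R3) (cf ks j)"
proof (rule elim_coeff_subexp[OF fam _ _ _ H_bound])
  show "eventually (\<lambda>n. \<forall>j\<in>J. \<forall>z\<in>ball 0 R2. cmod (\<alpha> n j z) \<le> max 1 Ca) U"
    using \<alpha>_bound by eventually_elim (use rad in auto)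
qed (use rad in auto)

lemma H_subexp:
  assumes sg: "\<And>c. c > 0 \<Longrightarrow> eventually (\<lambda>n. log_size (h n) Q R3 \<le> c * T n) U" and j: "j \<in> J"
  shows "subexp (cball 0 R3) (\<lambda>n. H n j)" "subexp (cball 0 R3) (\<lambda>n z. inverse (H n j z))"
proof -
  have *: "eventually (\<lambda>n. \<forall>z\<in>cball 0 R3. cmod (H n j z) \<le> exp (\<epsilon> * T n) \<and> cmod (inverse (H n j z)) \<le> exp (\<epsilon> * T n)) U"
    if \<epsilon>: "\<epsilon> > 0" for \<epsilon>
    using sg[OF \<epsilon>]
  proof eventually_elim
    case (elim n)
    show ?case
    proof
      fix z :: complex assume z: "z \<in> cball 0 R3"
      have s1: "1 \<le> log_size (h n) Q R3" using rad by (intro size_facts) auto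
      have "\<bar>ln (cmod (H n j z))\<bar> \<le> log_size (h n) Q R3"
      proof (cases "j = 0")
        case True
        then show ?thesis using s1 by (simp add: H_0)
      next
        case False
        then show ?thesis using j z rad by (simp add: H_Q size_facts(2))
      qed
      then have le: "\<bar>ln (cmod (H n j z))\<bar> \<le> \<epsilon> * T n" using elim by linarith
      have nz: "H n j z \<noteq> 0" using unit_family.h_nz[OF fam j] z rad by auto
      have "exp (- (\<epsilon> * T n)) \<le> cmod (H n j z)" by (rule norm_le_exp_abs_ln(1)[OF le nz])
      then have "cmod (inverse (H n j z)) \<le> exp (\<epsilon> * T n)"
        using le_imp_inverse_le[of "exp (- (\<epsilon> * T n))" "cmod (H n j z)"] by (simp add: norm_inverse exp_minus)
      then show "cmod (H n j z) \<le> exp (\<epsilon> * T n) \<and> cmod (inverse (H n j z)) \<le> exp (\<epsilon> * T n)"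
        using norm_le_exp_abs_ln(2)[OF le nz] by simp
    qed
  qed
  show "subexp (cball 0 R3) (\<lambda>n. H n j)" "subexp (cball 0 R3) (\<lambda>n z. inverse (H n j z))"
    unfolding subexp_def by (intro allI impI, rule eventually_mono[OF *], assumption, blast)+
qed

text \<open>A tiny coefficient means that the eliminations in \<open>ks\<close> annihilate the term
  \<open>j\<close> up to a tiny error; integrating back expresses this term by the pivot terms with
  constant coefficients. For \<open>j \<noteq> 0\<close> this is a relation among the units in which
  \<open>j\<close> has coefficient \<open>1\<close>; for \<open>j = 0\<close> it contains
  \<open>a\<close>.\<close>

lemma tiny_coeff_case:
  assumes sg: "\<And>c. c > 0 \<Longrightarrow> eventually (\<lambda>n. log_size (h n) Q R3 \<le> c * T n) U"
    and ks: "set ks \<subseteq> Q" "distinct ks" and j: "j \<in> J" "j \<notin> set ks" "j = 0 \<Longrightarrow> set ks \<noteq> Q"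
    and piv: "\<And>us k vs. ks = us @ k # vs \<Longrightarrow> \<not> tiny (cball 0 R') (cf vs k)"
    and ti: "tiny (cball 0 R') (cf ks j)"
  shows comparable
proof -
  have R'0: "R' > 0" using rad by simp
  have ksJ: "set ks \<subseteq> J" using ks by auto
  have "tiny (cball 0 R4) (cf ks j)"
  proof (rule tiny_spread[OF unit_family.hol_C[OF fam ksJ j(1)] coeff_subexp[OF ksJ j(1)] _ _ _ R'0 _ ti])
    show "cball 0 R' \<subseteq> cball (0::complex) R4" using rad by auto
  qed (use rad in auto)
  moreover have "cball (0::complex) R4 \<subseteq> cball 0 R3" using rad by (intro subset_cball) simp
  ultimately have "tiny (cball 0 R4) (\<lambda>n z. cf ks j n z * H n j z)"
    by (intro tiny_subexp_mult subexp_subset[OF H_subexp(1)[OF sg j(1)]])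
  then have "tiny (cball 0 R4) (\<lambda>n. elim_op (H n) (\<alpha> n) ks (\<lambda>z. \<alpha> n j z * H n j z))"
  proof (rule tiny_cong_ev, intro always_eventually allI ballI)
    fix n and z :: complex assume "z \<in> cball 0 R4"
    then have "z \<in> unit_disc" using rad by auto
    then show "cmod (elim_op (H n) (\<alpha> n) ks (\<lambda>z. \<alpha> n j z * H n j z) z) \<le> cmod (cf ks j n z * H n j z)"
      using unit_family.V_term[OF fam ksJ j(1)] by simp
  qed
  moreover have hol: "(\<lambda>z. \<alpha> n j z * H n j z) holomorphic_on unit_disc" for n
    by (intro holomorphic_intros unit_family.hol_h[OF fam j(1)] unit_family.hol_\<alpha>[OF fam j(1)])
  moreover have "R3 \<le> 1" using rad by simp
  ultimately have "\<exists>c. tiny (cball 0 R5) (\<lambda>n z. \<alpha> n j z * H n j z + (\<Sum>k\<in>set ks. c n k * (\<alpha> n k z * H n k z)))"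
    using rad
    by (intro integrate_elimination[where s = R' and r = R4 and R = R3 and J = J, OF fam _ _ _ _ piv ksJ ks(2)]
      coeff_subexp H_subexp[OF sg]) simp_all
  then obtain c where "tiny (cball 0 R5) (\<lambda>n z. \<alpha> n j z * H n j z + (\<Sum>k\<in>set ks. c n k * (\<alpha> n k z * H n k z)))" by blast
  moreover have "(\<Sum>k\<in>set ks. c n k * (\<alpha> n k z * H n k z)) = (\<Sum>k\<in>set ks. c n k * h n k z)" for n z
    using ks by (intro sum.cong) (auto simp: H_Q \<alpha>_Q)
  ultimately have c: "tiny (cball 0 R5) (\<lambda>n z. \<alpha> n j z * H n j z + (\<Sum>k\<in>set ks. c n k * h n k z))" by simp
  show ?thesis
  proof (cases "j = 0")
    case False
    then have jQ: "j \<in> Q" using j by simp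
    define d where "d n = (c n)(j := 1)" for n
    have eq: "\<alpha> n j z * H n j z + (\<Sum>k\<in>set ks. c n k * h n k z) = of_real 0 * a n z + (\<Sum>k\<in>insert j (set ks). d n k * h n k z)" for n z
    proof -
      have "(\<Sum>k\<in>set ks. d n k * h n k z) = (\<Sum>k\<in>set ks. c n k * h n k z)"
        using j(2) by (intro sum.cong) (auto simp: d_def)
      then show ?thesis using j(2) jQ by (simp add: d_def H_Q \<alpha>_Q)
    qed
    show ?thesis
    proof (rule relation_case[OF sg])
      show "insert j (set ks) \<subseteq> Q" using jQ ks by auto
      show "tiny (cball 0 R5) (\<lambda>n z. of_real 0 * a n z + (\<Sum>k\<in>insert j (set ks). d n k * h n k z))"
        using c unfolding eq .
      show "eventually (\<lambda>n. \<exists>k\<in>insert j (set ks). 1 + 0 \<le> cmod (d n k)) U" by (simp add: d_def)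
    qed auto
  next
    case True
    have ti0: "tiny (cball 0 R5) (\<lambda>n z. a n z + (\<Sum>k\<in>set ks. c n k * h n k z))"
      using c True by (simp add: H_0 \<alpha>_0)
    show ?thesis
    \<comment> \<open>If some coefficient is at least 2, the relation can cancel a term of the
      original one. Otherwise its coefficients are admissible as they stand, and it is shorter
      because \<open>set ks\<close> differs from \<open>Q\<close>.\<close>
    proof (cases "eventually (\<lambda>n. \<exists>k\<in>set ks. cmod (c n k) \<ge> 2) U")
      case True
      show ?thesis
        by (rule relation_case[OF sg ks(1), of 1 c]) (use ti0 True in auto)
    next
      case False
      then have "eventually (\<lambda>n. \<not> (\<exists>k\<in>set ks. cmod (c n k) \<ge> 2)) U" by (simp only: not_eventually_iff)
      then have c2: "eventually (\<lambda>n. \<forall>k\<in>set ks. cmod (c n k) \<le> 2) U" by eventually_elim auto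
      have psub: "set ks \<subset> Q" using j(3) \<open>j = 0\<close> ks by auto
      have ksD: "k \<in> Q" if "k \<in> set ks" for k using that ks by auto
      have small: "eventually (\<lambda>n. \<forall>z\<in>cball 0 R5. \<bar>ln (cmod (h n k z))\<bar> \<le> \<epsilon> * T n) U" if k: "k \<in> set ks" and \<epsilon>: "\<epsilon> > 0" for k \<epsilon>
        using sg[OF \<epsilon>]
      proof eventually_elim
        case (elim n)
        show ?case
        proof
          fix z :: complex assume "z \<in> cball 0 R5"
          then have "\<bar>ln (cmod (h n k z))\<bar> \<le> log_size (h n) Q R3" using ksD[OF k] rad by (intro size_facts) auto
          then show "\<bar>ln (cmod (h n k z))\<bar> \<le> \<epsilon> * T n" using elim by linarith
        qed
      qed
      have "\<exists>i\<in>set ks. \<exists>B. eventually (\<lambda>n. \<forall>z\<in>cball 0 R'. \<bar>ln (cmod (h n i z))\<bar> \<le> B) U"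
      proof (rule reduce_near_relation[where e = c, OF _ _ _ _ hola _ a_low zz _ small c2 ti0])
        show "\<exists>i\<in>Q''. \<exists>B. eventually (\<lambda>n. \<forall>z\<in>cball 0 R2. \<bar>ln (cmod (h' n i z))\<bar> \<le> B) U"
          if "Q'' \<subseteq> set ks" "near_relation Q'' h' a' zz w s R1" "s < R2" "R2 < R1" "R1 < 1" for Q'' h' a' R1 R2
          using IH[OF _ that(2-5)] that(1) psub by blast
        show "eventually (\<lambda>n. \<forall>z\<in>cball 0 R5. cmod (a n z) \<le> Ca) U"
          using a_bound by eventually_elim (use rad in auto)
        show "eventually (\<lambda>n. \<forall>j\<in>set ks. cmod (h n j (zz n)) \<le> K) U" using K by eventually_elim (use ks in auto)
      qed (use holh nzh ksD rad in auto)
      then show ?thesis using ks by blast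
    qed
  qed
qed

text \<open>The first coefficient is large on a whole circle; the second, being large at some point
  inside, is large somewhere on that circle by the maximum principle.\<close>

lemma common_lower_bound:
  assumes ks: "set ks \<subseteq> J" "i \<in> J" and nt: "\<not> tiny (cball 0 R') (cf ks 0)" "\<not> tiny (cball 0 R') (cf ks i)"
    and \<epsilon>: "\<epsilon> > 0"
  shows "eventually (\<lambda>n. \<exists>z0\<in>cball 0 R4. cmod (cf ks 0 n z0 * cf ks i n z0) \<ge> exp (- (\<epsilon> * T n))) U"
proof -
  have \<epsilon>2: "\<epsilon> / 2 > 0" using \<epsilon> by simp
  have J0: "0 \<in> J" by simp
  have e1: "eventually (\<lambda>n. \<exists>\<rho>. R5 \<le> \<rho> \<and> \<rho> \<le> R4 \<and> (\<forall>z\<in>sphere 0 \<rho>. cmod (cf ks 0 n z) \<ge> exp (- (\<epsilon> / 2) * T n))) U"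
    by (rule not_tiny_circle[OF unit_family.hol_C[OF fam ks(1) J0] coeff_subexp[OF ks(1) J0] nt(1)])
      (use rad \<epsilon> in auto)
  have "\<not> eventually (\<lambda>n. \<forall>z\<in>cball 0 R'. cmod (cf ks i n z) \<le> exp (- (\<epsilon> / 2) * T n)) U"
    using nt(2) \<epsilon>2 unfolding tiny_def by blast
  then have "eventually (\<lambda>n. \<not> (\<forall>z\<in>cball 0 R'. cmod (cf ks i n z) \<le> exp (- (\<epsilon> / 2) * T n))) U"
    by (simp only: not_eventually_iff)
  with e1 show ?thesis
  proof eventually_elim
    case (elim n)
    obtain \<rho> where \<rho>: "R5 \<le> \<rho>" "\<rho> \<le> R4" "\<forall>z\<in>sphere 0 \<rho>. cmod (cf ks 0 n z) \<ge> exp (- (\<epsilon> / 2) * T n)"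
      using elim(1) by blast
    obtain z where z: "z \<in> cball 0 R'" "\<not> cmod (cf ks i n z) \<le> exp (- (\<epsilon> / 2) * T n)" using elim(2) by blast
    have "\<exists>z0\<in>sphere 0 \<rho>. \<not> cmod (cf ks i n z0) \<le> exp (- (\<epsilon> / 2) * T n)"
    proof (rule ccontr)
      assume "\<not> ?thesis"
      then have b: "cmod (cf ks i n u) \<le> exp (- (\<epsilon> / 2) * T n)" if "u \<in> sphere 0 \<rho>" for u using that by blast
      have "cmod (cf ks i n z) \<le> exp (- (\<epsilon> / 2) * T n)"
        by (rule norm_le_on_cball_of_sphere[OF unit_family.hol_C[OF fam ks] _ _ b, of \<rho>]) (use \<rho> rad z in auto)
      then show False using z by simp
    qed
    then obtain z0 where z0: "z0 \<in> sphere 0 \<rho>" "cmod (cf ks i n z0) \<ge> exp (- (\<epsilon> / 2) * T n)" by force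
    have "exp (- (\<epsilon> * T n)) = exp (- (\<epsilon> / 2) * T n) * exp (- (\<epsilon> / 2) * T n)" by (simp flip: exp_add)
    also have "\<dots> \<le> cmod (cf ks 0 n z0) * cmod (cf ks i n z0)" using z0 \<rho> by (intro mult_mono) auto
    finally show ?case using z0 \<rho> by (intro bexI[of _ z0]) (auto simp: norm_mult)
  qed
qed

text \<open>For each \<open>i\<close>, all terms except \<open>0\<close> and \<open>i\<close> can be
  eliminated so that the final coefficients are not small, and the second main theorem bounds every
  logarithm on a disc by the logarithm of the size on a larger one. With
  \<open>B = \<epsilon> * T\<close> and \<open>T\<close> the size at \<open>R2\<close>, this is the
  self-bound excluded by the growth argument.\<close>

lemma nontiny_contradiction:
  assumes nt: "\<And>i. i \<in> Q \<Longrightarrow> set (ks i) = Q - {i} \<and> distinct (ks i) \<and>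
      \<not> tiny (cball 0 R') (cf (ks i) 0) \<and> \<not> tiny (cball 0 R') (cf (ks i) i)"
  shows False
proof -
  define q where "q = card Q"
  define CC where "CC = (168 * 4 ^ q * (q + 4) ^ 3 * max 1 Ca :: real)"
  have CC: "CC \<ge> 168"
  proof -
    have p: "1 \<le> (4::real) ^ q" "1 \<le> real (q + 4) ^ 3" by (rule one_le_power, simp)+
    have "(168::real) * 1 * 1 * 1 \<le> 168 * 4 ^ q * real (q + 4) ^ 3 * max 1 Ca"
      by (intro mult_mono p mult_nonneg_nonneg) auto
    then show ?thesis by (simp add: CC_def)
  qed
  \<comment> \<open>The bound \<open>X\<close> for each term becomes
    \<open>1 + q * X \<le> (q + 1) * X\<close> for the size.\<close>
  define C' where "C' = (q + 1) * CC"
  have C'CC: "C' \<ge> CC" using CC by (simp add: C'_def algebra_simps)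
  then have C'1: "C' \<ge> 1" using CC by simp
  have R21: "R2 < R1" "R1 - R2 \<le> 1" using rad by auto
  obtain \<epsilon> M0 where \<epsilon>: "\<epsilon> > 0" and contra:
    "\<And>m B. m R2 \<ge> M0 \<Longrightarrow> B \<le> \<epsilon> * m R2 \<Longrightarrow>
      (\<And>r. R2 \<le> r \<Longrightarrow> r \<le> R1 \<Longrightarrow> 1 \<le> m r \<and> m r \<le> m R1) \<Longrightarrow>
      (\<And>r \<delta>. R2 \<le> r \<Longrightarrow> 0 < \<delta> \<Longrightarrow> r + \<delta> \<le> R1 \<Longrightarrow> m r \<le> C' / \<delta> ^ 3 * (B + ln (C' * m (r + \<delta>) / \<delta>))) \<Longrightarrow> False"
    using logarithmic_self_bound_contradiction[OF C'1 R21] by metis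
  have "eventually (\<lambda>n. \<forall>i\<in>Q. \<exists>z0\<in>cball 0 R4. cmod (cf (ks i) 0 n z0 * cf (ks i) i n z0) \<ge> exp (- (\<epsilon> * T n))) U"
  proof (subst eventually_ball_finite_distrib[OF Q(1)], intro ballI)
    fix i assume i: "i \<in> Q"
    show "eventually (\<lambda>n. \<exists>z0\<in>cball 0 R4. cmod (cf (ks i) 0 n z0 * cf (ks i) i n z0) \<ge> exp (- (\<epsilon> * T n))) U"
      by (rule common_lower_bound[OF _ _ _ _ \<epsilon>]) (use nt[OF i] i in auto)
  qed
  moreover have "eventually (\<lambda>n. \<kappa> n \<ge> 1) U" using \<kappa> by (simp add: filterlim_at_top)
  ultimately have "eventually (\<lambda>n. False) U" using M err \<alpha>_bound T_ge[of M0] T_ge[of 0]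
  proof eventually_elim
    case (elim n)
    define m where "m r = log_size (h n) Q r" for r
    interpret unit_family "H n" "\<alpha> n" J by (rule fam)
    show ?case
    proof (rule contra[of m "\<epsilon> * T n"])
      show "M0 \<le> m R2" using elim by (simp add: m_def T_def)
      show "\<epsilon> * T n \<le> \<epsilon> * m R2" by (simp add: m_def T_def)
      show "1 \<le> m r \<and> m r \<le> m R1" if "R2 \<le> r" "r \<le> R1" for r
        using that rad size_facts(1)[of r n] size_facts(4)[of R1 r n] by (auto simp: m_def)
      fix r \<delta> assume r: "R2 \<le> r" "0 < \<delta>" "r + \<delta> \<le> R1"
      define X where "X = CC / \<delta> ^ 3 * (\<epsilon> * T n + ln (CC * m (r + \<delta>) / \<delta>))"
      have m1: "1 \<le> m (r + \<delta>)" unfolding m_def using r rad by (intro size_facts) auto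
      have \<delta>1: "\<delta> \<le> 1" using r rad by simp
      have sub: "ball 0 (r + \<delta>) \<subseteq> cball (0::complex) R" using r rad by auto
      have hb: "\<bar>ln (cmod (h n i z))\<bar> \<le> X" if i: "i \<in> Q" and z: "z \<in> cball 0 r" for i z
      proof -
        obtain z0 where z0: "z0 \<in> cball 0 R4" "cmod (cf (ks i) 0 n z0 * cf (ks i) i n z0) \<ge> exp (- (\<epsilon> * T n))"
          using elim(1) i by blast
        have i0: "i \<noteq> 0" using i Q(2) by metis
        have len: "length (ks i) < q"
        proof -
          have "length (ks i) = card (Q - {i})" using nt[OF i] by (metis distinct_card)
          then show ?thesis using card_Diff1_less[OF Q(1) i] by (simp add: q_def)
        qed
        have "\<bar>ln (cmod (H n i z))\<bar> \<le> (168 * 4 ^ q * (q + 4) ^ 3 * max 1 Ca) / \<delta> ^ 3 *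
            (\<epsilon> * T n + ln ((168 * 4 ^ q * (q + 4) ^ 3 * max 1 Ca) * m (r + \<delta>) / \<delta>))"
        \<comment> \<open>\<open>M' = M n\<close> is admissible as soon as
          \<open>\<kappa> n \<ge> 1\<close>; the size \<open>m (r + \<delta>)\<close> enters only
          through a logarithm.\<close>
        proof (rule second_main_theorem[where M' = "M n", OF _ _ _ i0 _ len _ _ _ _ r(2) _ m1 _ _ _ _ z0(2) _ z])
          show "set (ks i) = J - {0, i}" using nt[OF i] Q i by auto
          show "H n 0 z = 1" for z by (simp add: H_0)
          show "cmod (\<alpha> n j z) \<le> max 1 Ca" if "j \<in> J" "z \<in> ball 0 (r + \<delta>)" for j z
            using elim(6) that sub by blast
          show "\<bar>ln (cmod (H n j z))\<bar> \<le> m (r + \<delta>)" if j: "j \<in> J" and z: "z \<in> ball 0 (r + \<delta>)" for j z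
          proof (cases "j = 0")
            case True
            then show ?thesis using m1 by (simp add: H_0)
          next
            case False
            then show ?thesis using j z r rad unfolding m_def by (simp add: H_Q size_facts(2))
          qed
          show "\<bar>ln (cmod (H n i z))\<bar> \<le> M n" if "z \<in> ball 0 (r + \<delta>)" for z
            using elim(4) that sub i by (simp add: H_Q subset_eq)
          show "cmod (\<Sum>j\<in>J. \<alpha> n j z * H n j z) \<le> exp (- M n)" if "z \<in> ball 0 (r + \<delta>)" for z
          proof -
            have "1 * M n \<le> \<kappa> n * M n" using elim by (intro mult_right_mono) auto
            then have "exp (- \<kappa> n * M n) \<le> exp (- M n)" by simp
            moreover have "cmod (a n z + (\<Sum>j\<in>Q. h n j z)) \<le> exp (- \<kappa> n * M n)" using elim(5) that sub by blast
            ultimately show ?thesis unfolding sum_terms[OF order_refl] by linarith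
          qed
          show "z0 \<in> cball 0 r" using z0 r rad by auto
        qed (use Q i r rad elim \<epsilon> in auto)
        then show ?thesis using i by (simp add: X_def CC_def H_Q)
      qed
      have lnp: "1 \<le> ln (CC * m (r + \<delta>) / \<delta>)"
      proof -
        have "168 * 1 \<le> CC * m (r + \<delta>)" using CC m1 by (intro mult_mono) auto
        then have "168 / 1 \<le> CC * m (r + \<delta>) / \<delta>" using r \<delta>1 by (intro frac_le) auto
        then have "exp 1 \<le> CC * m (r + \<delta>) / \<delta>" using exp_le by linarith
        then show ?thesis by (subst ln_ge_iff) (auto intro: less_le_trans[OF exp_gt_zero])
      qed
      have \<epsilon>T: "0 \<le> \<epsilon> * T n" using \<epsilon> elim by simp
      have c1: "1 \<le> CC / \<delta> ^ 3"
      proof -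
        have "\<delta> ^ 3 \<le> 1" using r \<delta>1 by (intro power_le_one) auto
        then show ?thesis using CC r by (simp add: pos_le_divide_eq)
      qed
      have X1: "1 \<le> X"
      proof -
        have "1 * 1 \<le> CC / \<delta> ^ 3 * (\<epsilon> * T n + ln (CC * m (r + \<delta>) / \<delta>))"
          using c1 lnp \<epsilon>T by (intro mult_mono) auto
        then show ?thesis by (simp add: X_def)
      qed
      have "m r \<le> 1 + q * X" unfolding m_def q_def using r rad by (intro size_facts(3) hb) auto
      also have "\<dots> \<le> (q + 1) * X" using X1 by (simp add: algebra_simps)
      also have "\<dots> = C' / \<delta> ^ 3 * (\<epsilon> * T n + ln (CC * m (r + \<delta>) / \<delta>))" by (simp add: X_def C'_def)
      also have "\<dots> \<le> C' / \<delta> ^ 3 * (\<epsilon> * T n + ln (C' * m (r + \<delta>) / \<delta>))"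
      proof (rule mult_left_mono)
        have "CC * m (r + \<delta>) / \<delta> \<le> C' * m (r + \<delta>) / \<delta>"
          using C'CC m1 r by (intro divide_right_mono mult_right_mono) auto
        then show "\<epsilon> * T n + ln (CC * m (r + \<delta>) / \<delta>) \<le> \<epsilon> * T n + ln (C' * m (r + \<delta>) / \<delta>)"
          using CC m1 r by (intro add_left_mono ln_mono) auto
      qed (use C'1 r in auto)
      finally show "m r \<le> C' / \<delta> ^ 3 * (\<epsilon> * T n + ln (C' * m (r + \<delta>) / \<delta>))" .
    qed
  qed
  then show False using nontrivial by (simp add: eventually_False)
qed

text \<open>If no unit is comparable to \<open>1\<close>, the size at \<open>R3\<close> is of
  smaller order than \<open>T\<close>; hence no coefficient needed below is tiny, and the growth
  argument gives a contradiction.\<close>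

lemma comparable_index: "Q \<noteq> {} \<Longrightarrow> comparable"
proof (rule ccontr)
  assume ne: "Q \<noteq> {}" and nc: "\<not> comparable"
  have sg: "eventually (\<lambda>n. log_size (h n) Q R3 \<le> c * T n) U" if c: "c > 0" for c
  proof -
    have "\<not> eventually (\<lambda>n. c * T n \<le> log_size (h n) Q R3) U" using doubling_case[OF c] nc by blast
    then have "eventually (\<lambda>n. \<not> c * T n \<le> log_size (h n) Q R3) U" by (simp only: not_eventually_iff)
    then show ?thesis by eventually_elim simp
  qed
  \<comment> \<open>Induction from the tail of the list: when the coefficient of the head is tested,
    those of the earlier pivots are already known not to be tiny, as \<open>tiny_coeff_case\<close>
    requires.\<close>
  have piv: "\<not> tiny (cball 0 R') (cf vs k)" if "set ks \<subseteq> Q" "distinct ks" "ks = us @ k # vs" for ks us k vs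
    using that
  proof (induction ks arbitrary: us k vs)
    case (Cons k' ks)
    have IH: "\<not> tiny (cball 0 R') (cf vs k)" if "ks = us @ k # vs" for us k vs
      using Cons that by auto
    show ?case
    proof (cases us)
      case Nil
      then have k: "k' = k" "ks = vs" using Cons.prems by auto
      show ?thesis
      proof
        assume "tiny (cball 0 R') (cf vs k)"
        then have comparable
          using tiny_coeff_case[OF sg, of ks k] IH Cons.prems k Q by auto
        then show False using nc by blast
      qed
    next
      case (Cons u us')
      then show ?thesis using IH Cons.prems by auto
    qed
  qed simp
  define ks where "ks i = (SOME l. set l = Q - {i} \<and> distinct l)" for i
  have ks: "set (ks i) = Q - {i} \<and> distinct (ks i)" for i
    unfolding ks_def by (rule someI_ex[OF finite_distinct_list]) (simp add: Q)
  have nt: "\<not> tiny (cball 0 R') (cf (ks i) j)" if "i \<in> Q" "j = 0 \<or> j = i" for i j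
  proof
    assume ti: "tiny (cball 0 R') (cf (ks i) j)"
    have comparable
    proof (rule tiny_coeff_case[OF sg _ _ _ _ _ _ ti])
      show "\<not> tiny (cball 0 R') (cf vs k)" if "ks i = us @ k # vs" for us k vs
        using piv[OF _ _ that] ks[of i] by auto
    qed (use ks[of i] that Q in auto)
    then show False using nc by blast
  qed
  show False by (rule nontiny_contradiction[of ks]) (use ks nt in auto)
qed

end

text \<open>If the size at an intermediate radius stays bounded along \<open>U\<close>, every term
  is comparable to \<open>1\<close>. Otherwise, \<open>U\<close> being an ultrafilter, it tends to
  infinity and can serve as the scale of the induction step.\<close>

theorem (in ultrafilter) near_relation_imp_comparable:
  assumes "finite Q" "0 \<notin> Q" "near_relation Q h a zz w s R" "0 \<le> s" "cmod w \<le> s" "s < R'" "R' < R" "R < 1"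
  shows "\<exists>i\<in>Q. \<exists>B. eventually (\<lambda>n. \<forall>z\<in>cball 0 R'. \<bar>ln (cmod (h n i z))\<bar> \<le> B) U"
  using assms
proof (induction Q arbitrary: h a R R' rule: finite_psubset_induct)
  case (psubset Q)
  note nr = psubset.prems(2)[unfolded near_relation_def]
  obtain Ca where Ca: "eventually (\<lambda>n. \<forall>z\<in>cball 0 R. cmod (a n z) \<le> Ca) U" using nr by blast
  obtain ca where ca: "ca > 0" "eventually (\<lambda>n. cmod (a n w) \<ge> ca) U" using nr by blast
  obtain K where K: "eventually (\<lambda>n. \<forall>j\<in>Q. cmod (h n j (zz n)) \<le> K) U" using nr by blast
  obtain M \<kappa> where M\<kappa>: "filterlim \<kappa> at_top U" "eventually (\<lambda>n. 1 \<le> M n) U"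
      "eventually (\<lambda>n. \<forall>j\<in>Q. \<forall>z\<in>cball 0 R. \<bar>ln (cmod (h n j z))\<bar> \<le> M n) U"
      "eventually (\<lambda>n. \<forall>z\<in>cball 0 R. cmod (a n z + (\<Sum>j\<in>Q. h n j z)) \<le> exp (- \<kappa> n * M n)) U" using nr by blast
  \<comment> \<open>Without terms, \<open>a\<close> would be bounded at \<open>w\<close> by the
    error alone, against its lower bound there.\<close>
  have ne: "Q \<noteq> {}"
  proof
    assume Q: "Q = {}"
    have "eventually (\<lambda>n. \<kappa> n \<ge> 1 + \<bar>ln ca\<bar>) U" using M\<kappa>(1) by (simp add: filterlim_at_top)
    with M\<kappa>(2,4) ca(2) have "eventually (\<lambda>n. False) U"
    proof eventually_elim
      case (elim n)
      have "(1 + \<bar>ln ca\<bar>) * 1 \<le> \<kappa> n * M n" using elim by (intro mult_mono) auto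
      then have "- \<kappa> n * M n < ln ca" by simp
      then have "exp (- \<kappa> n * M n) < ca" using ca(1) by (metis exp_less_cancel_iff exp_ln)
      moreover have "cmod (a n w) \<le> exp (- \<kappa> n * M n)" using elim(2) psubset.prems Q by auto
      ultimately show False using elim by simp
    qed
    then show False using nontrivial by (simp add: eventually_False)
  qed
  define d where "d = (R - R') / 6"
  have d: "d > 0" using psubset.prems by (simp add: d_def)
  have "6 * d = R - R'" unfolding d_def by simp
  then have R: "R = R' + 6 * d" by linarith
  define T where "T n = log_size (h n) Q (R' + 4 * d)" for n
  have hol: "\<And>n j. j \<in> Q \<Longrightarrow> h n j holomorphic_on unit_disc" "\<And>n j z. j \<in> Q \<Longrightarrow> z \<in> unit_disc \<Longrightarrow> h n j z \<noteq> 0"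
    using nr by blast+
  show ?case
  proof (cases "\<exists>B. eventually (\<lambda>n. T n \<le> B) U")
    case True
    then obtain B where B: "eventually (\<lambda>n. T n \<le> B) U" by blast
    obtain i where i: "i \<in> Q" using ne by blast
    have "eventually (\<lambda>n. \<forall>z\<in>cball 0 R'. \<bar>ln (cmod (h n i z))\<bar> \<le> B) U"
      using B
    proof eventually_elim
      case (elim n)
      show ?case
      proof
        fix z :: complex assume z: "z \<in> cball 0 R'"
        have "\<bar>ln (cmod (h n i z))\<bar> \<le> T n" unfolding T_def
          by (rule log_size_ge[OF psubset.hyps hol]) (use i z d psubset.prems R in auto)
        then show "\<bar>ln (cmod (h n i z))\<bar> \<le> B" using elim by simp
      qed
    qed
    then show ?thesis using i by blast
  next
    case False
    have "filterlim T at_top U"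
      unfolding filterlim_at_top
    proof
      fix Z
      have "\<not> eventually (\<lambda>n. T n \<le> Z) U" using False by blast
      then have "eventually (\<lambda>n. \<not> T n \<le> Z) U" by (simp only: not_eventually_iff)
      then show "eventually (\<lambda>n. Z \<le> T n) U" by eventually_elim simp
    qed
    then interpret scale U T by unfold_locales
    interpret reduction U T Q h a zz w s R' "R' + d" "R' + 2 * d" "R' + 3 * d" "R' + 4 * d" "R' + 5 * d" R Ca ca K M \<kappa>
    proof unfold_locales
      show "\<exists>i\<in>Q''. \<exists>B. eventually (\<lambda>n. \<forall>z\<in>cball 0 R2. \<bar>ln (cmod (h' n i z))\<bar> \<le> B) U"
        if "Q'' \<subset> Q" "near_relation Q'' h' a' zz w s R1" "s < R2" "R2 < R1" "R1 < 1" for Q'' h' a' R1 R2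
        using psubset.IH[OF that(1) _ that(2) _ _ that(3-5)] psubset.prems that(1) by blast
      show "T n = log_size (h n) Q (R' + 4 * d)" for n by (rule T_def)
      show "0 \<le> s" "s < R'" "R < 1" by (rule psubset.prems)+
      show "R' < R' + d" "R' + d < R' + 2 * d" "R' + 2 * d < R' + 3 * d" "R' + 3 * d < R' + 4 * d"
        "R' + 4 * d < R' + 5 * d" "R' + 5 * d < R" using d R by auto
      show "finite Q" "0 \<notin> Q" by (rule psubset)+
      show "a n holomorphic_on unit_disc" for n using nr by blast
      show "eventually (\<lambda>n. zz n \<in> cball 0 s) U" using nr by blast
    qed (fact Ca ca K M\<kappa> | rule hol; assumption)+
    show ?thesis by (rule comparable_index[OF ne])
  qed
qed

section \<open>Null classes\<close>

text \<open>The relation is exact here, so any \<open>\<kappa>\<close> tending to infinity along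
  \<open>U\<close> turns it into a \<open>near_relation\<close>; the locale fixes one such
  function.\<close>

locale unit_tuples = ultrafilter U for U :: "(nat \<Rightarrow> complex \<Rightarrow> complex) filter" +
  fixes p :: nat and \<kappa> :: "(nat \<Rightarrow> complex \<Rightarrow> complex) \<Rightarrow> real"
  assumes tuples: "eventually (\<lambda>f. f \<in> nonvanishing_tuples p) U"
    and sum_zero: "eventually (\<lambda>f. \<forall>z\<in>unit_disc. (\<Sum>i=1..p. f i z) = 0) U"
    and \<kappa>: "filterlim \<kappa> at_top U" and p: "p \<ge> 1"
begin

text \<open>The second branch makes \<open>quot i j f\<close> a unit for every \<open>f\<close>, not only for almost every one.\<close>

definition quot :: "nat \<Rightarrow> nat \<Rightarrow> (nat \<Rightarrow> complex \<Rightarrow> complex) \<Rightarrow> complex \<Rightarrow> complex" where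
  "quot i j f = (if f \<in> nonvanishing_tuples p then (\<lambda>z. f i z / f j z) else (\<lambda>z. 1))"

lemma unit: "f \<in> nonvanishing_tuples p \<Longrightarrow> i \<in> {1..p} \<Longrightarrow> f i holomorphic_on unit_disc"
  "f \<in> nonvanishing_tuples p \<Longrightarrow> i \<in> {1..p} \<Longrightarrow> z \<in> unit_disc \<Longrightarrow> f i z \<noteq> 0"
  unfolding nonvanishing_tuples_def nonvanishing_holomorphic_def by (auto simp: PiE_iff)

lemma quot_hol: "i \<in> {1..p} \<Longrightarrow> j \<in> {1..p} \<Longrightarrow> quot i j f holomorphic_on unit_disc"
  using unit by (auto simp: quot_def intro!: holomorphic_intros)

lemma quot_nz: "i \<in> {1..p} \<Longrightarrow> j \<in> {1..p} \<Longrightarrow> z \<in> unit_disc \<Longrightarrow> quot i j f z \<noteq> 0"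
  using unit(2)[of f i z] unit(2)[of f j z] by (simp add: quot_def)

lemma quot_eq: "eventually (\<lambda>f. \<forall>i j. quot i j f = (\<lambda>z. f i z / f j z)) U"
  using tuples by eventually_elim (simp add: quot_def)

definition sim :: "nat \<Rightarrow> nat \<Rightarrow> bool" where
  "sim i j \<longleftrightarrow> (\<forall>r<1. \<exists>B. eventually (\<lambda>f. \<forall>z\<in>cball 0 r. \<bar>ln (cmod (quot i j f z))\<bar> \<le> B) U)"

lemma quot_mult:
  assumes "i \<in> {1..p}" "j \<in> {1..p}" "k \<in> {1..p}" "z \<in> unit_disc"
  shows "quot i k f z = quot i j f z * quot j k f z"
  using unit(2)[of f j z] assms by (simp add: quot_def)

lemma sim_refl: "i \<in> {1..p} \<Longrightarrow> sim i i"
  unfolding sim_def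
proof (intro allI impI)
  fix r :: real assume i: "i \<in> {1..p}" and r: "r < 1"
  have "quot i i f z = 1" if "z \<in> cball 0 r" for f z
    using unit(2)[of f i z] i that r by (auto simp: quot_def)
  then show "\<exists>B. eventually (\<lambda>f. \<forall>z\<in>cball 0 r. \<bar>ln (cmod (quot i i f z))\<bar> \<le> B) U"
    by (intro exI[of _ 0] always_eventually) auto
qed

lemma sim_sym: "sim i j \<Longrightarrow> sim j i"
  unfolding sim_def
proof (intro allI impI)
  fix r :: real assume s: "\<forall>r<1. \<exists>B. eventually (\<lambda>f. \<forall>z\<in>cball 0 r. \<bar>ln (cmod (quot i j f z))\<bar> \<le> B) U" and r: "r < 1"
  have "ln (cmod (quot j i f z)) = - ln (cmod (quot i j f z))" for f z
    by (auto simp: quot_def norm_divide ln_div)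
  then show "\<exists>B. eventually (\<lambda>f. \<forall>z\<in>cball 0 r. \<bar>ln (cmod (quot j i f z))\<bar> \<le> B) U"
    using s r by (auto simp: abs_minus_cancel)
qed

lemma sim_trans:
  assumes "i \<in> {1..p}" "j \<in> {1..p}" "k \<in> {1..p}" "sim i j" "sim j k" shows "sim i k"
  unfolding sim_def
proof (intro allI impI)
  fix r :: real assume r: "r < 1"
  obtain B1 B2 where B: "eventually (\<lambda>f. \<forall>z\<in>cball 0 r. \<bar>ln (cmod (quot i j f z))\<bar> \<le> B1) U"
    "eventually (\<lambda>f. \<forall>z\<in>cball 0 r. \<bar>ln (cmod (quot j k f z))\<bar> \<le> B2) U"
    using assms(4,5) r unfolding sim_def by blast
  from B have "eventually (\<lambda>f. \<forall>z\<in>cball 0 r. \<bar>ln (cmod (quot i k f z))\<bar> \<le> B1 + B2) U"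
  proof eventually_elim
    case (elim f)
    show ?case
    proof
      fix z :: complex assume z: "z \<in> cball 0 r"
      then have zU: "z \<in> unit_disc" using r by auto
      have "ln (cmod (quot i k f z)) = ln (cmod (quot i j f z)) + ln (cmod (quot j k f z))"
        using quot_mult[OF assms(1-3) zU, of f] quot_nz[OF assms(1,2) zU, of f] quot_nz[OF assms(2,3) zU, of f]
        by (simp add: norm_mult ln_mult)
      moreover have "\<bar>ln (cmod (quot i j f z))\<bar> \<le> B1" "\<bar>ln (cmod (quot j k f z))\<bar> \<le> B2" using elim z by blast+
      ultimately show "\<bar>ln (cmod (quot i k f z))\<bar> \<le> B1 + B2" by linarith
    qed
  qed
  then show "\<exists>B. eventually (\<lambda>f. \<forall>z\<in>cball 0 r. \<bar>ln (cmod (quot i k f z))\<bar> \<le> B) U" by blast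
qed

definition lim_quot :: "nat \<Rightarrow> nat \<Rightarrow> complex \<Rightarrow> complex" where
  "lim_quot i j = (SOME g. g holomorphic_on unit_disc \<and> (\<forall>r<1. uniform_limit (cball 0 r) (quot i j) g U))"

text \<open>Montel gives the limit, and the two-sided bound in \<open>sim\<close> keeps it away from
  zero.\<close>

lemma lim_quot:
  assumes ij: "i \<in> {1..p}" "j \<in> {1..p}" "sim i j"
  shows "lim_quot i j holomorphic_on unit_disc" "\<And>r. r < 1 \<Longrightarrow> uniform_limit (cball 0 r) (quot i j) (lim_quot i j) U"
    "\<And>z. z \<in> unit_disc \<Longrightarrow> ((\<lambda>f. quot i j f z) \<longlongrightarrow> lim_quot i j z) U"
    "\<And>z. z \<in> unit_disc \<Longrightarrow> lim_quot i j z \<noteq> 0"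
proof -
  have bd: "\<exists>B. eventually (\<lambda>f. \<forall>z\<in>cball 0 r. exp (- B) \<le> cmod (quot i j f z) \<and> cmod (quot i j f z) \<le> exp B) U" if r: "r < 1" for r
  proof -
    obtain B where "eventually (\<lambda>f. \<forall>z\<in>cball 0 r. \<bar>ln (cmod (quot i j f z))\<bar> \<le> B) U"
      using ij(3) r unfolding sim_def by blast
    then have "eventually (\<lambda>f. \<forall>z\<in>cball 0 r. exp (- B) \<le> cmod (quot i j f z) \<and> cmod (quot i j f z) \<le> exp B) U"
    proof eventually_elim
      case (elim f)
      show ?case
        by (intro ballI conjI norm_le_exp_abs_ln quot_nz ij(1,2)) (use elim r in auto)
    qed
    then show ?thesis by blast
  qed
  have bd': "\<exists>B. eventually (\<lambda>f. \<forall>z\<in>cball 0 r. cmod (quot i j f z) \<le> B) U" if "0 < r" "r < 1" for r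
  proof -
    obtain B where "eventually (\<lambda>f. \<forall>z\<in>cball 0 r. exp (- B) \<le> cmod (quot i j f z) \<and> cmod (quot i j f z) \<le> exp B) U"
      using bd \<open>r < 1\<close> by blast
    then show ?thesis by (intro exI[of _ "exp B"]) (auto elim: eventually_mono)
  qed
  have "\<exists>g. g holomorphic_on unit_disc \<and> (\<forall>r<1. uniform_limit (cball 0 r) (quot i j) g U)"
  proof (rule montel[of "quot i j" 1, OF quot_hol[OF ij(1,2)]])
    show "\<exists>B. eventually (\<lambda>f. \<forall>z\<in>cball 0 r. cmod (quot i j f z) \<le> B) U" if "0 < r" "r < 1" for r
      by (rule bd'[OF that])
  qed blast
  from someI_ex[OF this] show 1: "lim_quot i j holomorphic_on unit_disc"
    "\<And>r. r < 1 \<Longrightarrow> uniform_limit (cball 0 r) (quot i j) (lim_quot i j) U"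
    unfolding lim_quot_def by blast+
  show 2: "((\<lambda>f. quot i j f z) \<longlongrightarrow> lim_quot i j z) U" if "z \<in> unit_disc" for z
    by (rule tendsto_uniform_limitI[OF 1(2)[of "cmod z"]]) (use that in auto)
  show "lim_quot i j z \<noteq> 0" if z: "z \<in> unit_disc" for z
  proof -
    obtain B where B: "eventually (\<lambda>f. \<forall>z\<in>cball 0 (cmod z). exp (- B) \<le> cmod (quot i j f z) \<and> cmod (quot i j f z) \<le> exp B) U"
      using bd[of "cmod z"] z by auto
    have "((\<lambda>f. cmod (quot i j f z)) \<longlongrightarrow> cmod (lim_quot i j z)) U" by (intro tendsto_norm 2 z)
    moreover have "eventually (\<lambda>f. exp (- B) \<le> cmod (quot i j f z)) U" using B by eventually_elim auto
    ultimately have "exp (- B) \<le> cmod (lim_quot i j z)" using tendsto_lowerbound nontrivial by blast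
    then show ?thesis using exp_gt_zero[of "- B"] by auto
  qed
qed

definition cls :: "nat \<Rightarrow> nat set" where "cls i = {j \<in> {1..p}. sim j i}"

definition null :: "nat \<Rightarrow> bool" where "null i \<longleftrightarrow> (\<forall>z\<in>unit_disc. (\<Sum>k\<in>cls i. lim_quot k i z) = 0)"

lemma cls_eq: "i \<in> {1..p} \<Longrightarrow> j \<in> cls i \<Longrightarrow> cls j = cls i"
  unfolding cls_def using sim_trans sim_sym by blast

text \<open>Changing the denominator from \<open>i\<close> to \<open>j\<close> multiplies all limits
  by the common factor \<open>lim_quot i j\<close>.\<close>

lemma null_cls:
  assumes i: "i \<in> {1..p}" and j: "j \<in> cls i" and n: "null i" shows "null j"
  unfolding null_def
proof
  fix z :: complex assume z: "z \<in> unit_disc"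
  have jp: "j \<in> {1..p}" "sim j i" using j by (auto simp: cls_def)
  have "lim_quot k j z = lim_quot k i z * lim_quot i j z" if k: "k \<in> cls i" for k
  proof -
    have kp: "k \<in> {1..p}" "sim k i" using k by (auto simp: cls_def)
    have kj: "sim k j" using sim_trans[OF kp(1) i jp(1) kp(2) sim_sym[OF jp(2)]] .
    have "((\<lambda>f. quot k i f z * quot i j f z) \<longlongrightarrow> lim_quot k i z * lim_quot i j z) U"
      by (intro tendsto_mult lim_quot(3) kp i jp z sim_sym)
    then have "((\<lambda>f. quot k j f z) \<longlongrightarrow> lim_quot k i z * lim_quot i j z) U"
      using quot_mult[OF kp(1) i jp(1) z] by simp
    then show ?thesis using tendsto_unique[OF nontrivial lim_quot(3)[OF kp(1) jp(1) kj z]] by simp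
  qed
  then have "(\<Sum>k\<in>cls i. lim_quot k j z) = (\<Sum>k\<in>cls i. lim_quot k i z) * lim_quot i j z"
    by (simp add: sum_distrib_right)
  then show "(\<Sum>k\<in>cls j. lim_quot k j z) = 0" using n z cls_eq[OF i j] by (simp add: null_def)
qed

text \<open>If \<open>f k\<close> is comparable to the largest component at some point, divide the relation by \<open>f k\<close>. Were the class
  sum not null, the remaining quotients would form a relation to which
  the comparison theorem applies, and the class of \<open>k\<close> would not be complete.\<close>

lemma null_of_dominant:
  assumes k: "k \<in> {1..p}" and s: "0 < s" "s < 1" and zz: "eventually (\<lambda>f. zz f \<in> cball 0 s) U"
    and K: "eventually (\<lambda>f. \<forall>j\<in>{1..p}. cmod (f j (zz f)) \<le> K * cmod (f k (zz f))) U"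
  shows "null k"
proof (rule ccontr)
  assume "\<not> null k"
  then obtain w where w: "w \<in> unit_disc" "(\<Sum>j\<in>cls k. lim_quot j k w) \<noteq> 0" unfolding null_def by blast
  \<comment> \<open>The limit of \<open>a f w\<close>. Being nonzero, it provides the lower bound
    for \<open>a\<close> that the comparison theorem needs.\<close>
  define A where "A = (\<Sum>j\<in>cls k. lim_quot j k w)"
  define s' where "s' = max s (cmod w)"
  have s': "0 < s'" "s' < 1" "cmod w \<le> s'" "s \<le> s'" using s w by (auto simp: s'_def)
  define Q where "Q = {1..p} - cls k"
  have Q: "finite Q" "0 \<notin> Q" "Q \<subseteq> {1..p}" by (auto simp: Q_def)
  have fin: "finite (cls k)" by (simp add: cls_def)
  have clsD: "j \<in> {1..p}" "sim j k" if "j \<in> cls k" for j using that by (auto simp: cls_def)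
  have clsP: "cls k \<subseteq> {1..p}" by (auto simp: cls_def)
  define h where "h f j = quot j k f" for f j
  define a where "a f z = (\<Sum>j\<in>cls k. quot j k f z)" for f z
  have near: "near_relation Q h a zz w s' R" if R: "s' < R" "R < 1" for R
    unfolding near_relation_def
  proof (intro conjI)
    show "\<forall>f. \<forall>j\<in>Q. h f j holomorphic_on unit_disc \<and> (\<forall>z\<in>unit_disc. h f j z \<noteq> 0)"
      using quot_hol quot_nz k Q by (auto simp: h_def subset_eq)
    show "\<forall>f. a f holomorphic_on unit_disc"
      unfolding a_def using quot_hol clsD k by (intro allI holomorphic_intros) auto
    have "\<exists>B. eventually (\<lambda>f. \<forall>z\<in>cball 0 R. cmod (quot j k f z) \<le> B) U" if j: "j \<in> cls k" for j
    proof -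
      obtain B where "eventually (\<lambda>f. \<forall>z\<in>cball 0 R. \<bar>ln (cmod (quot j k f z))\<bar> \<le> B) U"
        using clsD(2)[OF j] R unfolding sim_def by blast
      then have "eventually (\<lambda>f. \<forall>z\<in>cball 0 R. cmod (quot j k f z) \<le> exp B) U"
      proof eventually_elim
        case (elim f)
        show ?case
          by (intro ballI norm_le_exp_abs_ln(2) quot_nz clsD[OF j] k) (use elim R in auto)
      qed
      then show ?thesis by blast
    qed
    then have "\<forall>j\<in>cls k. \<exists>B. eventually (\<lambda>f. \<forall>z\<in>cball 0 R. cmod (quot j k f z) \<le> B) U" by blast
    from bchoice[OF this] obtain B where
      B: "\<And>j. j \<in> cls k \<Longrightarrow> eventually (\<lambda>f. \<forall>z\<in>cball 0 R. cmod (quot j k f z) \<le> B j) U" by blast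
    then have "eventually (\<lambda>f. \<forall>j\<in>cls k. \<forall>z\<in>cball 0 R. cmod (quot j k f z) \<le> B j) U"
      using fin by (simp add: eventually_ball_finite)
    then have "eventually (\<lambda>f. \<forall>z\<in>cball 0 R. cmod (a f z) \<le> (\<Sum>j\<in>cls k. B j)) U"
      by eventually_elim (auto simp: a_def intro!: sum_norm_le)
    then show "\<exists>Ca. eventually (\<lambda>f. \<forall>z\<in>cball 0 R. cmod (a f z) \<le> Ca) U" by blast
    have "((\<lambda>f. a f w) \<longlongrightarrow> A) U"
      unfolding a_def A_def by (intro tendsto_sum lim_quot(3) clsD k w)
    then have "((\<lambda>f. cmod (a f w)) \<longlongrightarrow> cmod A) U" by (rule tendsto_norm)
    moreover have "cmod A / 2 < cmod A" using w by (simp add: A_def)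
    ultimately have "eventually (\<lambda>f. cmod A / 2 < cmod (a f w)) U" by (rule order_tendstoD)
    then have "eventually (\<lambda>f. cmod A / 2 \<le> cmod (a f w)) U" by eventually_elim simp
    moreover have "cmod A / 2 > 0" using w by (simp add: A_def)
    ultimately show "\<exists>ca>0. eventually (\<lambda>f. ca \<le> cmod (a f w)) U" by blast
    show "eventually (\<lambda>f. zz f \<in> cball 0 s') U" using zz by eventually_elim (use s' in auto)
    have "eventually (\<lambda>f. \<forall>j\<in>Q. cmod (h f j (zz f)) \<le> K) U" using K quot_eq zz tuples
    proof eventually_elim
      case (elim f)
      have "zz f \<in> unit_disc" using elim s by auto
      then have "cmod (f k (zz f)) > 0" using unit(2) elim k by simp
      then show ?case using elim Q by (auto simp: h_def norm_divide divide_le_eq)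
    qed
    then show "\<exists>K. eventually (\<lambda>f. \<forall>j\<in>Q. cmod (h f j (zz f)) \<le> K) U" by blast
    define M where "M f = log_size (h f) Q R" for f
    have hh: "h f j holomorphic_on unit_disc" "z \<in> unit_disc \<Longrightarrow> h f j z \<noteq> 0" if "j \<in> Q" for f j z
      using quot_hol quot_nz k Q that by (auto simp: h_def subset_eq)
    have R01: "0 \<le> R" "R < 1" using R s' by auto
    show "\<exists>M \<kappa>. filterlim \<kappa> at_top U \<and> eventually (\<lambda>n. 1 \<le> M n) U \<and>
      eventually (\<lambda>n. \<forall>j\<in>Q. \<forall>z\<in>cball 0 R. \<bar>ln (cmod (h n j z))\<bar> \<le> M n) U \<and>
      eventually (\<lambda>n. \<forall>z\<in>cball 0 R. cmod (a n z + (\<Sum>j\<in>Q. h n j z)) \<le> exp (- \<kappa> n * M n)) U"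
    proof (rule exI[of _ M], rule exI[of _ \<kappa>], intro conjI)
      show "eventually (\<lambda>f. 1 \<le> M f) U"
        unfolding M_def by (intro always_eventually allI log_size_ge_1[OF Q(1) hh R01])
      show "eventually (\<lambda>f. \<forall>j\<in>Q. \<forall>z\<in>cball 0 R. \<bar>ln (cmod (h f j z))\<bar> \<le> M f) U"
        unfolding M_def by (intro always_eventually allI ballI log_size_ge[OF Q(1) hh R01])
      show "eventually (\<lambda>f. \<forall>z\<in>cball 0 R. cmod (a f z + (\<Sum>j\<in>Q. h f j z)) \<le> exp (- \<kappa> f * M f)) U"
        using sum_zero quot_eq
      proof eventually_elim
        case (elim f)
        show ?case
        proof
          fix z :: complex assume "z \<in> cball 0 R"
          then have z: "z \<in> unit_disc" using R by auto
          have "a f z + (\<Sum>j\<in>Q. h f j z) = (\<Sum>j\<in>{1..p}. f j z / f k z)"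
            unfolding a_def h_def Q_def using elim(2) sum.subset_diff[OF clsP finite_atLeastAtMost, of "\<lambda>j. f j z / f k z"]
            by (simp add: add.commute)
          also have "\<dots> = 0" using elim(1) z by (simp flip: sum_divide_distrib)
          finally show "cmod (a f z + (\<Sum>j\<in>Q. h f j z)) \<le> exp (- \<kappa> f * M f)" by simp
        qed
      qed
    qed (rule \<kappa>)
  qed
  \<comment> \<open>Each index outside the class fails to be comparable on some disc. A radius
    \<open>R'\<close> beyond these finitely many radii excludes all of them at once, against the
    comparison theorem.\<close>
  have "\<forall>i\<in>Q. \<exists>r<1. \<not> (\<exists>B. eventually (\<lambda>f. \<forall>z\<in>cball 0 r. \<bar>ln (cmod (quot i k f z))\<bar> \<le> B) U)"
    by (auto simp: Q_def cls_def sim_def)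
  from bchoice[OF this] obtain r where r: "\<And>i. i \<in> Q \<Longrightarrow> r i < 1"
    "\<And>i. i \<in> Q \<Longrightarrow> \<not> (\<exists>B. eventually (\<lambda>f. \<forall>z\<in>cball 0 (r i). \<bar>ln (cmod (quot i k f z))\<bar> \<le> B) U)" by blast
  define m where "m = Max (insert s' (r ` Q))"
  have m: "s' \<le> m" "m < 1" "\<And>i. i \<in> Q \<Longrightarrow> r i \<le> m"
    using Q(1) s' r(1) by (auto simp: m_def)
  define R' where "R' = (m + 1) / 2"
  define R where "R = (R' + 1) / 2"
  have RR: "s' < R'" "m \<le> R'" "R' < R" "R < 1" using m by (auto simp: R'_def R_def)
  have "near_relation Q h a zz w s' R" by (rule near) (use RR in auto)
  from near_relation_imp_comparable[OF Q(1,2) this _ s'(3) RR(1,3,4)] s'(1)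
  obtain i B where i: "i \<in> Q" "eventually (\<lambda>f. \<forall>z\<in>cball 0 R'. \<bar>ln (cmod (h f i z))\<bar> \<le> B) U" by auto
  have "eventually (\<lambda>f. \<forall>z\<in>cball 0 (r i). \<bar>ln (cmod (quot i k f z))\<bar> \<le> B) U"
    using i(2) by eventually_elim (use m(3)[OF i(1)] RR in \<open>auto simp: h_def\<close>)
  then show False using r(2)[OF i(1)] by blast
qed

definition I_all :: "nat set" where "I_all = {i \<in> {1..p}. null i}"

text \<open>The index of the largest component at the origin, frozen along \<open>U\<close>, is
  dominant there with constant 1.\<close>

lemma I_all_nonempty: "I_all \<noteq> {}"
proof -
  have "eventually (\<lambda>f. \<exists>k\<in>{1..p}. \<forall>j\<in>{1..p}. cmod (f j 0) \<le> cmod (f k 0)) U"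
    using p by (intro always_eventually allI exists_maximal_index) auto
  from eventually_finite_Ex[OF finite_atLeastAtMost this]
  obtain k where k: "k \<in> {1..p}" "eventually (\<lambda>f. \<forall>j\<in>{1..p}. cmod (f j 0) \<le> cmod (f k 0)) U"
    by blast
  have "null k"
    by (rule null_of_dominant[OF k(1), of "1/2" "\<lambda>_. 0" 1]) (use k in auto)
  then show ?thesis using k by (auto simp: I_all_def)
qed

text \<open>Otherwise there are points \<open>zz f\<close> where the ratio is at least
  \<open>\<epsilon>\<close>. The largest component outside \<open>I_all\<close> at these points
  dominates those inside as well, up to \<open>1 / \<epsilon>\<close>, so its class would be
  null.\<close>

lemma dominated:
  assumes i: "i \<in> {1..p} - I_all" and \<epsilon>: "\<epsilon> > 0" and s: "0 < s" "s < 1"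
  shows "eventually (\<lambda>f. \<forall>z\<in>ball 0 s. cmod (f i z) / sqrt (\<Sum>j\<in>I_all. (cmod (f j z))\<^sup>2) < \<epsilon>) U"
proof (rule ccontr)
  define N where "N f z = sqrt (\<Sum>j\<in>I_all. (cmod (f j z))\<^sup>2)" for f :: "nat \<Rightarrow> complex \<Rightarrow> complex" and z
  assume "\<not> ?thesis"
  then have "eventually (\<lambda>f. \<not> (\<forall>z\<in>ball 0 s. cmod (f i z) / N f z < \<epsilon>)) U"
    by (simp only: N_def not_eventually_iff)
  then have ev: "eventually (\<lambda>f. \<exists>z. z \<in> ball 0 s \<and> \<epsilon> \<le> cmod (f i z) / N f z) U"
    by eventually_elim (auto simp: not_less)
  define zz where "zz f = (SOME z. z \<in> ball 0 s \<and> \<epsilon> \<le> cmod (f i z) / N f z)" for f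
  have zz: "eventually (\<lambda>f. zz f \<in> ball 0 s \<and> \<epsilon> \<le> cmod (f i (zz f)) / N f (zz f)) U"
    using ev unfolding zz_def by eventually_elim (rule someI_ex)
  have "eventually (\<lambda>f. \<exists>k\<in>{1..p} - I_all. \<forall>j\<in>{1..p} - I_all. cmod (f j (zz f)) \<le> cmod (f k (zz f))) U"
    using i by (intro always_eventually allI exists_maximal_index) auto
  from eventually_finite_Ex[OF finite_Diff[OF finite_atLeastAtMost] this]
  obtain k where k: "k \<in> {1..p} - I_all"
    "eventually (\<lambda>f. \<forall>j\<in>{1..p} - I_all. cmod (f j (zz f)) \<le> cmod (f k (zz f))) U"
    by blast
  have "null k"
  proof (rule null_of_dominant[OF _ s, of k zz "max 1 (1 / \<epsilon>)"])
    show "k \<in> {1..p}" using k by simp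
    show "eventually (\<lambda>f. zz f \<in> cball 0 s) U" using zz by eventually_elim auto
    show "eventually (\<lambda>f. \<forall>j\<in>{1..p}. cmod (f j (zz f)) \<le> max 1 (1 / \<epsilon>) * cmod (f k (zz f))) U"
      using zz k(2)
    proof eventually_elim
      case (elim f)
      define x where "x = cmod (f k (zz f))"
      have x0: "x \<ge> 0" by (simp add: x_def)
      have fi: "cmod (f i (zz f)) \<le> x" using elim i by (simp add: x_def)
      have N0: "N f (zz f) \<ge> 0" by (simp add: N_def sum_nonneg)
      \<comment> \<open>Division by zero yields \<open>0\<close>, which is less than
        \<open>\<epsilon>\<close>.\<close>
      have "N f (zz f) \<noteq> 0" using elim \<epsilon> by auto
      then have Np: "N f (zz f) > 0" using N0 by simp
      then have "\<epsilon> * N f (zz f) \<le> cmod (f i (zz f))" using elim by (simp add: pos_le_divide_eq)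
      then have Nx: "N f (zz f) \<le> 1 / \<epsilon> * x" using fi \<epsilon> by (simp add: field_simps)
      show ?case
      proof
        fix j assume j: "j \<in> {1..p}"
        show "cmod (f j (zz f)) \<le> max 1 (1 / \<epsilon>) * cmod (f k (zz f))"
        proof (cases "j \<in> I_all")
          case True
          have "finite I_all" by (simp add: I_all_def)
          then have "(cmod (f j (zz f)))\<^sup>2 \<le> (\<Sum>j\<in>I_all. (cmod (f j (zz f)))\<^sup>2)"
            using True by (intro member_le_sum) auto
          then have "cmod (f j (zz f)) \<le> N f (zz f)" unfolding N_def by (rule real_le_rsqrt)
          also have "\<dots> \<le> 1 / \<epsilon> * x" by (rule Nx)
          also have "\<dots> \<le> max 1 (1 / \<epsilon>) * x" using x0 by (intro mult_right_mono) auto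
          finally show ?thesis by (simp add: x_def)
        next
          case False
          then have "cmod (f j (zz f)) \<le> 1 * x" using elim j by (simp add: x_def)
          also have "\<dots> \<le> max 1 (1 / \<epsilon>) * x" using x0 by (intro mult_right_mono) auto
          finally show ?thesis by (simp add: x_def)
        qed
      qed
    qed
  qed
  then show False using k by (auto simp: I_all_def)
qed

text \<open>The class sum of a singleton is \<open>lim_quot i i\<close>, which has no zeros.\<close>

lemma card_null_cls:
  assumes i: "i \<in> I_all" shows "card (cls i) \<ge> 2"
proof (rule ccontr)
  assume c: "\<not> card (cls i) \<ge> 2"
  have ip: "i \<in> {1..p}" and n: "null i" using i by (auto simp: I_all_def)
  have fin: "finite (cls i)" by (simp add: cls_def)
  have ii: "i \<in> cls i" using ip sim_refl by (simp add: cls_def)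
  have "cls i = {i}"
  proof -
    have "card (cls i) \<le> card {i}" using c by simp
    then show ?thesis using card_seteq[of "cls i" "{i}"] fin ii by simp
  qed
  then have "lim_quot i i 0 = 0" using n by (simp add: null_def)
  then show False using lim_quot(4)[OF ip ip sim_refl[OF ip], of 0] by simp
qed

end

section \<open>From the ultrafilter to an infinite subset\<close>

lemma exists_inj_choice:
  fixes P :: "nat \<Rightarrow> 'a \<Rightarrow> bool"
  assumes "\<And>m E. finite E \<Longrightarrow> \<exists>x. x \<notin> E \<and> P m x"
  obtains g where "inj g" "\<And>m. P m (g m)"
proof -
  have "\<exists>g. \<forall>m. (\<lambda>g m x. x \<notin> g ` {..<m} \<and> P m x) g m (g m)"
  proof (rule dependent_wellorder_choice)
    fix r :: 'a and f g :: "nat \<Rightarrow> 'a" and x :: nat assume *: "\<And>y::nat. y < x \<Longrightarrow> f y = g y"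
    have "f ` {..<x} = g ` {..<x}" by (rule image_cong) (use * in auto)
    then show "(r \<notin> f ` {..<x} \<and> P x r) = (r \<notin> g ` {..<x} \<and> P x r)" by simp
  next
    fix x :: nat and f :: "nat \<Rightarrow> 'a" show "\<exists>r. r \<notin> f ` {..<x} \<and> P x r" by (rule assms) simp
  qed
  then obtain g where g: "\<And>m. g m \<notin> g ` {..<m}" "\<And>m. P m (g m)" by blast
  have "inj g"
  proof (rule linorder_injI)
    fix x y :: nat assume "x < y"
    then have "g x \<in> g ` {..<y}" by simp
    then show "g x \<noteq> g y" using g(1)[of y] by metis
  qed
  with g(2) that show ?thesis by blast
qed

lemma compact_in_disc:
  assumes "compact K" "K \<subseteq> unit_disc" obtains r where "r < 1" "K \<subseteq> cball 0 r"
proof (cases "K = {}")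
  case False
  then obtain x where x: "x \<in> K" "\<And>y. y \<in> K \<Longrightarrow> cmod y \<le> cmod x"
    using continuous_attains_sup[OF assms(1) False, of cmod] continuous_on_norm_id by auto
  show ?thesis by (rule that[of "cmod x"]) (use x assms in auto)
qed (use that[of 0] in auto)

lemma holds_almost_all_of_all: "\<gamma> > 0 \<Longrightarrow> (\<And>w. w \<in> W \<Longrightarrow> P w) \<Longrightarrow> holds_almost_all \<gamma> W P"
  unfolding holds_almost_all_def by (intro exI[of _ "{}"]) auto

lemma converges_on_compacts_sum:
  fixes h :: "'k \<Rightarrow> 'i \<Rightarrow> complex \<Rightarrow> complex"
  assumes "finite A" "\<And>k. k \<in> A \<Longrightarrow> converges_on_compacts J (h k) (g k)"
  shows "converges_on_compacts J (\<lambda>i z. \<Sum>k\<in>A. h k i z) (\<lambda>z. \<Sum>k\<in>A. g k z)"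
  unfolding converges_on_compacts_def
proof (intro allI impI)
  fix K :: "complex set" and \<epsilon> :: real assume K: "compact K \<and> K \<subseteq> unit_disc" and \<epsilon>: "\<epsilon> > 0"
  define \<eta> where "\<eta> = \<epsilon> / (card A + 1)"
  have \<eta>: "\<eta> > 0" using \<epsilon> by (simp add: \<eta>_def)
  have "\<forall>k\<in>A. \<exists>E. finite E \<and> E \<subseteq> J \<and> (\<forall>z\<in>K. \<forall>i\<in>J - E. dist (h k i z) (g k z) < \<eta>)"
    using assms(2) K \<eta> unfolding converges_on_compacts_def by blast
  from bchoice[OF this] obtain E where
    E: "\<forall>k\<in>A. finite (E k) \<and> E k \<subseteq> J \<and> (\<forall>z\<in>K. \<forall>i\<in>J - E k. dist (h k i z) (g k z) < \<eta>)" ..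
  have "dist (\<Sum>k\<in>A. h k i z) (\<Sum>k\<in>A. g k z) < \<epsilon>" if "z \<in> K" "i \<in> J - (\<Union>k\<in>A. E k)" for z i
  proof -
    have "dist (\<Sum>k\<in>A. h k i z) (\<Sum>k\<in>A. g k z) = cmod (\<Sum>k\<in>A. h k i z - g k z)"
      by (simp add: dist_norm sum_subtractf)
    also have "\<dots> \<le> card A * \<eta>"
    proof (rule order_trans[OF sum_norm_le[where g = "\<lambda>_. \<eta>"]])
      fix k assume k: "k \<in> A"
      have "dist (h k i z) (g k z) < \<eta>" using E k that by blast
      then show "cmod (h k i z - g k z) \<le> \<eta>" by (simp add: dist_norm)
    qed simp
    also have "\<dots> < (card A + 1) * \<eta>" using \<eta> by (simp add: algebra_simps)
    also have "\<dots> = \<epsilon>" by (simp add: \<eta>_def)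
    finally show ?thesis .
  qed
  then show "\<exists>E. finite E \<and> E \<subseteq> J \<and> (\<forall>z\<in>K. \<forall>i\<in>J - E. dist (\<Sum>k\<in>A. h k i z) (\<Sum>k\<in>A. g k z) < \<epsilon>)"
    using E assms(1) by (intro exI[of _ "\<Union>k\<in>A. E k"]) blast
qed

lemma converges_on_compacts_cong:
  assumes c: "converges_on_compacts J h g" and eq: "\<And>z. z \<in> unit_disc \<Longrightarrow> g z = g' z"
  shows "converges_on_compacts J h g'"
  unfolding converges_on_compacts_def
proof (intro allI impI)
  fix K :: "complex set" and \<epsilon> :: real assume K: "compact K \<and> K \<subseteq> unit_disc" and \<epsilon>: "\<epsilon> > 0"
  from c[unfolded converges_on_compacts_def, rule_format, OF K \<epsilon>]
  obtain E where E: "finite E" "E \<subseteq> J" "\<forall>z\<in>K. \<forall>i\<in>J - E. dist (h i z) (g z) < \<epsilon>" by blast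
  have "dist (h i z) (g' z) < \<epsilon>" if z: "z \<in> K" and i: "i \<in> J - E" for z i
  proof -
    have "g z = g' z" using K z by (intro eq) blast
    moreover have "dist (h i z) (g z) < \<epsilon>" using E(3) z i by blast
    ultimately show ?thesis by simp
  qed
  then show "\<exists>E. finite E \<and> E \<subseteq> J \<and> (\<forall>z\<in>K. \<forall>i\<in>J - E. dist (h i z) (g' z) < \<epsilon>)"
    using E(1,2) by blast
qed

theorem theorem1p7:
  fixes p :: nat and F :: "(nat \<Rightarrow> complex \<Rightarrow> complex) set"
  assumes "infinite F"
    and "F \<subseteq> nonvanishing_tuples p"
    and "\<And>f z. f \<in> F \<Longrightarrow> z \<in> unit_disc \<Longrightarrow> (\<Sum>i=1..p. f i z) = 0"
  shows "\<exists>(n::nat) (I :: nat \<Rightarrow> nat set) G.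
    (\<forall>k\<in>{1..n}. I k \<subseteq> {1..p} \<and> I k \<noteq> {}) \<and>
    disjoint_family_on I {1..n} \<and>
    G \<subseteq> F \<and> infinite G \<and>
    n \<ge> 1 \<and>
    (\<forall>k\<in>{1..n}.
      (\<forall>i\<in>I k. \<forall>j\<in>I k. \<exists>h. h holomorphic_on unit_disc \<and> (\<forall>z\<in>unit_disc. h z \<noteq> 0) \<and>
         converges_on_compacts G (\<lambda>f z. f i z / f j z) h) \<and>
      (\<forall>j\<in>I k. converges_on_compacts G (\<lambda>f z. \<Sum>i\<in>I k. f i z / f j z) (\<lambda>_. 0)) \<and>
      card (I k) \<ge> 2) \<and>
    (\<forall>i\<in>{1..p} - (\<Union>k\<in>{1..n}. I k). \<forall>\<epsilon>>0. \<forall>s\<in>{0<..<1}. \<forall>\<gamma>>0.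
      \<exists>E. finite E \<and> E \<subseteq> G \<and>
        (\<forall>f\<in>G - E. holds_almost_all \<gamma> (ball 0 s)
           (\<lambda>z. cmod (f i z) / sqrt (\<Sum>j\<in>(\<Union>k\<in>{1..n}. I k). (cmod (f j z))\<^sup>2) < \<epsilon>)))"
proof -
  \<comment> \<open>A countable subfamily is enough, and its enumeration supplies a function tending
    to infinity along a free ultrafilter.\<close>
  obtain e :: "nat \<Rightarrow> nat \<Rightarrow> complex \<Rightarrow> complex" where e: "inj e" "range e \<subseteq> F"
    using infinite_countable_subset[OF assms(1)] by blast
  have "infinite (range e)" using e(1) by (simp add: finite_image_iff)
  then obtain U where U: "ultrafilter U" and free: "\<And>E. finite E \<Longrightarrow> eventually (\<lambda>f. f \<in> range e - E) U"
    using free_ultrafilter_exists by blast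
  interpret ultrafilter U by (rule U)
  define \<kappa> where "\<kappa> f = real (inv e f)" for f
  have \<kappa>: "filterlim \<kappa> at_top U"
    unfolding filterlim_at_top
  proof
    fix Z :: real
    have "finite (e ` {..nat \<lceil>Z\<rceil>})" by simp
    from free[OF this] show "eventually (\<lambda>f. Z \<le> \<kappa> f) U"
    proof eventually_elim
      case (elim f)
      then obtain m where m: "f = e m" "m \<notin> {..nat \<lceil>Z\<rceil>}" by auto
      then have "\<kappa> f = real m" using e(1) by (simp add: \<kappa>_def inv_f_f)
      then show ?case using m by simp linarith
    qed
  qed
  have evF: "eventually (\<lambda>f. f \<in> F) U" using free[of "{}"] e(2) by (auto elim!: eventually_mono)
  \<comment> \<open>For \<open>p = 0\<close> there is only one tuple, so \<open>F\<close> would be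
    finite.\<close>
  have "p \<noteq> 0"
  proof
    assume "p = 0"
    then have "F \<subseteq> {\<lambda>_. undefined}" using assms(2) by (simp add: nonvanishing_tuples_def)
    then show False using assms(1) finite_subset by blast
  qed
  then interpret unit_tuples U p \<kappa>
    using evF assms(2,3) \<kappa> by unfold_locales (auto elim!: eventually_mono)
  define rr where "rr m = 1 - 1 / (real m + 2)" for m
  define ratio where "ratio i f z = cmod (f i z) / sqrt (\<Sum>j\<in>I_all. (cmod (f j z))\<^sup>2)" for i and f :: "nat \<Rightarrow> complex \<Rightarrow> complex" and z
  \<comment> \<open>Accuracy and radius are tied to one parameter \<open>m\<close>. The conditions
    are finitely many and each holds eventually, so \<open>P m\<close> does too; distinct members
    \<open>g m\<close> with \<open>P m\<close> then turn limits along \<open>U\<close> into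
    convergence off finite subsets of \<open>G\<close>.\<close>
  define P where "P m f \<longleftrightarrow> f \<in> F \<and>
    (\<forall>i\<in>{1..p}. \<forall>j\<in>{1..p}. sim i j \<longrightarrow> (\<forall>z\<in>cball 0 (rr m). dist (f i z / f j z) (lim_quot i j z) < 1 / (real m + 1))) \<and>
    (\<forall>i\<in>{1..p} - I_all. \<forall>z\<in>ball 0 (rr m). ratio i f z < 1 / (real m + 1))" for m f
  have rr: "0 < rr m" "rr m < 1" for m by (auto simp: rr_def field_simps)
  have evP: "eventually (P m) U" for m
  proof -
    have "eventually (\<lambda>f. \<forall>z\<in>cball 0 (rr m). dist (f i z / f j z) (lim_quot i j z) < 1 / (real m + 1)) U"
      if "i \<in> {1..p}" "j \<in> {1..p}" "sim i j" for i j
    proof -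
      have "eventually (\<lambda>f. \<forall>z\<in>cball 0 (rr m). dist (quot i j f z) (lim_quot i j z) < 1 / (real m + 1)) U"
        using lim_quot(2)[OF that rr(2)] by (rule uniform_limitD) simp
      then show ?thesis using quot_eq by eventually_elim simp
    qed
    then have "eventually (\<lambda>f. \<forall>i\<in>{1..p}. \<forall>j\<in>{1..p}. sim i j \<longrightarrow>
        (\<forall>z\<in>cball 0 (rr m). dist (f i z / f j z) (lim_quot i j z) < 1 / (real m + 1))) U"
      by (intro eventually_ball_finite ballI finite_atLeastAtMost) (simp add: eventually_mono)
    moreover have "eventually (\<lambda>f. \<forall>i\<in>{1..p} - I_all. \<forall>z\<in>ball 0 (rr m). ratio i f z < 1 / (real m + 1)) U"
      unfolding ratio_def using rr by (intro eventually_ball_finite ballI dominated) auto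
    ultimately show ?thesis unfolding P_def using evF by eventually_elim blast
  qed
  obtain g where g: "inj g" "\<And>m. P m (g m)"
  proof (rule exists_inj_choice[of P])
    fix m and E :: "(nat \<Rightarrow> complex \<Rightarrow> complex) set" assume "finite E"
    from eventually_conj[OF free[OF this] evP[of m]]
    have "\<exists>f. f \<in> range e - E \<and> P m f" using nontrivial eventually_happens' by blast
    then show "\<exists>x. x \<notin> E \<and> P m x" by blast
  qed blast
  define G where "G = range g"
  have infG: "infinite G" using g(1) by (simp add: G_def finite_image_iff)
  have GF: "G \<subseteq> F" using g(2) by (auto simp: G_def P_def)
  \<comment> \<open>\<open>P\<close> gets stronger with \<open>m\<close>, so it holds for all
    members of \<open>G\<close> except those chosen before stage \<open>m\<close>; these form the
    finite exceptional sets of the conclusion.\<close>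
  have Pl: "P m f" if f: "f \<in> G - g ` {..<m}" for m f
  proof -
    obtain l where l: "f = g l" "m \<le> l" using f by (force simp: G_def not_less[symmetric])
    have r: "rr m \<le> rr l" "1 / (real l + 1) \<le> 1 / (real m + 1)"
      using l(2) by (auto simp: rr_def intro!: divide_left_mono)
    have "P l f" using g(2) l by simp
    note Plf = this[unfolded P_def]
    show ?thesis unfolding P_def
    proof (intro conjI ballI impI)
      show "f \<in> F" using Plf by blast
      fix i assume i: "i \<in> {1..p}"
      fix j and z :: complex assume j: "j \<in> {1..p}" "sim i j" and z: "z \<in> cball 0 (rr m)"
      have "z \<in> cball 0 (rr l)" using z r by auto
      then have "dist (f i z / f j z) (lim_quot i j z) < 1 / (real l + 1)" using Plf i j by blast
      then show "dist (f i z / f j z) (lim_quot i j z) < 1 / (real m + 1)" using r(2) by linarith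
    next
      fix i and z :: complex assume i: "i \<in> {1..p} - I_all" and z: "z \<in> ball 0 (rr m)"
      have "z \<in> ball 0 (rr l)" using z r by auto
      then have "ratio i f z < 1 / (real l + 1)" using Plf i by blast
      then show "ratio i f z < 1 / (real m + 1)" using r(2) by linarith
    qed
  qed
  have choose: "\<exists>m. r \<le> rr m \<and> 1 / (real m + 1) < \<epsilon>" if "r < 1" "\<epsilon> > 0" for r \<epsilon> :: real
  proof -
    obtain m :: nat where m: "real m > max (1 / (1 - r)) (1 / \<epsilon>)" using reals_Archimedean2 by blast
    have "1 / (real m + 2) \<le> 1 - r"
    proof -
      have "1 / (1 - r) \<le> real m + 2" using m by simp
      then show ?thesis using that by (simp add: field_simps)
    qed
    moreover have "1 / (real m + 1) < \<epsilon>"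
    proof -
      have "1 / \<epsilon> < real m + 1" using m by simp
      then show ?thesis using that by (simp add: field_simps)
    qed
    ultimately show ?thesis by (intro exI[of _ m]) (simp add: rr_def)
  qed
  have conv: "converges_on_compacts G (\<lambda>f z. f i z / f j z) (lim_quot i j)"
    if ij: "i \<in> {1..p}" "j \<in> {1..p}" "sim i j" for i j
    unfolding converges_on_compacts_def
  proof (intro allI impI)
    fix K :: "complex set" and \<epsilon> :: real assume K: "compact K \<and> K \<subseteq> unit_disc" and \<epsilon>: "\<epsilon> > 0"
    obtain r where r: "r < 1" "K \<subseteq> cball 0 r" using compact_in_disc K by blast
    obtain m where m: "r \<le> rr m" "1 / (real m + 1) < \<epsilon>" using choose r(1) \<epsilon> by blast
    have "dist (f i z / f j z) (lim_quot i j z) < \<epsilon>" if f: "f \<in> G - g ` {..<m}" and z: "z \<in> K" for f z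
    proof -
      have "z \<in> cball 0 (rr m)" using z r m by auto
      then have "dist (f i z / f j z) (lim_quot i j z) < 1 / (real m + 1)"
        using Pl[OF f] ij unfolding P_def by blast
      then show ?thesis using m by simp
    qed
    then show "\<exists>E. finite E \<and> E \<subseteq> G \<and> (\<forall>z\<in>K. \<forall>f\<in>G - E. dist (f i z / f j z) (lim_quot i j z) < \<epsilon>)"
      by (intro exI[of _ "g ` {..<m}"]) (auto simp: G_def)
  qed
  \<comment> \<open>A set of classes rather than a family over \<open>I_all\<close>, since
    equivalent indices give the same block.\<close>
  define Bl where "Bl = cls ` I_all"
  have finI: "finite I_all" by (simp add: I_all_def)
  then obtain I where I: "bij_betw I {1..card Bl} Bl"
    using ex_bij_betw_nat_finite_1[of Bl] by (auto simp: Bl_def)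
  have self: "i \<in> cls i" if "i \<in> {1..p}" for i using that sim_refl by (simp add: cls_def)
  have IB: "\<exists>i\<in>I_all. I k = cls i" if "k \<in> {1..card Bl}" for k
  proof -
    have "I k \<in> cls ` I_all" using bij_betwE[OF I] that by (simp only: Bl_def)
    then show ?thesis by blast
  qed
  \<comment> \<open>Being null is constant on classes, so the null classes exhaust
    \<open>I_all\<close> without leaving it.\<close>
  have UB: "(\<Union>k\<in>{1..card Bl}. I k) = I_all"
  proof -
    have "(\<Union>k\<in>{1..card Bl}. I k) = \<Union>Bl" using bij_betw_imp_surj_on[OF I] by simp
    also have "\<dots> = I_all"
      unfolding Bl_def using self null_cls by (auto simp: I_all_def cls_def)
    finally show ?thesis .
  qed
  have disj: "disjoint_family_on I {1..card Bl}"
    unfolding disjoint_family_on_def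
  proof (intro ballI impI)
    fix k l assume k: "k \<in> {1..card Bl}" and l: "l \<in> {1..card Bl}" and kl: "k \<noteq> l"
    obtain i j where i: "i \<in> I_all" "I k = cls i" and j: "j \<in> I_all" "I l = cls j" using IB k l by meson
    have ne: "I k \<noteq> I l" using bij_betw_imp_inj_on[OF I] k l kl by (auto dest: inj_onD)
    have ijp: "i \<in> {1..p}" "j \<in> {1..p}" using i j by (auto simp: I_all_def)
    show "I k \<inter> I l = {}"
    proof (rule ccontr)
      assume "I k \<inter> I l \<noteq> {}"
      then obtain x where "x \<in> cls i" "x \<in> cls j" using i j by auto
      then have "cls i = cls j" using cls_eq ijp by metis
      then show False using ne i j by simp
    qed
  qed
  have card_Bl: "card Bl \<ge> 1"
    using I_all_nonempty finI by (simp add: Bl_def Suc_le_eq card_gt_0_iff)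
  have I_sub: "I k \<subseteq> {1..p} \<and> I k \<noteq> {}" if "k \<in> {1..card Bl}" for k
    using IB[OF that] self by (auto simp: I_all_def cls_def)
  have I_conv: "(\<forall>i\<in>I k. \<forall>j\<in>I k. \<exists>h. h holomorphic_on unit_disc \<and> (\<forall>z\<in>unit_disc. h z \<noteq> 0) \<and>
         converges_on_compacts G (\<lambda>f z. f i z / f j z) h) \<and>
      (\<forall>j\<in>I k. converges_on_compacts G (\<lambda>f z. \<Sum>i\<in>I k. f i z / f j z) (\<lambda>_. 0)) \<and>
      card (I k) \<ge> 2" if k: "k \<in> {1..card Bl}" for k
  proof -
    obtain i0 where i0: "i0 \<in> I_all" "I k = cls i0" using IB[OF k] by blast
    have i0p: "i0 \<in> {1..p}" "null i0" using i0 by (auto simp: I_all_def)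
    have D: "i \<in> {1..p}" "sim i i0" if "i \<in> I k" for i using that i0 by (auto simp: cls_def)
    have simI: "sim i j" if "i \<in> I k" "j \<in> I k" for i j
      using sim_trans[OF D(1)[OF that(1)] i0p(1) D(1)[OF that(2)] D(2)[OF that(1)] sim_sym[OF D(2)[OF that(2)]]] .
    have "converges_on_compacts G (\<lambda>f z. \<Sum>i\<in>I k. f i z / f j z) (\<lambda>_. 0)" if j: "j \<in> I k" for j
    proof -
      have jc: "j \<in> cls i0" using j i0 by simp
      have "converges_on_compacts G (\<lambda>f z. \<Sum>i\<in>I k. f i z / f j z) (\<lambda>z. \<Sum>i\<in>I k. lim_quot i j z)"
      proof (rule converges_on_compacts_sum)
        show "finite (I k)" by (simp add: i0(2) cls_def)
        show "converges_on_compacts G (\<lambda>f z. f i z / f j z) (lim_quot i j)" if "i \<in> I k" for i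
          by (rule conv[OF D(1)[OF that] D(1)[OF j] simI[OF that j]])
      qed
      moreover have "(\<Sum>i\<in>I k. lim_quot i j z) = 0" if "z \<in> unit_disc" for z
        using null_cls[OF i0p(1) jc i0p(2)] that i0 cls_eq[OF i0p(1) jc] by (simp add: null_def)
      ultimately show ?thesis by (rule converges_on_compacts_cong)
    qed
    moreover have "\<exists>h. h holomorphic_on unit_disc \<and> (\<forall>z\<in>unit_disc. h z \<noteq> 0) \<and>
         converges_on_compacts G (\<lambda>f z. f i z / f j z) h" if "i \<in> I k" "j \<in> I k" for i j
      using lim_quot(1,4)[OF D(1)[OF that(1)] D(1)[OF that(2)] simI[OF that]]
        conv[OF D(1)[OF that(1)] D(1)[OF that(2)] simI[OF that]] by blast
    moreover have "card (I k) \<ge> 2" using card_null_cls[OF i0(1)] i0 by simp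
    ultimately show ?thesis by blast
  qed
  have I_rest: "\<exists>E. finite E \<and> E \<subseteq> G \<and>
        (\<forall>f\<in>G - E. holds_almost_all \<gamma> (ball 0 s) (\<lambda>z. cmod (f i z) / sqrt (\<Sum>j\<in>I_all. (cmod (f j z))\<^sup>2) < \<epsilon>))"
    if i: "i \<in> {1..p} - I_all" and \<epsilon>: "\<epsilon> > 0" and s: "s \<in> {0<..<1}" and \<gamma>: "\<gamma> > 0" for i \<epsilon> s \<gamma>
  proof -
    obtain m where m: "s \<le> rr m" "1 / (real m + 1) < \<epsilon>" using choose[of s \<epsilon>] s \<epsilon> by auto
    have "ratio i f z < \<epsilon>" if f: "f \<in> G - g ` {..<m}" and z: "z \<in> ball 0 s" for f z
    proof -
      have "z \<in> ball 0 (rr m)" using z m by auto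
      then have "ratio i f z < 1 / (real m + 1)" using Pl[OF f] i unfolding P_def by blast
      then show ?thesis using m by simp
    qed
    then have "holds_almost_all \<gamma> (ball 0 s) (\<lambda>z. cmod (f i z) / sqrt (\<Sum>j\<in>I_all. (cmod (f j z))\<^sup>2) < \<epsilon>)"
      if "f \<in> G - g ` {..<m}" for f
      using that unfolding ratio_def by (intro holds_almost_all_of_all[OF \<gamma>]) blast
    moreover have "finite (g ` {..<m})" "g ` {..<m} \<subseteq> G" by (auto simp: G_def)
    ultimately show ?thesis by blast
  qed
  show ?thesis
  proof (rule exI[of _ "card Bl"], rule exI[of _ I], rule exI[of _ G], unfold UB, intro conjI)
    show "\<forall>k\<in>{1..card Bl}. I k \<subseteq> {1..p} \<and> I k \<noteq> {}" by (intro ballI I_sub)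
  qed (fact disj GF infG card_Bl | rule ballI, erule I_conv | intro ballI allI impI, rule I_rest; assumption)+
qed

end
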